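(* Let $p$ and $q$ be relatively prime positive integers with $p/q\ne1/3$, let $a,b,c>0$ satisfy $a^2+b^2=c^2$ and $\ln(a/c)/\ln(b/2c)=p/q$, and put $m=\max(p,q)$, $r=(a/c)^{1/p}=(b/2c)^{1/q}$. Let $f$ be a continuous function on $X$, and let $\{S_n\}$ be a sequence of supertiles of increasing size. Let $d\nu=\sum_k\nu_k\,d\Omega_k$ and $d\rho=\sum_k\rho_k\,d\Omega_k$ be measures on $X$, where, for $k=1,\dots,m$, $$\nu_k=\frac{1-r^2}{4c^2}\bigl(a^2H(p-k)+b^2H(q-k)\bigr)r^{-2k},\qquad \rho_k=\frac{a^2H(p-k)+b^2H(q-k)}{pa^2+qb^2},$$ with $H(n)=1$ for $n\ge0$ and $H(n)=0$ for $n<0$. Then $$\lim_{n\to\infty}\langle f,S_n\rangle=\int_X f\,d\nu,\qquad \lim_{n\to\infty}\langle f,S_n\rangle'=\int_X f\,d\rho .$$ These limits also hold if $f$ is the characteristic function of an interval in $X$.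
   Context: Let $\theta=\arcsin(a/c)$. A tile is a right triangle with an ordered triple of vertices $(A,C,B)$, with right angle at $C$ and angle $\theta$ at $A$, so that $|AC|:|CB|:|AB|=b:a:c$. Subdivision rule: let $F$ be the foot of the perpendicular from $C$ to $AB$, and let $M,N,K$ be the midpoints of $AC$, $AF$, $FC$. The tile $(A,C,B)$ is divided into the five daughter tiles $(A,N,M)$, $(M,K,C)$, $(M,K,F)$, $(F,N,M)$ (each smaller than the parent by the linear factor $b/(2c)=r^q$) and $(C,F,B)$ (smaller by the linear factor $a/c=r^p$). For $k=1,\dots,m$, a tile of size $D_k$ is a tile with hypotenuse $c\,r^k$. The substitution $\Phi$ acts on finite collections of tiles with sizes among $D_1,\dots,D_m$: expand linearly by the factor $r^{-1}$ and then subdivide once each expanded tile coming from a tile of size $D_1$. Thus $\Phi$ takes a tile of size $D_{k+1}$ to one tile of size $D_k$ with the same orientation, and a tile of size $D_1$ to one tile of size $D_p$ and four of size $D_q$. A sequence of supertiles of increasing size means $S_n=\Phi^{j_n}(t_n)$ with $j_n\to\infty$, where each $t_n$ is a single tile with size among $D_1,\dots,D_m$ and arbitrary orientation. The orientation of a tile $(A,C,B)$ is $\Omega=(\pm,\phi)$, where $\pm$ is the handedness of the triangle and $\phi\in\mathbb R/2\pi\mathbb Z$ is the direction of the vector from $A$ to $C$. The space of orientations is two copies of the circle, with Haar measure $d\Omega=d\phi/4\pi$. The space of tiles up to translation is $X=\{1,\dots,m\}\times\{+,-\}\times S^1$ ($2m$ circles), and $d\Omega_k$ is the measure $d\Omega$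 on the two circles of size $D_k$. An interval in $X$ is an interval in one of these circles. For a function $f$ on $X$ and a finite collection $S$ of tiles, $\langle f,S\rangle$ is the average of $f$ over the tiles of $S$ with each tile given equal weight, and $\langle f,S\rangle'$ is the average with each tile weighted proportionally to its area. *)

theory Defs
  imports "HOL-Analysis.Analysis" "HOL-Library.Multiset"
begin

(* The plane is the type of complex numbers; a tile is its ordered triple of vertices (A, C, B). *)
type_synonym tile = "complex \<times> complex \<times> complex"

(* Tiles of size D_k, i.e. with hypotenuse c r^k.  The angle arcsin (a/c) at A is determined by
   the side lengths; no position or direction is prescribed. *)
definition tile_of_size :: "real \<Rightarrow> real \<Rightarrow> real \<Rightarrow> real \<Rightarrow> nat \<Rightarrow> tile \<Rightarrow> bool" where
  "tile_of_size a b c r k = (\<lambda>(A, C, B).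
     inner (A - C) (B - C) = 0 \<and>
     dist A C = b * r ^ k \<and> dist C B = a * r ^ k \<and> dist A B = c * r ^ k)"

definition foot :: "complex \<Rightarrow> complex \<Rightarrow> complex \<Rightarrow> complex" where
  "foot C A B = A + (inner (C - A) (B - A) / inner (B - A) (B - A)) *\<^sub>R (B - A)"

lemma foot_perpendicular:
  assumes "A \<noteq> B"
  shows "foot C A B \<in> affine hull {A, B}" "inner (C - foot C A B) (B - A) = 0"
proof -
  define s where "s = inner (C - A) (B - A) / inner (B - A) (B - A)"
  have "foot C A B = (1 - s) *\<^sub>R A + s *\<^sub>R B"
    unfolding foot_def s_def[symmetric] by (simp add: algebra_simps)
  then show "foot C A B \<in> affine hull {A, B}"
    unfolding affine_hull_2 by (metis (mono_tags, lifting) diff_add_cancel mem_Collect_eq)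
  have "inner (B - A) (B - A) \<noteq> 0"
    using assms by simp
  moreover have e: "C - foot C A B = (C - A) - s *\<^sub>R (B - A)"
    unfolding foot_def s_def by simp
  ultimately show "inner (C - foot C A B) (B - A) = 0"
    unfolding e inner_diff_left[of "C - A"] inner_scaleR_left s_def by simp
qed

definition subdivide :: "tile \<Rightarrow> tile multiset" where
  "subdivide = (\<lambda>(A, C, B).
     let F = foot C A B; M = midpoint A C; N = midpoint A F; K = midpoint F C
     in {#(A, N, M), (M, K, C), (M, K, F), (F, N, M), (C, F, B)#})"

definition expand :: "real \<Rightarrow> tile \<Rightarrow> tile" where
  "expand s = (\<lambda>(A, C, B). (s *\<^sub>R A, s *\<^sub>R C, s *\<^sub>R B))"

definition hypotenuse :: "tile \<Rightarrow> real" where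
  "hypotenuse = (\<lambda>(A, C, B). dist A B)"

(* The substitution Phi; a tile has size D_1 iff its hypotenuse is c r. *)
definition substitution :: "real \<Rightarrow> real \<Rightarrow> tile multiset \<Rightarrow> tile multiset" where
  "substitution c r S =
     (\<Sum>t\<in>#S. if hypotenuse t = c * r then subdivide (expand (inverse r) t)
             else {#expand (inverse r) t#})"

definition supertile_sequence ::
    "real \<Rightarrow> real \<Rightarrow> real \<Rightarrow> real \<Rightarrow> nat \<Rightarrow> (nat \<Rightarrow> tile multiset) \<Rightarrow> bool" where
  "supertile_sequence a b c r m S \<longleftrightarrow>
     (\<exists>j t. filterlim j at_top sequentially \<and>
        (\<forall>n. (\<exists>k\<in>{1..m}. tile_of_size a b c r k (t n)) \<and>
             S n = (substitution c r ^^ j n) {#t n#}))"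

(* The space X of tiles up to translation.  In (k, s, u), k is the size, s the handedness, and the
   direction phi modulo 2 pi is represented by the unit vector u = cis phi. *)
definition tile_space :: "nat \<Rightarrow> (nat \<times> bool \<times> complex) set" where
  "tile_space m = {1..m} \<times> UNIV \<times> sphere 0 1"

(* The handedness is True iff A, C, B are in counterclockwise order. *)
definition orientation :: "tile \<Rightarrow> bool \<times> complex" where
  "orientation = (\<lambda>(A, C, B). (Im (cnj (C - A) * (B - A)) > 0, sgn (C - A)))"

definition tile_class :: "real \<Rightarrow> real \<Rightarrow> tile \<Rightarrow> nat \<times> bool \<times> complex" where
  "tile_class c r t = ((THE k. hypotenuse t = c * r ^ k), orientation t)"

definition interval_of :: "nat \<Rightarrow> (nat \<times> bool \<times> complex) set \<Rightarrow> bool" where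
  "interval_of m I \<longleftrightarrow>
     (\<exists>k\<in>{1..m}. \<exists>s. \<exists>J::real set. is_interval J \<and> I = {k} \<times> {s} \<times> cis ` J)"

definition tile_area :: "tile \<Rightarrow> real" where
  "tile_area = (\<lambda>(A, C, B). measure lebesgue (convex hull {A, C, B}))"

definition weighted_average :: "(tile \<Rightarrow> real) \<Rightarrow> (tile \<Rightarrow> complex) \<Rightarrow> tile multiset \<Rightarrow> complex" where
  "weighted_average w g S = (\<Sum>t\<in>#S. of_real (w t) * g t) / of_real (\<Sum>t\<in>#S. w t)"

definition tile_average ::
    "real \<Rightarrow> real \<Rightarrow> (nat \<times> bool \<times> complex \<Rightarrow> complex) \<Rightarrow> tile multiset \<Rightarrow> complex" where
  "tile_average c r f = weighted_average (\<lambda>_. 1) (\<lambda>t. f (tile_class c r t))"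

definition tile_area_average ::
    "real \<Rightarrow> real \<Rightarrow> (nat \<times> bool \<times> complex \<Rightarrow> complex) \<Rightarrow> tile multiset \<Rightarrow> complex" where
  "tile_area_average c r f = weighted_average tile_area (\<lambda>t. f (tile_class c r t))"

(* The measure d Omega = d phi / (4 pi) on two copies of the circle (total mass 1). *)
definition orientation_measure :: "(bool \<times> complex) measure" where
  "orientation_measure =
     count_space UNIV \<Otimes>\<^sub>M
     distr (density lborel (\<lambda>\<phi>. ennreal (indicator {0..<2 * pi} \<phi> / (4 * pi))))
           (restrict_space borel (sphere 0 1)) cis"

(* The measure sum_k w_k d Omega_k on X, for weights w_k \<ge> 0. *)
definition weighted_measure :: "nat \<Rightarrow> (nat \<Rightarrow> real) \<Rightarrow> (nat \<times> bool \<times> complex) measure" where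
  "weighted_measure m w =
     density (count_space {1..m} \<Otimes>\<^sub>M orientation_measure) (\<lambda>(k, _). ennreal (w k))"

lemma space_weighted_measure: "space (weighted_measure m w) = tile_space m"
  by (auto simp: weighted_measure_def orientation_measure_def tile_space_def
      space_pair_measure space_restrict_space)

definition H :: "int \<Rightarrow> real" where
  "H n = (if n \<ge> 0 then 1 else 0)"

definition nu :: "nat \<Rightarrow> nat \<Rightarrow> real \<Rightarrow> real \<Rightarrow> real \<Rightarrow> real \<Rightarrow> nat \<Rightarrow> real" where
  "nu p q a b c r k =
     (1 - r\<^sup>2) / (4 * c\<^sup>2) *
     (a\<^sup>2 * H (int p - int k) + b\<^sup>2 * H (int q - int k)) * r powi (- 2 * int k)"

definition rho :: "nat \<Rightarrow> nat \<Rightarrow> real \<Rightarrow> real \<Rightarrow> nat \<Rightarrow> real" where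
  "rho p q a b k =
     (a\<^sup>2 * H (int p - int k) + b\<^sup>2 * H (int q - int k)) / (real p * a\<^sup>2 + real q * b\<^sup>2)"

end

theory Submission
  imports Defs "HOL-Computational_Algebra.Fundamental_Theorem_Algebra"
begin

text \<open>
  Weighting tiles by area turns the substitution into a Markov operator on functions on the space
  of tiles up to translation: a tile of size \<open>D\<^sub>1\<close> is sent to \<open>D\<^sub>p\<close> with probability \<open>a\<^sup>2 / c\<^sup>2\<close> and
  to \<open>D\<^sub>q\<close> with probability \<open>b\<^sup>2 / c\<^sup>2\<close>.  It acts on each Fourier mode by a linear recursion on the
  coefficients.  The zeroth mode is a renewal process, which converges because \<open>p\<close> and \<open>q\<close> are coprime.
  The other modes decay: odd ones because the daughters of type \<open>(M, K, F)\<close> and \<open>(F, N, M)\<close>, of equal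
  chirality and opposite direction, cancel, even nonzero ones because the angle of the tile is an
  irrational multiple of \<open>\<pi>\<close>.  For the latter, \<open>s = 4 sin\<^sup>2 \<theta>\<close> satisfies an equation over the rationals
  with only one root in \<open>[0, 4]\<close>, whereas for a rational multiple of \<open>\<pi>\<close> it is an algebraic integer all
  of whose conjugates lie in \<open>[0, 4]\<close>; hence \<open>s\<close> would be the integer \<open>1\<close>, \<open>2\<close> or \<open>3\<close>, which leaves only
  \<open>p / q = 1 / 3\<close>.  Continuous functions follow by
  trigonometric approximation, indicators of intervals by squeezing, and the unweighted average of \<open>f\<close> is a
  quotient of area averages of \<open>r\<^sup>-\<^sup>2\<^sup>k f\<close> and \<open>r\<^sup>-\<^sup>2\<^sup>k\<close>.
\<close>

subsection \<open>Irrationality of the angle\<close>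

text \<open>One step of the operator is no contraction: it merely relabels a tile of size D_(k+1) as
  one of size D_k, so averaging only happens with the delays p and q. Decay is therefore measured on
  scalar delay recursions, over windows of length m or 2 m. Convergence has to be uniform on the
  whole space of tiles, because the initial tile of a supertile may change its size and orientation
  with n. Fourier modes give this for free, since the direction enters only through a factor of
  modulus 1.

  The equation for s comes from computing r^(2 p q) in two ways, as (s / 4)^q and as ((4 - s) /
  16)^p.

  The weights rho_k are the tail probabilities of a random step, p with probability \<alpha> and q
  with probability \<beta>, divided by its mean. They are the coefficients of a linear functional
  that the renewal recursion conserves; comparing its value at the start with its value in the limit
  identifies the limit.\<close>

fun cheb :: "nat \<Rightarrow> 'a::comm_ring_1 poly" where
  "cheb 0 = [:2:]"
| "cheb (Suc 0) = [:0, 1:]"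
| "cheb (Suc (Suc n)) = [:0, 1:] * cheb (Suc n) - cheb n"

text \<open>Thus \<open>cheb n\<close> is the Chebyshev polynomial in the scaling 2 T_n(x / 2), with
  z + 1 / z in the role of 2 cos. In this scaling the coefficients are integers and, for n > 0, the
  leading one is 1, which makes the roots of \<open>cheb n - [:2:]\<close> algebraic
  integers.\<close>

lemma poly_cheb:
  fixes z :: "'a::field"
  assumes "z \<noteq> 0"
  shows "poly (cheb n) (z + inverse z) = z ^ n + inverse z ^ n"
proof (induction n rule: cheb.induct)
  case (3 n)
  have "(z + inverse z) * (z ^ Suc n + inverse z ^ Suc n) - (z ^ n + inverse z ^ n)
      = z ^ Suc (Suc n) + inverse z ^ Suc (Suc n)
        + (z * inverse z - 1) * (z ^ n + inverse z ^ n)"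
    by (simp add: algebra_simps)
  then show ?case using 3 assms by simp
qed simp_all

text \<open>The index starts at \<open>Suc n\<close> because \<open>cheb 0\<close> is the constant
  2, which is not monic.\<close>

lemma degree_lead_coeff_cheb:
  "degree (cheb (Suc n) :: 'a::idom poly) = Suc n \<and> coeff (cheb (Suc n) :: 'a poly) (Suc n) = 1"
proof (induction n rule: less_induct)
  case (less n)
  show ?case
  proof (cases n)
    case (Suc k)
    let ?p = "[:0, 1:] * cheb (Suc k) :: 'a poly"
    have IH: "degree (cheb (Suc k) :: 'a poly) = Suc k" "coeff (cheb (Suc k) :: 'a poly) (Suc k) = 1"
      using less[of k] Suc by auto
    have d: "degree ?p = Suc (Suc k)"
      using IH by (subst degree_mult_eq) auto
    have "degree (cheb k :: 'a poly) < Suc (Suc k)"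
    proof (cases k)
      case (Suc l)
      then show ?thesis using less[of l] \<open>n = Suc k\<close> by simp
    qed simp
    moreover from this have "coeff (cheb k :: 'a poly) (Suc (Suc k)) = 0"
      by (rule coeff_eq_0)
    moreover have "coeff ?p (Suc (Suc k)) = 1"
      using IH by simp
    ultimately have "coeff (?p - cheb k) (Suc (Suc k)) = 1"
      by simp
    moreover have "degree (?p - cheb k) = Suc (Suc k)"
      using \<open>degree (cheb k :: 'a poly) < Suc (Suc k)\<close> d degree_add_eq_left[of "- cheb k" ?p]
      by simp
    ultimately show ?thesis
      using Suc by simp
  qed auto
qed

lemma cheb_minus_2:
  "degree (cheb (Suc n) - [:2:] :: 'a::idom poly) = Suc n"
  "coeff (cheb (Suc n) - [:2:] :: 'a poly) (Suc n) = 1"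
  using degree_lead_coeff_cheb[of n, where 'a = 'a]
    degree_add_eq_left[of "[:-2:]" "cheb (Suc n) :: 'a poly"]
  by (simp_all add: diff_conv_add_uminus del: add_uminus_conv_diff)

lemma coeff_cheb_Ints: "coeff (cheb n :: 'a::comm_ring_1 poly) i \<in> \<int>"
proof (induction n arbitrary: i rule: cheb.induct)
  case 1
  then show ?case by (cases i) (auto simp: coeff_pCons split: nat.splits)
next
  case 2
  then show ?case by (auto simp: coeff_pCons split: nat.splits)
next
  case (3 n)
  then show ?case by (auto simp: coeff_pCons split: nat.splits intro: Ints_diff)
qed

section \<open>Rational polynomials and their complex roots\<close>

lemma map_poly_of_rat_mult:
  "map_poly of_rat (f * g) = map_poly of_rat f * (map_poly of_rat g :: 'a::field_char_0 poly)"
  by (rule poly_eqI) (simp add: coeff_map_poly coeff_mult of_rat_sum of_rat_mult)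

lemma map_poly_of_rat_add:
  "map_poly of_rat (f + g) = map_poly of_rat f + (map_poly of_rat g :: 'a::field_char_0 poly)"
  by (rule poly_eqI) (simp add: coeff_map_poly of_rat_add)

lemma map_poly_of_rat_diff:
  "map_poly of_rat (f - g) = map_poly of_rat f - (map_poly of_rat g :: 'a::field_char_0 poly)"
  by (rule poly_eqI) (simp add: coeff_map_poly of_rat_diff)

lemma map_poly_of_rat_power:
  "map_poly of_rat (f ^ n) = (map_poly of_rat f :: 'a::field_char_0 poly) ^ n"
  by (induction n) (simp_all add: map_poly_of_rat_mult)

lemma map_poly_of_rat_cheb: "map_poly of_rat (cheb n) = (cheb n :: 'a::field_char_0 poly)"
  by (induction n rule: cheb.induct)
     (simp_all add: map_poly_of_rat_mult map_poly_of_rat_diff map_poly_pCons)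
text \<open>Dividing by the linear factor leaves a cofactor that does not vanish at x, since x is a
  simple root. A nonconstant cofactor would have a complex root, which could only be x.\<close>

lemma poly_eq_linear_if_unique_root:
  fixes g :: "complex poly"
  assumes "g \<noteq> 0" "poly g x = 0" and roots: "\<And>y. poly g y = 0 \<Longrightarrow> y = x"
    and simple: "poly (pderiv g) x \<noteq> 0"
  shows "degree g = 1"
proof -
  obtain h where h: "g = [:-x, 1:] * h"
    using assms(2) by (auto simp: poly_eq_0_iff_dvd)
  have hx: "poly h x \<noteq> 0"
    using simple unfolding h pderiv_mult by (auto simp: pderiv_pCons simp del: mult_pCons_left)
  have "constant (poly h)"
  proof (rule ccontr)
    assume "\<not> constant (poly h)"
    then obtain y where "poly h y = 0"
      using fundamental_theorem_of_algebra by blast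
    then show False using roots[of y] hx h by simp
  qed
  then have "degree h = 0"
    by (simp add: constant_degree)
  then show ?thesis
    using assms(1) by (simp add: h degree_mult_eq del: mult_pCons_left)
qed

text \<open>A polynomial of minimal degree over the rationals with root \<open>x\<close> divides both \<open>f\<close> and \<open>g\<close>,
  so \<open>x\<close> is its only root, and the root is simple by minimality.\<close>

lemma rational_if_unique_common_root:
  fixes x :: complex and f g :: "rat poly"
  assumes "f \<noteq> 0" "poly (map_poly of_rat f) x = 0" "poly (map_poly of_rat g) x = 0"
    and uniq: "\<And>y. poly (map_poly of_rat f) y = 0 \<Longrightarrow> poly (map_poly of_rat g) y = 0 \<Longrightarrow> y = x"
  shows "x \<in> \<rat>"
proof -
  let ?R = "\<lambda>h. h \<noteq> 0 \<and> poly (map_poly of_rat h) x = 0"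
  obtain h where h: "?R h" and min: "\<And>h'. ?R h' \<Longrightarrow> degree h \<le> degree h'"
    using ex_has_least_nat[of ?R f degree] assms by blast
  have dvd: "h dvd k" if "poly (map_poly of_rat k) x = 0" for k :: "rat poly"
  proof -
    have "k = k div h * h + k mod h" by simp
    then have "map_poly of_rat k = map_poly of_rat (k div h) * map_poly of_rat h
        + (map_poly of_rat (k mod h) :: complex poly)"
      by (metis map_poly_of_rat_add map_poly_of_rat_mult)
    then have "poly (map_poly of_rat (k mod h)) x = 0"
      using that h by simp
    then have "k mod h = 0"
      using min[of "k mod h"] degree_mod_less[of h k] h by force
    then show ?thesis by (simp add: dvd_eq_mod_eq_0)
  qed
  define hc where "hc = (map_poly of_rat h :: complex poly)"
  have dc: "degree hc = degree h"
    unfolding hc_def by (rule degree_map_poly) simp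
  have "hc \<noteq> 0"
    using h by (simp add: hc_def map_poly_eq_0_iff)
  have "poly hc y = 0 \<Longrightarrow> y = x" for y
    using uniq[of y] dvd[of f] dvd[of g] assms(2,3)
    by (auto simp: hc_def map_poly_of_rat_mult elim!: dvdE)
  moreover have "poly (pderiv hc) x \<noteq> 0"
  proof
    assume *: "poly (pderiv hc) x = 0"
    have e: "pderiv hc = map_poly of_rat (pderiv h)"
      by (rule poly_eqI) (simp add: hc_def coeff_map_poly coeff_pderiv of_rat_mult of_rat_add)
    have "degree h \<noteq> 0"
      using h by (metis degree_0_id hc_def map_poly_pCons map_poly_0 poly_pCons poly_0 mult_zero_right
          add_0_right of_rat_eq_0_iff pCons_0_0 of_rat_0)
    then have "pderiv h \<noteq> 0" "degree (pderiv h) < degree h"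
      by (auto simp: pderiv_eq_0_iff degree_pderiv)
    then show False
      using min[of "pderiv h"] * e by auto
  qed
  ultimately have "degree h = 1"
    using poly_eq_linear_if_unique_root[of hc x] \<open>hc \<noteq> 0\<close> h dc by (simp add: hc_def)
  then obtain u v where uv: "h = [:u, v:]" "v \<noteq> 0"
    by (metis One_nat_def degree1_coeffs)
  then have "of_rat u + x * of_rat v = 0"
    using h by (simp add: map_poly_pCons)
  then have "x = of_rat (- u / v)"
    using uv by (simp add: field_simps of_rat_minus of_rat_divide eq_neg_iff_add_eq_0)
  then show ?thesis by simp
qed

text \<open>Solving z^2 - y z + 1 = 0 gives y = z + 1 / z. The assumption then reads (z^N - 1)^2 =
  0, so z has modulus 1 and y = 2 Re z.\<close>

lemma real_if_root_cheb_minus_2: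
  fixes y :: complex
  assumes "N > 0" "poly (cheb N - [:2:]) y = 0"
  obtains t :: real where "y = of_real t" "\<bar>t\<bar> \<le> 2"
proof -
  define z where "z = (y + csqrt (y\<^sup>2 - 4)) / 2"
  have "(csqrt (y\<^sup>2 - 4))\<^sup>2 = y\<^sup>2 - 4" by simp
  then have q: "z * z + 1 = y * z"
    unfolding z_def power2_eq_square
    by (simp add: field_simps) (use \<open>(csqrt (y\<^sup>2 - 4))\<^sup>2 = y\<^sup>2 - 4\<close> in \<open>algebra\<close>)
  then have "z \<noteq> 0" by auto
  then have y: "y = z + inverse z"
    using q by (simp add: field_simps)
  have "z ^ N + inverse z ^ N = 2"
    using poly_cheb[OF \<open>z \<noteq> 0\<close>, of N] assms(2) by (simp add: y)
  then have "(z ^ N - 1)\<^sup>2 = 0"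
    using \<open>z \<noteq> 0\<close> by (simp add: field_simps power2_eq_square)
  then have "norm z ^ N = 1"
    by (simp flip: norm_power)
  then have n1: "norm z = 1"
    using assms(1) power_eq_imp_eq_base[of "norm z" N 1] by simp
  then have "inverse z = cnj z"
    by (simp add: inverse_complex_def complex_eq_iff cmod_def)
  then have "y = of_real (2 * Re z)"
    by (simp add: y complex_add_cnj)
  moreover have "\<bar>2 * Re z\<bar> \<le> 2"
    using abs_Re_le_cmod[of z] n1 by simp
  ultimately show ?thesis by (rule that)
qed

text \<open>On [0, 4] the left side of the equation strictly increases in s and the right side
  strictly decreases, so they meet at most once.\<close>

lemma tile_equation_unique_root:
  fixes s t :: real
  assumes "p > 0" "q > 0" "0 \<le> s" "s \<le> 4" "0 \<le> t" "t \<le> 4"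
    and "s ^ q * 16 ^ p = (4 - s) ^ p * 4 ^ q" "t ^ q * 16 ^ p = (4 - t) ^ p * 4 ^ q"
  shows "s = t"
proof -
  have aux: False if "0 \<le> s" "s < t" "t \<le> 4" "s ^ q * 16 ^ p = (4 - s) ^ p * 4 ^ q"
      "t ^ q * 16 ^ p = (4 - t) ^ p * 4 ^ q" for s t :: real
  proof -
    have "s ^ q < t ^ q" "(4 - t) ^ p < (4 - s) ^ p"
      using that assms(1,2) by (auto intro!: power_strict_mono)
    then have "s ^ q * 16 ^ p < t ^ q * 16 ^ p" "(4 - t) ^ p * 4 ^ q < (4 - s) ^ p * 4 ^ q"
      by simp_all
    then show False using that(4,5) by linarith
  qed
  show ?thesis
    using aux[of s t] aux[of t s] assms by (meson linorder_neqE_linordered_idom)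
qed

text \<open>With theta the argument of e, \<open>rel\<close> is the square of |sin theta|^q = (|cos
  theta| / 2)^p with denominators cleared.\<close>

theorem unit_not_root_of_unity:
  fixes e :: complex and p q N :: nat
  assumes "p > 0" "q > 0" "q \<noteq> 3 * p" "norm e = 1" "Re e \<noteq> 0" "Im e \<noteq> 0"
    and rel: "(4 * (Im e)\<^sup>2) ^ q * 16 ^ p = (4 * (Re e)\<^sup>2) ^ p * 4 ^ q"
    and "N > 0"
  shows "e ^ N \<noteq> 1"
proof
  assume eN: "e ^ N = 1"
  define s where "s = 4 * (Im e)\<^sup>2"
  have e1: "(Re e)\<^sup>2 + (Im e)\<^sup>2 = 1"
    using \<open>norm e = 1\<close> by (simp add: cmod_def)
  have s: "0 < s" "s < 4" "4 - s = 4 * (Re e)\<^sup>2"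
    using e1 assms(5,6) zero_less_power2[of "Re e"] zero_less_power2[of "Im e"]
    unfolding s_def by linarith+
  have srel: "s ^ q * 16 ^ p = (4 - s) ^ p * 4 ^ q"
    using rel s(3) by (simp add: s_def)
  have "e \<noteq> 0" using \<open>norm e = 1\<close> by auto
  have inv: "inverse e = cnj e"
    using e1 by (simp add: inverse_complex_def complex_eq_iff)
  \<comment> \<open>Passing from s to 2 - s = 2 cos (2 theta) gives the sum of e^2 and its inverse,
    an argument at which \<open>poly_cheb\<close> applies.\<close>
  define x :: complex where "x = of_real (2 - s)"
  have x: "x = e\<^sup>2 + inverse (e\<^sup>2)"
    using e1 unfolding power_inverse[symmetric] inv
    by (simp add: x_def s_def complex_eq_iff power2_eq_square)
  \<comment> \<open>The equation for s in terms of x, where s = 2 - x and 4 - s = 2 + x.\<close>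
  define g :: "rat poly" where "g = [:2, -1:] ^ q * [:16 ^ p:] - [:2, 1:] ^ p * [:4 ^ q:]"
  obtain N' where N': "N = Suc N'" using \<open>N > 0\<close> gr0_implies_Suc by blast
  have fx: "poly (cheb N - [:2:]) x = 0"
  proof -
    have "(e\<^sup>2) ^ N = 1"
      using eN by (metis mult.commute power_mult power_one)
    then show ?thesis
      using \<open>e \<noteq> 0\<close> poly_cheb[of "e\<^sup>2" N] by (simp add: x power_inverse[of "e\<^sup>2" N])
  qed
  have fc: "map_poly of_rat (cheb N - [:2:]) = (cheb N - [:2:] :: complex poly)"
    by (simp add: map_poly_of_rat_diff map_poly_of_rat_cheb map_poly_pCons)
  have gc: "poly (map_poly of_rat g) y = (2 - y) ^ q * 16 ^ p - (2 + y) ^ p * 4 ^ q" for y :: complex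
    by (simp add: g_def map_poly_of_rat_diff map_poly_of_rat_mult map_poly_of_rat_power
        map_poly_pCons map_poly_smult of_rat_mult of_rat_power of_rat_minus)
  have "degree (cheb N - [:2:] :: rat poly) = N"
    by (simp only: N' cheb_minus_2)
  then have f0: "cheb N - [:2:] \<noteq> (0 :: rat poly)"
    using \<open>N > 0\<close> by auto
  have "x \<in> \<rat>"
  proof (rule rational_if_unique_common_root[OF f0])
    show "poly (map_poly of_rat (cheb N - [:2:])) x = 0"
      using fx fc by simp
    have "(2 - x) ^ q * 16 ^ p - (2 + x) ^ p * 4 ^ q
        = of_real (s ^ q * 16 ^ p - (4 - s) ^ p * 4 ^ q)"
      by (simp add: x_def)
    then show "poly (map_poly of_rat g) x = 0"
      by (simp add: gc srel)
  next
    fix y :: complex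
    assume "poly (map_poly of_rat (cheb N - [:2:])) y = 0" and gy: "poly (map_poly of_rat g) y = 0"
    then obtain t where t: "y = of_real t" "\<bar>t\<bar> \<le> 2"
      using real_if_root_cheb_minus_2[OF \<open>N > 0\<close>, of y] fc by auto
    have "of_real ((2 - t) ^ q * 16 ^ p - (2 + t) ^ p * 4 ^ q) = (0 :: complex)"
      using gy by (simp add: gc t(1))
    then have "(2 - t) ^ q * 16 ^ p = (4 - (2 - t)) ^ p * 4 ^ q"
      unfolding of_real_eq_0_iff by simp
    then have "2 - t = s"
      using tile_equation_unique_root[OF assms(1,2), of "2 - t" s] t(2) s srel by auto
    then show "y = x" by (auto simp: x_def t(1))
  qed
  moreover have "algebraic_int x"
  proof (rule algebraic_int.intros)
    let ?c = "cheb N - [:2:] :: complex poly"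
    have "degree ?c = N" "coeff ?c N = 1"
      by (simp_all only: N' cheb_minus_2)
    then show "lead_coeff ?c = 1" by simp
    show "\<forall>i. coeff ?c i \<in> \<int>"
      using coeff_cheb_Ints[of N, where 'a = complex]
      by (auto intro!: Ints_diff simp: coeff_pCons split: nat.splits)
  qed (fact fx)
  ultimately have "x \<in> \<int>"
    by (rule rational_algebraic_int_is_int[rotated])
  then obtain i where "x = of_int i" by (auto elim: Ints_cases)
  then have "2 - s = of_int i"
    unfolding x_def by (metis of_real_eq_iff of_real_of_int_eq)
  then have i: "s = of_int (2 - i)" by simp
  then have "2 - i \<in> {1, 2, 3}"
    using s(1,2) by auto
  then consider "s = 1" | "s = 2" | "s = 3"
    using i by auto
  then show False
  proof cases
    case 1
    then have "real (16 ^ p) = real (3 ^ p * 4 ^ q)"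
      using srel by simp
    then have "(16 :: nat) ^ p = 3 ^ p * 4 ^ q"
      unfolding of_nat_eq_iff .
    moreover have "(3 :: nat) dvd 3 ^ p * 4 ^ q"
      using \<open>p > 0\<close> by simp
    ultimately have "(3 :: nat) dvd 16 ^ p" by simp
    moreover have "(16 :: nat) ^ p mod 3 = 1"
      by (subst power_mod[symmetric]) simp
    ultimately show False
      by (simp add: dvd_eq_mod_eq_0)
  next
    \<comment> \<open>Here all terms are powers of 2, and comparing exponents gives q = 3 p, the
      excluded ratio. The other two cases fail modulo 3.\<close>
    case 2
    have "(2 :: real) ^ (q + 4 * p) = 2 ^ q * 16 ^ p"
      by (simp add: power_add power_mult)
    also have "\<dots> = 2 ^ p * 4 ^ q"
      using srel 2 by simp
    also have "\<dots> = 2 ^ (p + 2 * q)"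
      by (simp add: power_add power_mult)
    finally have "q + 4 * p = p + 2 * q"
      by (simp add: power_inject_exp)
    then show False using assms(3) by simp
  next
    case 3
    then have "real (3 ^ q * 16 ^ p) = real (4 ^ q)"
      using srel by simp
    then have "(3 :: nat) ^ q * 16 ^ p = 4 ^ q"
      unfolding of_nat_eq_iff .
    then have "(3 :: nat) dvd 4 ^ q"
      by (metis \<open>q > 0\<close> dvd_mult2 dvd_power)
    moreover have "(4 :: nat) ^ q mod 3 = 1"
      by (subst power_mod[symmetric]) simp
    ultimately show False
      by (simp add: dvd_eq_mod_eq_0)
  qed
qed

subsection \<open>Contractions and renewal sequences\<close>

text \<open>Every completed block of K indices contributes one factor \<delta>, so z i is at most
  \<delta> ^ (i div K) times the maximum of the first block. Looking back over a window accommodates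
  recursions with several delays.\<close>

lemma contraction_tendsto_0:
  fixes z :: "nat \<Rightarrow> real"
  assumes "\<And>i. 0 \<le> z i" "0 \<le> \<delta>" "\<delta> < 1" "K > 0"
    and step: "\<And>i D. i \<ge> K \<Longrightarrow> (\<And>l. i - K \<le> l \<Longrightarrow> l < i \<Longrightarrow> z l \<le> D) \<Longrightarrow> z i \<le> \<delta> * D"
  shows "z \<longlonglongrightarrow> 0"
proof -
  define D where "D = Max (z ` {..<K})"
  have D: "z i \<le> D" if "i < K" for i
    unfolding D_def using that by (auto intro!: Max_ge)
  have "0 \<le> D" using D[of 0] assms(1)[of 0] \<open>K > 0\<close> by linarith
  have bound: "z i \<le> \<delta> ^ (i div K) * D" for i
  proof (induction i rule: less_induct)
    case (less i)
    show ?case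
    proof (cases "i < K")
      case False
      have div: "i div K = Suc ((i - K) div K)"
        using False \<open>K > 0\<close> by (simp add: le_div_geq)
      have "z l \<le> \<delta> ^ ((i - K) div K) * D" if "i - K \<le> l" "l < i" for l
      proof -
        have "(i - K) div K \<le> l div K"
          using that by (intro div_le_mono)
        then have "\<delta> ^ (l div K) \<le> \<delta> ^ ((i - K) div K)"
          using assms by (intro power_decreasing) auto
        then show ?thesis
          using less[OF that(2)] \<open>0 \<le> D\<close> by (meson mult_right_mono order_trans)
      qed
      then have "z i \<le> \<delta> * (\<delta> ^ ((i - K) div K) * D)"
        using False by (intro step) auto
      then show ?thesis by (simp add: div)
    qed (use D in auto)
  qed
  have "filterlim (\<lambda>i. i div K) at_top sequentially"
    using \<open>K > 0\<close> unfolding filterlim_at_top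
    by (auto simp: eventually_sequentially less_eq_div_iff_mult_less_eq intro!: exI[of _ "_ * K"])
  then have "(\<lambda>i. \<delta> ^ (i div K)) \<longlonglongrightarrow> 0"
    using LIMSEQ_realpow_zero[OF assms(2,3)] filterlim_compose by blast
  then have "(\<lambda>i. \<delta> ^ (i div K) * D) \<longlonglongrightarrow> 0"
    using tendsto_mult_left_zero by blast
  then show ?thesis
    by (rule tendsto_sandwich[rotated 2, OF tendsto_const]) (use bound assms(1) in auto)
qed

text \<open>In a Bezout representation of n the coefficient of q may be reduced modulo p. Its
  contribution is then at most p * q \<le> n, so the coefficient of p comes out nonnegative.\<close>

lemma coprime_representable:
  fixes p q n :: nat
  assumes "coprime p q" "p > 0" "n \<ge> p * q"
  shows "\<exists>k l. n = k * p + l * q"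
proof -
  obtain u v :: int where uv: "u * int p + v * int q = 1"
    using bezout_int[of "int p" "int q"] assms(1) by auto
  define l where "l = (int n * v) mod int p"
  have l: "0 \<le> l" "l < int p" using \<open>p > 0\<close> by (simp_all add: l_def)
  obtain t where t: "int n * v = l + int p * t"
    unfolding l_def by (metis mod_mult_div_eq)
  have "int n = int n * (u * int p + v * int q)" by (simp add: uv)
  also have "\<dots> = (int n * u + t * int q) * int p + l * int q"
    using t by algebra
  finally have n: "int n = (int n * u + t * int q) * int p + l * int q" .
  have "l * int q \<le> int p * int q"
    using l by (intro mult_right_mono) auto
  also have "\<dots> \<le> int n"
    using assms(3) by (simp flip: of_nat_mult)
  finally have "0 \<le> (int n * u + t * int q) * int p"
    using n by linarith
  then have k: "0 \<le> int n * u + t * int q"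
    using \<open>p > 0\<close> by (simp add: zero_le_mult_iff)
  have "int n = int (nat (int n * u + t * int q) * p + nat l * q)"
    using n k l by simp
  then show ?thesis
    unfolding of_nat_eq_iff by blast
qed

text \<open>The window maximum decreases and the window minimum increases; a value at distance \<open>\<epsilon>\<close> below
  the maximum pushes a complete later window below it by a fixed fraction of \<open>\<epsilon>\<close>.\<close>

lemma renewal_convergent:
  fixes y :: "nat \<Rightarrow> real"
  assumes "p > 0" "q > 0" "coprime p q" "0 < \<alpha>" "0 < \<beta>" "\<alpha> + \<beta> = 1" and m: "m = max p q"
    and rec: "\<And>i. i \<ge> m \<Longrightarrow> y i = \<alpha> * y (i - p) + \<beta> * y (i - q)"
  shows "convergent y"
proof -
  have "m > 0" using assms by auto
  define W where "W n = y ` {n..<n + m}" for n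
  have W: "finite (W n)" "W n \<noteq> {}" for n
    using \<open>m > 0\<close> by (auto simp: W_def)
  define M where "M n = Max (W n)" for n
  define \<mu> where "\<mu> n = Min (W n)" for n
  \<comment> \<open>A bound on one window persists, because each later value is a convex combination
    of two earlier ones.\<close>
  have upper: "y i \<le> B" if "\<And>l. n \<le> l \<Longrightarrow> l < n + m \<Longrightarrow> y l \<le> B" "n \<le> i" for n B i
    using that(2)
  proof (induction i rule: less_induct)
    case (less i)
    show ?case
    proof (cases "i < n + m")
      case False
      then have "y (i - p) \<le> B" "y (i - q) \<le> B"
        using assms(1,2) m by (auto intro!: less)
      then have "\<alpha> * y (i - p) + \<beta> * y (i - q) \<le> \<alpha> * B + \<beta> * B"
        using assms by (intro add_mono mult_left_mono) auto
      also have "\<dots> = B" using \<open>\<alpha> + \<beta> = 1\<close> by (simp flip: distrib_right)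
      finally show ?thesis using rec[of i] False by simp
    qed (use that(1) less in auto)
  qed
  have lower: "B \<le> y i" if "\<And>l. n \<le> l \<Longrightarrow> l < n + m \<Longrightarrow> B \<le> y l" "n \<le> i" for n B i
    using that(2)
  proof (induction i rule: less_induct)
    case (less i)
    show ?case
    proof (cases "i < n + m")
      case False
      then have "B \<le> y (i - p)" "B \<le> y (i - q)"
        using assms(1,2) m by (auto intro!: less)
      then have "\<alpha> * B + \<beta> * B \<le> \<alpha> * y (i - p) + \<beta> * y (i - q)"
        using assms by (intro add_mono mult_left_mono) auto
      moreover have "\<alpha> * B + \<beta> * B = B" using \<open>\<alpha> + \<beta> = 1\<close> by (simp flip: distrib_right)
      ultimately show ?thesis using rec[of i] False by simp
    qed (use that(1) less in auto)
  qed
  have yM: "y i \<le> M n" if "n \<le> i" for i n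
    by (rule upper[OF _ that]) (auto simp: M_def W_def)
  have y\<mu>: "\<mu> n \<le> y i" if "n \<le> i" for i n
    by (rule lower[OF _ that]) (auto simp: \<mu>_def W_def)
  have "decseq M"
    unfolding decseq_def M_def using W yM
    by (auto simp: W_def M_def intro!: Max.boundedI)
  have "incseq \<mu>"
    unfolding incseq_def \<mu>_def using W y\<mu>
    by (auto simp: W_def \<mu>_def intro!: Min.boundedI)
  define \<gamma> where "\<gamma> = min \<alpha> \<beta>"
  have \<gamma>: "0 < \<gamma>" "\<gamma> < 1" "\<gamma> \<le> \<alpha>" "\<gamma> \<le> \<beta>" using assms by (auto simp: \<gamma>_def)
  \<comment> \<open>A deficit \<epsilon> at i is passed on to i + p with weight \<alpha> and to i +
    q with weight \<beta>; \<gamma> is the smaller of the two.\<close>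
  have drop1: "y (i + p) \<le> M n - \<gamma> * \<epsilon> \<and> y (i + q) \<le> M n - \<gamma> * \<epsilon>"
    if "n \<le> i" "y i \<le> M n - \<epsilon>" "0 \<le> \<epsilon>" "n + m \<le> i + p" "n + m \<le> i + q" for i n \<epsilon>
  proof
    have "y (i + p) = \<alpha> * y i + \<beta> * y (i + p - q)"
      using rec[of "i + p"] that by simp
    also have "\<dots> \<le> \<alpha> * (M n - \<epsilon>) + \<beta> * M n"
      using that assms m by (intro add_mono mult_left_mono yM) auto
    also have "\<dots> = M n - \<alpha> * \<epsilon>"
      using \<open>\<alpha> + \<beta> = 1\<close> by algebra
    also have "\<dots> \<le> M n - \<gamma> * \<epsilon>"
      using \<gamma> that by (simp add: mult_right_mono)
    finally show "y (i + p) \<le> M n - \<gamma> * \<epsilon>" .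
    have "y (i + q) = \<alpha> * y (i + q - p) + \<beta> * y i"
      using rec[of "i + q"] that by simp
    also have "\<dots> \<le> \<alpha> * M n + \<beta> * (M n - \<epsilon>)"
      using that assms m by (intro add_mono mult_left_mono yM) auto
    also have "\<dots> = M n - \<beta> * \<epsilon>"
      using \<open>\<alpha> + \<beta> = 1\<close> by algebra
    also have "\<dots> \<le> M n - \<gamma> * \<epsilon>"
      using \<gamma> that by (simp add: mult_right_mono)
    finally show "y (i + q) \<le> M n - \<gamma> * \<epsilon>" .
  qed
  have drop: "y (i + (k * p + l * q)) \<le> M n - \<gamma> ^ (k + l) * \<epsilon>"
    if "n + m \<le> i" "y i \<le> M n - \<epsilon>" "0 \<le> \<epsilon>" for i n \<epsilon> k l
  proof -
    have 1: "y (i + k * p) \<le> M n - \<gamma> ^ k * \<epsilon>"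
    proof (induction k)
      case (Suc k)
      then show ?case
        using drop1[of n "i + k * p" "\<gamma> ^ k * \<epsilon>"] that \<gamma> by (simp add: algebra_simps)
    qed (use that in auto)
    show ?thesis
    proof (induction l)
      case (Suc l)
      then show ?case
        using drop1[of n "i + (k * p + l * q)" "\<gamma> ^ (k + l) * \<epsilon>"] that \<gamma> by (simp add: algebra_simps)
    qed (use 1 in auto)
  qed
  \<comment> \<open>The low value will sit between n + m and n + 2 m, so every index of the window
    at n + J lies at least p * q after it. It is then reached by steps p and q, at most J + m in
    number, which gives the exponent in \<kappa>.\<close>
  define J where "J = 2 * m + p * q"
  define \<kappa> where "\<kappa> = \<gamma> ^ (J + m)"
  have \<kappa>: "0 < \<kappa>" using \<gamma> by (simp add: \<kappa>_def)
  have contract: "M (n + J) \<le> M n - \<kappa> * (M n - \<mu> (n + m))" for n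
  proof -
    \<comment> \<open>The minimum is taken from index n + m on, so that all predecessors used by
      \<open>drop\<close> are still at least n, where \<open>M n\<close> is an upper bound.\<close>
    have "\<mu> (n + m) \<in> W (n + m)" unfolding \<mu>_def using W by simp
    then obtain i where i: "n + m \<le> i" "i < n + m + m" "y i = \<mu> (n + m)"
      by (auto simp: W_def)
    define \<epsilon> where "\<epsilon> = M n - y i"
    have \<epsilon>: "0 \<le> \<epsilon>" using yM[of n i] i by (simp add: \<epsilon>_def)
    have "y l \<le> M n - \<kappa> * \<epsilon>" if l: "n + J \<le> l" "l < n + J + m" for l
    proof -
      have "p * q \<le> l - i" using l i by (simp add: J_def)
      then obtain k k' where k: "l - i = k * p + k' * q"
        using coprime_representable[OF assms(3,1)] by blast
      have "k + k' \<le> k * p + k' * q"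
        using assms(1,2) by (intro add_mono) auto
      also have "\<dots> \<le> J + m" using k l i by linarith
      finally have "\<gamma> ^ (J + m) \<le> \<gamma> ^ (k + k')"
        using \<gamma> by (intro power_decreasing) auto
      then have "\<kappa> * \<epsilon> \<le> \<gamma> ^ (k + k') * \<epsilon>"
        using \<epsilon> by (simp add: \<kappa>_def mult_right_mono)
      moreover have "y (i + (k * p + k' * q)) \<le> M n - \<gamma> ^ (k + k') * \<epsilon>"
        using i \<epsilon> by (intro drop) (auto simp: \<epsilon>_def)
      moreover have "i + (k * p + k' * q) = l" using k l i by (simp add: J_def flip: k)
      ultimately show ?thesis by simp
    qed
    then show ?thesis
      unfolding M_def[of "n + J"] using W[of "n + J"] i(3)
      by (auto simp: W_def \<epsilon>_def)
  qed
  have "\<mu> 0 \<le> M n" for n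
    using y\<mu>[of 0 n] yM[of n n] by simp
  then obtain M' where M': "M \<longlonglongrightarrow> M'"
    using decseq_convergent[OF \<open>decseq M\<close>] by blast
  have "\<mu> n \<le> M 0" for n
    using yM[of 0 n] y\<mu>[of n n] by simp
  then obtain \<mu>' where \<mu>': "\<mu> \<longlonglongrightarrow> \<mu>'"
    using incseq_convergent[OF \<open>incseq \<mu>\<close>] by blast
  have "M' \<le> M' - \<kappa> * (M' - \<mu>')"
  proof (rule LIMSEQ_le)
    show "(\<lambda>n. M (n + J)) \<longlonglongrightarrow> M'"
      by (rule LIMSEQ_ignore_initial_segment[OF M'])
    show "(\<lambda>n. M n - \<kappa> * (M n - \<mu> (n + m))) \<longlonglongrightarrow> M' - \<kappa> * (M' - \<mu>')"
      by (intro tendsto_intros M' LIMSEQ_ignore_initial_segment[OF \<mu>'])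
  qed (use contract in auto)
  moreover have "\<mu>' \<le> M'"
    by (rule LIMSEQ_le[OF \<mu>' M']) (use y\<mu> yM order_trans in blast)
  ultimately have "M' = \<mu>'"
    using \<kappa> by (simp add: mult_le_0_iff)
  then have "y \<longlonglongrightarrow> M'"
    by (intro tendsto_sandwich[OF _ _ _ M', of \<mu> y]) (use \<mu>' yM y\<mu> in auto)
  then show ?thesis by (rule convergentI)
qed

text \<open>The window sum \<open>I\<close> is invariant under a shift: up to the common factor 1 /
  Z, a shift adds y (i + m) with weight \<alpha> + \<beta> = 1 and removes \<alpha> y (i + m - p) +
  \<beta> y (i + m - q), which is the same value by the recursion. As the weights sum to 1, the
  initial value of \<open>I\<close> is the limit of y.\<close>

lemma renewal_limit:
  fixes y :: "nat \<Rightarrow> complex"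
  assumes "p > 0" "q > 0" "coprime p q" "0 < \<alpha>" "0 < \<beta>" "\<alpha> + \<beta> = 1" and m: "m = max p q"
    and rec: "\<And>i. i \<ge> m \<Longrightarrow> y i = of_real \<alpha> * y (i - p) + of_real \<beta> * y (i - q)"
    and \<rho>: "\<And>k. \<rho> k = (\<alpha> * H (int p - int k) + \<beta> * H (int q - int k)) / (\<alpha> * p + \<beta> * q)"
  shows "y \<longlonglongrightarrow> (\<Sum>k=1..m. of_real (\<rho> k) * y (m - k))"
proof -
  have "convergent (\<lambda>i. Re (y i))"
    by (rule renewal_convergent[OF assms(1-7)]) (simp add: rec)
  moreover have "convergent (\<lambda>i. Im (y i))"
    by (rule renewal_convergent[OF assms(1-7)]) (simp add: rec)
  ultimately obtain u v where "(\<lambda>i. Re (y i)) \<longlonglongrightarrow> u" "(\<lambda>i. Im (y i)) \<longlonglongrightarrow> v"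
    by (auto simp: convergent_def)
  then have Y: "y \<longlonglongrightarrow> Complex u v"
    by (simp add: tendsto_complex_iff)
  define Z where "Z = \<alpha> * p + \<beta> * q"
  have Z: "Z > 0" using assms by (simp add: Z_def add_pos_pos)
  have \<rho>sum: "(\<Sum>k=1..m. of_real (\<rho> k) * x k)
      = (of_real \<alpha> * (\<Sum>k=1..p. x k) + of_real \<beta> * (\<Sum>k=1..q. x k)) / of_real Z"
    for x :: "nat \<Rightarrow> complex"
  proof -
    have part: "(\<Sum>k=1..m. of_real (H (int s - int k)) * x k) = (\<Sum>k=1..s. x k)" if "s \<le> m" for s
      using that by (intro sum.mono_neutral_cong_right) (auto simp: H_def)
    have "(\<Sum>k=1..m. of_real (\<rho> k) * x k)
      = (\<Sum>k=1..m. (of_real \<alpha> * (of_real (H (int p - int k)) * x k)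
            + of_real \<beta> * (of_real (H (int q - int k)) * x k)) / of_real Z)"
      by (intro sum.cong refl) (simp add: \<rho> Z_def field_simps)
    also have "\<dots> = (of_real \<alpha> * (\<Sum>k=1..m. of_real (H (int p - int k)) * x k)
            + of_real \<beta> * (\<Sum>k=1..m. of_real (H (int q - int k)) * x k)) / of_real Z"
      by (simp add: sum_divide_distrib[symmetric] sum.distrib sum_distrib_left)
    finally show ?thesis using part m by simp
  qed
  define I where "I i = (\<Sum>k=1..m. of_real (\<rho> k) * y (i + m - k))" for i
  have "I (Suc i) = I i" for i
  proof -
    have tel: "(\<Sum>k=1..s. y (Suc i + m - k)) = (\<Sum>k=1..s. y (i + m - k)) + y (i + m) - y (i + m - s)"
      if "s \<le> m" for s
      using that by (induction s) (auto simp: Suc_diff_le Suc_diff_Suc algebra_simps)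
    have "I (Suc i) = (of_real \<alpha> * (\<Sum>k=1..p. y (Suc i + m - k)) + of_real \<beta> * (\<Sum>k=1..q. y (Suc i + m - k))) / of_real Z"
      unfolding I_def by (rule \<rho>sum)
    also have "of_real \<alpha> * (\<Sum>k=1..p. y (Suc i + m - k)) + of_real \<beta> * (\<Sum>k=1..q. y (Suc i + m - k))
       = of_real \<alpha> * (\<Sum>k=1..p. y (i + m - k)) + of_real \<beta> * (\<Sum>k=1..q. y (i + m - k))
         + of_real (\<alpha> + \<beta>) * y (i + m) - (of_real \<alpha> * y (i + m - p) + of_real \<beta> * y (i + m - q))"
    proof -
      have "p \<le> m" "q \<le> m" using m by simp_all
      then show ?thesis
        unfolding tel[OF \<open>p \<le> m\<close>] tel[OF \<open>q \<le> m\<close>] by (simp add: algebra_simps)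
    qed
    also have "of_real \<alpha> * y (i + m - p) + of_real \<beta> * y (i + m - q) = y (i + m)"
      using rec[of "i + m"] by simp
    finally show ?thesis
      unfolding I_def \<rho>sum using \<open>\<alpha> + \<beta> = 1\<close> by simp
  qed
  then have I0: "I i = I 0" for i
    by (induction i) auto
  have "I \<longlonglongrightarrow> (\<Sum>k=1..m. of_real (\<rho> k) * Complex u v)"
    unfolding I_def
  proof (intro tendsto_intros)
    fix k assume "k \<in> {1..m}"
    then have "(\<lambda>i. y (i + m - k)) = (\<lambda>i. y (i + (m - k)))" by auto
    then show "(\<lambda>i. y (i + m - k)) \<longlonglongrightarrow> Complex u v"
      using LIMSEQ_ignore_initial_segment[OF Y] by simp
  qed
  moreover have "(\<Sum>k=1..m. of_real (\<rho> k) * Complex u v) = Complex u v"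
  proof -
    have "(of_real Z :: complex) = of_real \<alpha> * of_nat p + of_real \<beta> * of_nat q"
      by (simp add: Z_def)
    moreover have "(of_real Z :: complex) \<noteq> 0" using Z by simp
    ultimately show ?thesis unfolding \<rho>sum by (simp add: field_simps)
  qed
  moreover have "I \<longlonglongrightarrow> I 0"
    by (rule tendsto_eventually, rule always_eventually, rule allI, rule I0)
  ultimately have "I 0 = Complex u v"
    using LIMSEQ_unique by metis
  then show ?thesis using Y by (simp add: I_def)
qed

subsection \<open>The area-weighted substitution as a Markov operator\<close>

locale pinwheel =
  fixes p q m :: nat and a b c r :: real
  assumes p: "p > 0" and q: "q > 0" and coprime: "coprime p q" and ratio: "q \<noteq> 3 * p"
    and pos: "a > 0" "b > 0" "c > 0" "r > 0" and pythagoras: "a\<^sup>2 + b\<^sup>2 = c\<^sup>2"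
    and m: "m = max p q" and rp: "r ^ p = a / c" and rq: "r ^ q = b / (2 * c)"
begin

section \<open>Constants of the tile and its irrational angle\<close>

definition \<alpha> :: real where "\<alpha> = a\<^sup>2 / c\<^sup>2"
definition \<beta> :: real where "\<beta> = b\<^sup>2 / c\<^sup>2"
text \<open>This is exp (i theta) for the angle theta at A. In a tile of chirality s,
  \<open>rot s\<close> turns the direction of AC into that of AB, and \<open>quarter s\<close> is
  the right-angle turn of the same sense.\<close>

definition unit :: complex where "unit = Complex (b / c) (a / c)"
definition rot :: "bool \<Rightarrow> complex" where "rot s = (if s then unit else cnj unit)"
definition quarter :: "bool \<Rightarrow> complex" where "quarter s = (if s then \<i> else - \<i>)"

lemma \<alpha>\<beta>: "0 < \<alpha>" "0 < \<beta>" "\<alpha> + \<beta> = 1"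
  using pos pythagoras by (auto simp: \<alpha>_def \<beta>_def field_simps)

lemma m_pos: "m > 0" and p_le: "p \<le> m" and q_le: "q \<le> m"
  using m p by auto

lemma norm_unit: "norm unit = 1"
proof -
  have "(norm unit)\<^sup>2 = 1"
    using \<alpha>\<beta>(3) by (simp add: unit_def cmod_power2 power_divide \<alpha>_def \<beta>_def)
  then show ?thesis using norm_ge_zero[of unit] by (auto simp: power2_eq_1_iff simp del: norm_ge_zero)
qed

lemma norm_rot [simp]: "norm (rot s) = 1" and norm_quarter [simp]: "norm (quarter s) = 1"
  by (simp_all add: rot_def quarter_def norm_unit)

lemma rot_nonzero [simp]: "rot s \<noteq> 0"
  using norm_rot[of s] by (auto simp del: norm_rot)

text \<open>The required relation is (r ^ p) ^ q = (r ^ q) ^ p: the imaginary part of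
  \<open>unit\<close> is r ^ p, and half its real part is r ^ q.\<close>

lemma unit_power_ne_1: "N > 0 \<Longrightarrow> unit ^ N \<noteq> 1"
proof (rule unit_not_root_of_unity[OF p q ratio norm_unit])
  have "(4 * (Im unit)\<^sup>2) ^ q * 16 ^ p = (4 * (r ^ p)\<^sup>2) ^ q * 16 ^ p"
    by (simp add: unit_def rp)
  also have "\<dots> = (16 * (r ^ q)\<^sup>2) ^ p * 4 ^ q"
    by (simp add: power_mult_distrib mult_ac flip: power_mult)
  also have "\<dots> = (4 * (Re unit)\<^sup>2) ^ p * 4 ^ q"
    by (simp add: unit_def rq power_divide power_mult_distrib)
  finally show "(4 * (Im unit)\<^sup>2) ^ q * 16 ^ p = (4 * (Re unit)\<^sup>2) ^ p * 4 ^ q" .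
qed (use pos in \<open>auto simp: unit_def\<close>)

text \<open>Otherwise a nonzero power of \<open>unit\<close> would be 1 or -1, and its square would
  be 1.\<close>

lemma abs_Re_unit_powi: "\<bar>Re (unit powi n)\<bar> < 1" if "n \<noteq> 0"
proof -
  have pow: "\<bar>Re (unit ^ N)\<bar> < 1" if "N > 0" for N
  proof (rule ccontr)
    assume "\<not> \<bar>Re (unit ^ N)\<bar> < 1"
    moreover have n1: "norm (unit ^ N) = 1" by (simp add: norm_power norm_unit)
    ultimately have "\<bar>Re (unit ^ N)\<bar> = 1"
      using abs_Re_le_cmod[of "unit ^ N"] by linarith
    then have re: "(Re (unit ^ N))\<^sup>2 = 1" by (metis power2_abs power_one)
    then have im: "Im (unit ^ N) = 0"
      using n1 by (simp add: cmod_def)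
    have "(unit ^ N)\<^sup>2 = 1"
      using re im by (simp add: complex_eq_iff power2_eq_square)
    then have "unit ^ (N * 2) = 1" by (simp add: power_mult)
    then show False using unit_power_ne_1[of "N * 2"] \<open>N > 0\<close> by simp
  qed
  have inv: "inverse unit = cnj unit"
    using norm_unit by (simp add: inverse_complex_def complex_eq_iff cmod_def)
  show ?thesis
  proof (cases "n \<ge> 0")
    case True
    then show ?thesis using pow[of "nat n"] that by (simp add: power_int_def)
  next
    case False
    then have "unit powi n = cnj (unit ^ nat (- n))"
      by (simp add: power_int_def inv)
    then show ?thesis using pow[of "nat (- n)"] False by (simp del: complex_cnj_power)
  qed
qed

text \<open>The coefficients are area fractions: \<alpha> for the daughter \<open>(C, F, B)\<close>
  and \<beta> / 4 for each of the other four, of which \<open>(A, N, M)\<close> and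
  \<open>(M, K, C)\<close> share an orientation. The value type is general because Fourier modes are
  complex while squeezing needs the order of the reals.\<close>

definition averaging :: "(nat \<times> bool \<times> complex \<Rightarrow> 'v::real_vector) \<Rightarrow> nat \<times> bool \<times> complex \<Rightarrow> 'v" where
  "averaging f = (\<lambda>(k, s, u).
     if k = 1 then \<alpha> *\<^sub>R f (p, \<not> s, quarter s * rot s * u)
       + (\<beta> / 4) *\<^sub>R (2 *\<^sub>R f (q, \<not> s, rot s * u) + f (q, s, rot s * u) + f (q, s, - (rot s * u)))
     else f (k - 1, s, u))"

lemma averaging_Suc_0:
  "averaging f (Suc 0, s, u) = \<alpha> *\<^sub>R f (p, \<not> s, quarter s * rot s * u)
       + (\<beta> / 4) *\<^sub>R (2 *\<^sub>R f (q, \<not> s, rot s * u) + f (q, s, rot s * u) + f (q, s, - (rot s * u)))"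
  and averaging_gt_1: "k \<noteq> Suc 0 \<Longrightarrow> averaging f (k, s, u) = f (k - 1, s, u)"
  by (simp_all add: averaging_def)

lemma in_tile_space: "(k, s, u) \<in> tile_space m \<longleftrightarrow> 1 \<le> k \<and> k \<le> m \<and> norm u = 1"
  by (auto simp: tile_space_def)

lemma tile_space_daughters:
  "norm u = 1 \<Longrightarrow> (p, s', quarter s * rot s * u) \<in> tile_space m"
  "norm u = 1 \<Longrightarrow> (q, s', rot s * u) \<in> tile_space m"
  "norm u = 1 \<Longrightarrow> (q, s', - (rot s * u)) \<in> tile_space m"
  using p q p_le q_le by (auto simp: in_tile_space norm_mult)

lemma averaging_cong:
  assumes "\<And>x. x \<in> tile_space m \<Longrightarrow> f x = g x" "x \<in> tile_space m"
  shows "averaging f x = averaging g x"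
proof -
  obtain k s u where x: "x = (k, s, u)" by (cases x) auto
  then have u: "norm u = 1" and k: "1 \<le> k" "k \<le> m" using assms(2) by (auto simp: in_tile_space)
  show ?thesis
  proof (cases "k = Suc 0")
    case False
    then have "(k - 1, s, u) \<in> tile_space m"
      using k u by (auto simp: in_tile_space)
    then show ?thesis
      using False by (simp add: x averaging_gt_1 assms(1))
  qed (simp add: x averaging_Suc_0 assms(1) tile_space_daughters u)
qed

lemma averaging_power_cong:
  assumes "\<And>x. x \<in> tile_space m \<Longrightarrow> f x = g x" "x \<in> tile_space m"
  shows "(averaging ^^ j) f x = (averaging ^^ j) g x"
  using assms(2)
proof (induction j arbitrary: x)
  case (Suc j)
  then show ?case by (simp add: averaging_cong[of "(averaging ^^ j) f"])
qed (use assms in auto)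

lemma averaging_add: "averaging (\<lambda>x. f x + g x) = (\<lambda>x. averaging f x + averaging g x)"
  by (rule ext) (auto simp: averaging_def algebra_simps)

lemma averaging_power_add:
  "(averaging ^^ j) (\<lambda>x. f x + g x) = (\<lambda>x. (averaging ^^ j) f x + (averaging ^^ j) g x)"
  by (induction j) (simp_all add: averaging_add)

lemma averaging_linear:
  assumes "linear h"
  shows "averaging (\<lambda>x. h (f x)) = (\<lambda>x. h (averaging f x))"
  using assms by (intro ext) (auto simp: averaging_def linear_add linear_scale)

lemma averaging_power_linear:
  assumes "linear h"
  shows "(averaging ^^ j) (\<lambda>x. h (f x)) = (\<lambda>x. h ((averaging ^^ j) f x))"
  by (induction j) (simp_all add: averaging_linear[OF assms])

lemma averaging_power_const: "(averaging ^^ j) (\<lambda>_. v) = (\<lambda>_. v)"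
proof (induction j)
  case (Suc j)
  have "(\<alpha> + \<beta>) *\<^sub>R v = v" using \<alpha>\<beta> by simp
  moreover have "averaging (\<lambda>_. v) x = (if fst x = 1 then (\<alpha> + \<beta>) *\<^sub>R v else v)" for x :: "nat \<times> bool \<times> complex"
    by (cases x) (simp add: averaging_def algebra_simps flip: scaleR_left_distrib scaleR_2)
  ultimately have "averaging (\<lambda>_. v) = (\<lambda>_. v)" by (intro ext) simp
  then show ?case using Suc by simp
qed simp

lemma averaging_power_nonneg:
  fixes f :: "nat \<times> bool \<times> complex \<Rightarrow> real"
  assumes "\<And>x. x \<in> tile_space m \<Longrightarrow> 0 \<le> f x" "x \<in> tile_space m"
  shows "0 \<le> (averaging ^^ j) f x"
  using assms(2)
proof (induction j arbitrary: x)
  case (Suc j)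
  obtain k s u where x: "x = (k, s, u)" by (cases x) auto
  then have u: "norm u = 1" and k: "1 \<le> k" "k \<le> m" using Suc.prems by (auto simp: in_tile_space)
  show ?case
  proof (cases "k = Suc 0")
    case True
    show ?thesis
      using \<alpha>\<beta> u True
      by (auto simp: x averaging_Suc_0 intro!: add_nonneg_nonneg mult_nonneg_nonneg Suc.IH tile_space_daughters)
  next
    case False
    then show ?thesis
      using k u by (auto simp: x averaging_gt_1 in_tile_space intro!: Suc.IH)
  qed
qed (use assms in auto)

lemma averaging_power_mono:
  fixes f g :: "nat \<times> bool \<times> complex \<Rightarrow> real"
  assumes "\<And>x. x \<in> tile_space m \<Longrightarrow> f x \<le> g x" "x \<in> tile_space m"
  shows "(averaging ^^ j) f x \<le> (averaging ^^ j) g x"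
proof -
  have "0 \<le> (averaging ^^ j) (\<lambda>x. g x + - f x) x"
    using assms by (intro averaging_power_nonneg) auto
  also have "\<dots> = (averaging ^^ j) g x - (averaging ^^ j) f x"
    using averaging_power_linear[of uminus j f] unfolding averaging_power_add
    by (simp add: linear_iff)
  finally show ?thesis by simp
qed

lemma averaging_power_norm_le:
  fixes f :: "nat \<times> bool \<times> complex \<Rightarrow> 'v::real_normed_vector"
  assumes "\<And>x. x \<in> tile_space m \<Longrightarrow> norm (f x) \<le> B" "x \<in> tile_space m"
  shows "norm ((averaging ^^ j) f x) \<le> B"
  using assms(2)
proof (induction j arbitrary: x)
  case (Suc j)
  obtain k s u where x: "x = (k, s, u)" by (cases x) auto
  then have u: "norm u = 1" and k: "1 \<le> k" "k \<le> m" using Suc.prems by (auto simp: in_tile_space)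
  show ?case
  proof (cases "k = Suc 0")
    case True
    let ?g = "(averaging ^^ j) f"
    have "norm (averaging ?g x) \<le> \<alpha> * norm (?g (p, \<not> s, quarter s * rot s * u))
       + \<beta> / 4 * (2 * norm (?g (q, \<not> s, rot s * u)) + norm (?g (q, s, rot s * u)) + norm (?g (q, s, - (rot s * u))))"
      using \<alpha>\<beta> unfolding x True averaging_Suc_0
      by (intro norm_triangle_le add_mono) (auto intro!: norm_triangle_le add_mono)
    also have "\<dots> \<le> \<alpha> * B + \<beta> / 4 * (2 * B + B + B)"
      using \<alpha>\<beta> u by (intro add_mono mult_left_mono Suc.IH tile_space_daughters) auto
    also have "\<dots> = (\<alpha> + \<beta>) * B" by (simp add: algebra_simps)
    finally show ?thesis using \<alpha>\<beta> by simp
  next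
    case False
    then show ?thesis
      using k u by (auto simp: x averaging_gt_1 in_tile_space intro!: Suc.IH)
  qed
qed (use assms in auto)

text \<open>The iterates of a Fourier mode \<open>F k s * u powi n\<close> are again of this form.  In terms of the
  coefficients \<open>F\<close> for \<open>k = m, \<dots>, 1\<close>, continued by the coefficients of the iterates at \<open>k = 1\<close>,
  they are windows of length \<open>m\<close> of a single recursive sequence.\<close>

function mode_seq :: "(nat \<Rightarrow> bool \<Rightarrow> complex) \<Rightarrow> int \<Rightarrow> nat \<Rightarrow> bool \<Rightarrow> complex" where
  "mode_seq F n i s =
     (if i < m then F (m - i) s
      else of_real \<alpha> * (quarter s * rot s) powi n * mode_seq F n (i - p) (\<not> s)
        + of_real (\<beta> / 4) * rot s powi n
          * (2 * mode_seq F n (i - q) (\<not> s) + (1 + (- 1) powi n) * mode_seq F n (i - q) s))"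
  by pat_completeness auto
termination
  by (relation "Wellfounded.measure (\<lambda>(F, n, i, s). i)") (use p q m_pos in auto)

declare mode_seq.simps [simp del]

text \<open>A tile of size D_k is only relabelled k - 1 times before it is subdivided, so j and k
  enter through j - k alone; adding m keeps the index a natural number.\<close>

lemma averaging_power_mode:
  assumes "(k, s, u) \<in> tile_space m"
  shows "(averaging ^^ j) (\<lambda>(k, s, u). F k s * u powi n) (k, s, u) = mode_seq F n (j + m - k) s * u powi n"
  using assms
proof (induction j arbitrary: k s u)
  case 0
  then show ?case by (auto simp: in_tile_space mode_seq.simps)
next
  case (Suc j)
  show ?case
  proof (cases "k = Suc 0")
    case True
    have u: "norm u = 1" using Suc.prems by (auto simp: in_tile_space)
    have neg: "(- (rot s * u)) powi n = (- 1) powi n * rot s powi n * u powi n"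
      using power_int_mult_distrib[of "- 1" "rot s * u" n] by (simp add: power_int_mult_distrib)
    have "mode_seq F n (j + m) s =
       of_real \<alpha> * (quarter s * rot s) powi n * mode_seq F n (j + m - p) (\<not> s)
        + of_real (\<beta> / 4) * rot s powi n
          * (2 * mode_seq F n (j + m - q) (\<not> s) + (1 + (- 1) powi n) * mode_seq F n (j + m - q) s)"
      by (subst mode_seq.simps) simp
    then show ?thesis
      by (simp add: True averaging_Suc_0 Suc.IH tile_space_daughters u neg)
         (simp add: power_int_mult_distrib scaleR_conv_of_real algebra_simps)
  next
    case False
    then have "(k - 1, s, u) \<in> tile_space m" "j + m - (k - 1) = Suc j + m - k"
      using Suc.prems by (auto simp: in_tile_space)
    then show ?thesis
      using Suc.IH[of "k - 1" s u] False by (simp add: averaging_gt_1)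
  qed
qed

section \<open>Limits of the individual Fourier modes\<close>

definition converges_to :: "(nat \<times> bool \<times> complex \<Rightarrow> 'v::real_normed_vector) \<Rightarrow> 'v \<Rightarrow> bool" where
  "converges_to f L \<longleftrightarrow> uniform_limit (tile_space m) (\<lambda>j. (averaging ^^ j) f) (\<lambda>_. L) sequentially"

text \<open>Uniformity costs nothing: the direction u contributes a factor of modulus 1, and apart
  from it there are finitely many sizes and two chiralities. A nonzero limit tolerates that factor
  only for n = 0.\<close>

lemma converges_to_mode:
  assumes lim: "\<And>s. (\<lambda>i. mode_seq F n i s) \<longlonglongrightarrow> L" and L: "n = 0 \<or> L = 0"
  shows "converges_to (\<lambda>(k, s, u). F k s * u powi n) L"
  unfolding converges_to_def uniform_limit_iff
proof (intro allI impI)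
  fix \<epsilon> :: real assume "\<epsilon> > 0"
  have "\<forall>\<^sub>F i in sequentially. dist (mode_seq F n i True) L < \<epsilon> \<and> dist (mode_seq F n i False) L < \<epsilon>"
    using lim \<open>\<epsilon> > 0\<close> by (auto simp: tendsto_iff eventually_conj_iff)
  then obtain N where N: "dist (mode_seq F n i s) L < \<epsilon>" if "i \<ge> N" for i s
    unfolding eventually_sequentially by (metis (full_types))
  show "\<forall>\<^sub>F j in sequentially. \<forall>x\<in>tile_space m.
      dist ((averaging ^^ j) (\<lambda>(k, s, u). F k s * u powi n) x) L < \<epsilon>"
    unfolding eventually_sequentially
  proof (intro exI[of _ N] allI impI ballI)
    fix j x assume j: "N \<le> j" and x: "x \<in> tile_space m"
    obtain k s u where [simp]: "x = (k, s, u)" by (cases x) auto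
    have u: "norm u = 1" "k \<le> m" using x by (auto simp: in_tile_space)
    have "dist (mode_seq F n (j + m - k) s * u powi n) L = dist (mode_seq F n (j + m - k) s) L"
      using L u by (auto simp: norm_mult norm_power_int)
    then show "dist ((averaging ^^ j) (\<lambda>(k, s, u). F k s * u powi n) x) L < \<epsilon>"
      using N[of "j + m - k" s] averaging_power_mode[of k s u j F n] x j u by simp
  qed
qed

lemma mode_seq_rec:
  "i \<ge> m \<Longrightarrow> mode_seq F n i s = of_real \<alpha> * (quarter s * rot s) powi n * mode_seq F n (i - p) (\<not> s)
     + of_real (\<beta> / 4) * rot s powi n
       * (2 * mode_seq F n (i - q) (\<not> s) + (1 + (- 1) powi n) * mode_seq F n (i - q) s)"
  by (subst mode_seq.simps) simp

lemma norm_powi_1: "norm (x :: complex) = 1 \<Longrightarrow> norm (x powi n) = 1"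
  by (simp add: norm_power_int)

text \<open>For odd n the coefficient 1 + (-1)^n vanishes, so of the weight \<beta> only the half
  carried by the chirality-reversing daughters survives.\<close>

lemma mode_seq_odd_bound:
  assumes "odd n" "i \<ge> m" and D: "\<And>s. norm (mode_seq F n (i - p) s) \<le> D" "\<And>s. norm (mode_seq F n (i - q) s) \<le> D"
  shows "norm (mode_seq F n i s) \<le> (\<alpha> + \<beta> / 2) * D"
proof -
  have "norm (mode_seq F n i s) \<le> \<alpha> * norm (mode_seq F n (i - p) (\<not> s)) + \<beta> / 4 * (2 * norm (mode_seq F n (i - q) (\<not> s)))"
    using \<alpha>\<beta> assms(1) unfolding mode_seq_rec[OF assms(2)]
    by (intro norm_triangle_le add_mono) (simp_all add: norm_mult norm_powi_1)
  also have "\<dots> \<le> \<alpha> * D + \<beta> / 4 * (2 * D)"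
    using \<alpha>\<beta> by (intro add_mono mult_left_mono D) auto
  finally show ?thesis by (simp add: algebra_simps)
qed

text \<open>For even \<open>n\<close> cancellation only shows up after two steps of length \<open>q\<close>: the second one multiplies
  the sum of both chiralities by twice the real part of \<open>unit powi n\<close>.\<close>

lemma mode_seq_even_bound:
  assumes "even n" "i \<ge> 2 * m"
    and D: "\<And>l s. i - 2 * m \<le> l \<Longrightarrow> l < i \<Longrightarrow> norm (mode_seq F n l s) \<le> D"
  shows "norm (mode_seq F n i s) \<le> (\<alpha> + \<alpha> * \<beta> + \<beta>\<^sup>2 * \<bar>Re (unit powi n)\<bar>) * D"
proof -
  let ?y = "mode_seq F n"
  define \<sigma> where "\<sigma> i = ?y i True + ?y i False" for i
  have rec: "?y i s = of_real \<alpha> * (quarter s * rot s) powi n * ?y (i - p) (\<not> s)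
      + of_real (\<beta> / 2) * rot s powi n * \<sigma> (i - q)" if "i \<ge> m" for i s
    using assms(1) by (cases s) (simp_all add: mode_seq_rec[OF that] \<sigma>_def algebra_simps)
  have iq: "i - q \<ge> m" "i - q < i" "i - 2 * m \<le> i - q - p" "i - 2 * m \<le> i - q - q" "i \<ge> m"
    "i - q - p < i" "i - q - q < i" "i - p < i" "i - 2 * m \<le> i - p"
    using assms(2) p q p_le q_le by auto
  have "\<sigma> (i - q) = of_real \<alpha> * ((quarter True * rot True) powi n * ?y (i - q - p) False
        + (quarter False * rot False) powi n * ?y (i - q - p) True)
      + of_real (\<beta> / 2) * (unit powi n + cnj (unit powi n)) * \<sigma> (i - q - q)"
    unfolding \<sigma>_def[of "i - q"] rec[OF iq(1)] by (simp add: rot_def algebra_simps)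
  also have "unit powi n + cnj (unit powi n) = of_real (2 * Re (unit powi n))"
    by (rule complex_add_cnj)
  finally have "norm (\<sigma> (i - q)) \<le> \<alpha> * (norm (?y (i - q - p) False) + norm (?y (i - q - p) True))
      + \<beta> / 2 * (2 * \<bar>Re (unit powi n)\<bar>) * norm (\<sigma> (i - q - q))"
    using \<alpha>\<beta> by (auto intro!: norm_triangle_le add_mono simp: norm_mult norm_powi_1 simp del: of_real_mult)
  also have "\<dots> \<le> \<alpha> * (D + D) + \<beta> / 2 * (2 * \<bar>Re (unit powi n)\<bar>) * (D + D)"
    using \<alpha>\<beta> iq unfolding \<sigma>_def
    by (intro add_mono mult_left_mono norm_triangle_le D) auto
  finally have \<sigma>: "norm (\<sigma> (i - q)) \<le> 2 * (\<alpha> + \<beta> * \<bar>Re (unit powi n)\<bar>) * D"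
    by (simp add: algebra_simps)
  have "norm (?y i s) \<le> \<alpha> * norm (?y (i - p) (\<not> s)) + \<beta> / 2 * norm (\<sigma> (i - q))"
    using \<alpha>\<beta> unfolding rec[OF iq(5)]
    by (intro norm_triangle_le add_mono) (simp_all add: norm_mult norm_powi_1)
  also have "\<dots> \<le> \<alpha> * D + \<beta> / 2 * (2 * (\<alpha> + \<beta> * \<bar>Re (unit powi n)\<bar>) * D)"
    using \<alpha>\<beta> iq by (intro add_mono mult_left_mono D \<sigma>) auto
  finally show ?thesis by (simp add: algebra_simps power2_eq_square)
qed

lemma mode_seq_tendsto_0:
  assumes "n \<noteq> 0"
  shows "(\<lambda>i. mode_seq F n i s) \<longlonglongrightarrow> 0"
proof -
  \<comment> \<open>The recursion mixes the chiralities, so both are controlled together.\<close>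
  define z where "z i = max (norm (mode_seq F n i True)) (norm (mode_seq F n i False))" for i
  define \<delta> where "\<delta> = (if even n then \<alpha> + \<alpha> * \<beta> + \<beta>\<^sup>2 * \<bar>Re (unit powi n)\<bar> else \<alpha> + \<beta> / 2)"
  have zD: "z i \<le> D \<longleftrightarrow> (\<forall>s. norm (mode_seq F n i s) \<le> D)" for i D
    by (auto simp: z_def all_bool_eq)
  have "\<beta>\<^sup>2 * \<bar>Re (unit powi n)\<bar> < \<beta>\<^sup>2"
    using abs_Re_unit_powi[OF assms] \<alpha>\<beta> by simp
  \<comment> \<open>This is \<alpha> + \<beta> (\<alpha> + \<beta>) = 1, so the strict inequality
    comes from the damping of the last summand alone.\<close>
  moreover have "\<alpha> + \<alpha> * \<beta> + \<beta>\<^sup>2 = 1"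
    using \<alpha>\<beta>(3) by algebra
  ultimately have even: "\<alpha> + \<alpha> * \<beta> + \<beta>\<^sup>2 * \<bar>Re (unit powi n)\<bar> < 1"
    by linarith
  have odd: "\<alpha> + \<beta> / 2 < 1"
    using \<alpha>\<beta> by linarith
  have "\<delta> < 1"
    unfolding \<delta>_def using even odd by presburger
  moreover have "0 \<le> \<delta>"
    using \<alpha>\<beta> by (auto simp: \<delta>_def)
  moreover have "z i \<le> \<delta> * D" if i: "i \<ge> 2 * m" and D: "\<And>l. i - 2 * m \<le> l \<Longrightarrow> l < i \<Longrightarrow> z l \<le> D" for i D
  proof (cases "even n")
    case True
    then show ?thesis
      using mode_seq_even_bound[OF True i, of F D] D unfolding zD by (simp add: \<delta>_def)
  next
    case False
    have "z (i - p) \<le> D" "z (i - q) \<le> D"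
      using i p q p_le q_le by (auto intro!: D)
    then show ?thesis
      using mode_seq_odd_bound[OF False, of i F D] i unfolding zD by (simp add: \<delta>_def False)
  qed
  moreover have "0 \<le> z i" for i by (auto simp: z_def le_max_iff_disj)
  ultimately have "z \<longlonglongrightarrow> 0"
    using m_pos by (intro contraction_tendsto_0[of z \<delta> "2 * m"]) auto
  then show ?thesis
    by (rule Lim_null_comparison[rotated]) (cases s, simp_all add: z_def)
qed

definition \<rho> :: "nat \<Rightarrow> real" where "\<rho> = rho p q a b"

lemma \<rho>_eq: "\<rho> k = (\<alpha> * H (int p - int k) + \<beta> * H (int q - int k)) / (\<alpha> * p + \<beta> * q)"
proof -
  have "\<alpha> * p + \<beta> * q = (real p * a\<^sup>2 + real q * b\<^sup>2) / c\<^sup>2"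
    "\<alpha> * H (int p - int k) + \<beta> * H (int q - int k) = (a\<^sup>2 * H (int p - int k) + b\<^sup>2 * H (int q - int k)) / c\<^sup>2"
    by (simp_all add: \<alpha>_def \<beta>_def add_divide_distrib mult.commute)
  then show ?thesis
    using pos by (simp add: \<rho>_def rho_def)
qed

text \<open>The sum of the two chiralities obeys the scalar renewal recursion. Their difference
  loses the whole \<beta> part, since the daughters of size D_q are two of each chirality, and
  therefore decays.\<close>

lemma mode_seq_0_limit:
  "(\<lambda>i. mode_seq F 0 i s) \<longlonglongrightarrow> (\<Sum>k=1..m. of_real (\<rho> k) * ((F k True + F k False) / 2))"
proof -
  let ?y = "mode_seq F 0"
  define \<sigma> where "\<sigma> i = ?y i True + ?y i False" for i
  define d where "d i = ?y i True - ?y i False" for i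
  have rec: "?y i s = of_real \<alpha> * ?y (i - p) (\<not> s) + of_real (\<beta> / 2) * \<sigma> (i - q)" if "i \<ge> m" for i s
    by (cases s) (simp_all add: mode_seq_rec[OF that] \<sigma>_def algebra_simps)
  have \<sigma>: "\<sigma> i = of_real \<alpha> * \<sigma> (i - p) + of_real \<beta> * \<sigma> (i - q)" if "i \<ge> m" for i
    by (simp add: \<sigma>_def[of i] \<sigma>_def[of "i - p"] rec[OF that] algebra_simps)
  have d: "d i = - of_real \<alpha> * d (i - p)" if "i \<ge> m" for i
    by (simp add: d_def rec[OF that] algebra_simps)
  have lim\<sigma>: "\<sigma> \<longlonglongrightarrow> (\<Sum>k=1..m. of_real (\<rho> k) * \<sigma> (m - k))"
    by (rule renewal_limit[OF p q coprime \<alpha>\<beta> m \<sigma> \<rho>_eq])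
  have "(\<lambda>i. norm (d i)) \<longlonglongrightarrow> 0"
  proof (rule contraction_tendsto_0[of _ \<alpha> m])
    show "norm (d i) \<le> \<alpha> * D" if "m \<le> i" "\<And>l. i - m \<le> l \<Longrightarrow> l < i \<Longrightarrow> norm (d l) \<le> D" for i D
      using that(2)[of "i - p"] that(1) \<alpha>\<beta> p p_le by (simp add: d norm_mult)
  qed (use \<alpha>\<beta> m_pos in auto)
  then have limd: "d \<longlonglongrightarrow> 0" by (rule tendsto_norm_zero_cancel)
  have "(\<Sum>k=1..m. of_real (\<rho> k) * \<sigma> (m - k)) / 2 = (\<Sum>k=1..m. of_real (\<rho> k) * ((F k True + F k False) / 2))"
    unfolding sum_divide_distrib by (intro sum.cong) (auto simp: \<sigma>_def mode_seq.simps)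
  moreover have "(\<lambda>i. (\<sigma> i + (if s then 1 else - 1) * d i) / 2)
      \<longlonglongrightarrow> ((\<Sum>k=1..m. of_real (\<rho> k) * \<sigma> (m - k)) + (if s then 1 else - 1) * 0) / 2"
    by (intro tendsto_intros lim\<sigma> limd) auto
  moreover have "(\<sigma> i + (if s then 1 else - 1) * d i) / 2 = ?y i s" for i
    by (simp add: \<sigma>_def d_def)
  ultimately show ?thesis by simp
qed

lemma converges_to_mode_nonzero: "n \<noteq> 0 \<Longrightarrow> converges_to (\<lambda>(k, s, u). F k s * u powi n) 0"
  by (rule converges_to_mode) (auto intro: mode_seq_tendsto_0)

lemma converges_to_mode_0:
  fixes F :: "nat \<Rightarrow> bool \<Rightarrow> complex"
  shows "converges_to (\<lambda>(k, s, u). F k s) (\<Sum>k=1..m. of_real (\<rho> k) * ((F k True + F k False) / 2))"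
  using converges_to_mode[of F 0, OF mode_seq_0_limit] by simp

end

subsection \<open>Integration on the space of tiles\<close>

context
  notes One_nat_def [simp del]
begin

text \<open>The total mass is 1 / 2, so that the two circles of orientations together have mass
  1.\<close>

definition circle_measure :: "complex measure" where
  "circle_measure = distr (density lborel (\<lambda>\<phi>. ennreal (indicator {0..<2 * pi} \<phi> / (4 * pi))))
           (restrict_space borel (sphere 0 1)) cis"

lemma cis_measurable [measurable]: "cis \<in> measurable borel (restrict_space borel (sphere 0 1))"
  by (intro measurable_restrict_space2 borel_measurable_continuous_onI continuous_intros) auto

lemma sets_circle_measure [simp, measurable_cong]:
  "sets circle_measure = sets (restrict_space borel (sphere 0 1))"
  and space_circle_measure [simp]: "space circle_measure = sphere 0 1"
  by (auto simp: circle_measure_def space_restrict_space)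

lemma finite_circle_measure: "finite_measure circle_measure"
proof
  let ?d = "\<lambda>\<phi>. ennreal (indicator {0..<2 * pi} \<phi> / (4 * pi))"
  have "cis \<in> measurable (density lborel ?d) (restrict_space borel (sphere 0 1))"
    using cis_measurable by simp
  then have "emeasure circle_measure (space circle_measure) = emeasure (density lborel ?d) (cis -` sphere 0 1 \<inter> UNIV)"
    unfolding circle_measure_def by (subst emeasure_distr) (auto simp: space_restrict_space sets_restrict_space)
  also have "cis -` sphere 0 1 \<inter> UNIV = UNIV" by auto
  also have "emeasure (density lborel ?d) UNIV = (\<integral>\<^sup>+\<phi>. ennreal (1 / (4 * pi)) * indicator {0..<2 * pi} \<phi> \<partial>lborel)"
    by (subst emeasure_density) (auto intro!: nn_integral_cong split: split_indicator)
  also have "\<dots> = ennreal (1 / (4 * pi)) * ennreal (2 * pi)"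
    by (subst nn_integral_cmult_indicator) auto
  also have "\<dots> \<noteq> \<infinity>"
    by (simp add: ennreal_mult_eq_top_iff)
  finally show "emeasure circle_measure (space circle_measure) \<noteq> \<infinity>" .
qed

lemma integral_circle_measure:
  fixes g :: "complex \<Rightarrow> 'b::{banach, second_countable_topology}"
  assumes "g \<in> borel_measurable (restrict_space borel (sphere 0 1))"
  shows "integral\<^sup>L circle_measure g = (1 / (4 * pi)) *\<^sub>R (LINT \<phi>:{0..<2 * pi}|lborel. g (cis \<phi>))"
proof -
  have [measurable]: "(\<lambda>\<phi>. g (cis \<phi>)) \<in> borel_measurable borel"
    by (rule measurable_compose[OF cis_measurable assms])
  have "integral\<^sup>L circle_measure g
      = integral\<^sup>L (density lborel (\<lambda>\<phi>. ennreal (indicator {0..<2 * pi} \<phi> / (4 * pi)))) (\<lambda>\<phi>. g (cis \<phi>))"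
    unfolding circle_measure_def using assms by (intro integral_distr) simp_all
  also have "\<dots> = (LINT \<phi>|lborel. (indicator {0..<2 * pi} \<phi> / (4 * pi)) *\<^sub>R g (cis \<phi>))"
    by (intro integral_density) auto
  also have "\<dots> = (LINT \<phi>|lborel. (1 / (4 * pi)) *\<^sub>R (indicator {0..<2 * pi} \<phi> *\<^sub>R g (cis \<phi>)))"
    by (intro Bochner_Integration.integral_cong) auto
  also have "\<dots> = (1 / (4 * pi)) *\<^sub>R (LINT \<phi>|lborel. indicator {0..<2 * pi} \<phi> *\<^sub>R g (cis \<phi>))"
    by (rule integral_scaleR_right)
  finally show ?thesis
    by (simp only: set_lebesgue_integral_def)
qed

text \<open>Measurability can be asked circle by circle because sizes and chiralities are discrete;
  boundedness then gives integrability for the finite measures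
  \<open>weighted_measure m w\<close>.\<close>

definition bounded_borel :: "nat \<Rightarrow> (nat \<times> bool \<times> complex \<Rightarrow> 'b::{banach, second_countable_topology}) \<Rightarrow> bool" where
  "bounded_borel m f \<longleftrightarrow>
     (\<forall>k\<in>{1..m}. \<forall>s. (\<lambda>u. f (k, s, u)) \<in> borel_measurable (restrict_space borel (sphere 0 1))) \<and>
     (\<exists>B. \<forall>x\<in>tile_space m. norm (f x) \<le> B)"

lemma orientation_measure_eq: "orientation_measure = count_space UNIV \<Otimes>\<^sub>M circle_measure"
  by (simp add: orientation_measure_def circle_measure_def)

lemma finite_orientation_measure: "finite_measure orientation_measure"
proof -
  interpret c: finite_measure circle_measure by (rule finite_circle_measure)
  interpret b: finite_measure "count_space (UNIV :: bool set)" by (rule finite_measure_count_space) simp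
  show ?thesis
    unfolding orientation_measure_eq by (rule finite_measure_pair_measure) unfold_locales
qed

lemma bounded_borel_measurable:
  assumes "bounded_borel m f"
  shows "f \<in> borel_measurable (count_space {1..m} \<Otimes>\<^sub>M orientation_measure)"
    and "f \<in> borel_measurable (weighted_measure m w)"
proof -
  show *: "f \<in> borel_measurable (count_space {1..m} \<Otimes>\<^sub>M orientation_measure)"
  proof (rule measurable_pair_measure_countable1)
    fix k assume k: "k \<in> {1..m}"
    show "(\<lambda>y. f (k, y)) \<in> borel_measurable orientation_measure"
      unfolding orientation_measure_eq
    proof (rule measurable_pair_measure_countable1)
      fix s :: bool
      show "(\<lambda>u. f (k, s, u)) \<in> borel_measurable circle_measure"
        using assms k by (simp add: bounded_borel_def cong: measurable_cong_sets)
    qed simp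
  qed simp
  then show "f \<in> borel_measurable (weighted_measure m w)"
    by (simp only: weighted_measure_def measurable_cong_sets[OF sets_density refl])
qed

lemma finite_weighted_measure: "finite_measure (weighted_measure m w)"
proof
  interpret o: finite_measure orientation_measure by (rule finite_orientation_measure)
  \<comment> \<open>Inserting 0 keeps the maximum meaningful for m = 0.\<close>
  define W where "W = Max (insert 0 (w ` {1..m}))"
  have W: "w k \<le> W" if "k \<in> {1..m}" for k
    using that unfolding W_def by (intro Max_ge) auto
  have g: "(\<lambda>(k, _). ennreal (w k)) \<in> borel_measurable (count_space {1..m} \<Otimes>\<^sub>M orientation_measure)"
    unfolding case_prod_beta' by (rule measurable_compose[OF measurable_fst]) simp
  let ?M = "count_space {1..m} \<Otimes>\<^sub>M orientation_measure"
  have "emeasure (weighted_measure m w) (space (weighted_measure m w))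
      = (\<integral>\<^sup>+x. (case x of (k, _) \<Rightarrow> ennreal (w k)) * indicator (space ?M) x \<partial>?M)"
    unfolding weighted_measure_def space_density by (rule emeasure_density[OF g sets.top])
  also have "\<dots> = (\<integral>\<^sup>+x. (case x of (k, _) \<Rightarrow> ennreal (w k)) \<partial>?M)"
    by (rule nn_integral_cong) simp
  also have "\<dots> \<le> (\<integral>\<^sup>+x. ennreal W \<partial>(count_space {1..m} \<Otimes>\<^sub>M orientation_measure))"
    by (intro nn_integral_mono) (use W in \<open>auto simp: space_pair_measure intro!: ennreal_leI\<close>)
  also have "\<dots> = ennreal W * (emeasure (count_space {1..m}) {1..m} * emeasure orientation_measure (space orientation_measure))"
    by (simp add: space_pair_measure o.emeasure_pair_measure_Times)
  also have "\<dots> < \<infinity>"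
    by (simp add: ennreal_mult_less_top ennreal_mult_eq_top_iff o.emeasure_eq_measure of_nat_less_top)
  finally show "emeasure (weighted_measure m w) (space (weighted_measure m w)) \<noteq> \<infinity>" by simp
qed

lemma bounded_borel_integrable:
  assumes "bounded_borel m f"
  shows "integrable (weighted_measure m w) f"
proof -
  interpret finite_measure "weighted_measure m w" by (rule finite_weighted_measure)
  obtain B where "\<forall>x\<in>tile_space m. norm (f x) \<le> B"
    using assms by (auto simp: bounded_borel_def)
  then show ?thesis
    by (intro integrable_const_bound[of _ B] bounded_borel_measurable[OF assms])
       (auto intro!: AE_I2 simp: space_weighted_measure)
qed

text \<open>Fubini over the two discrete factors. The sign of the weights matters because
  \<open>ennreal\<close> truncates negative numbers to 0.\<close>

lemma integral_weighted_measure: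
  fixes f :: "nat \<times> bool \<times> complex \<Rightarrow> 'b::{banach, second_countable_topology}"
  assumes f: "bounded_borel m f" and w: "\<And>k. k \<in> {1..m} \<Longrightarrow> 0 \<le> w k"
  shows "integral\<^sup>L (weighted_measure m w) f =
    (\<Sum>k=1..m. w k *\<^sub>R (\<Sum>s\<in>UNIV. (1 / (4 * pi)) *\<^sub>R (LINT \<phi>:{0..<2 * pi}|lborel. f (k, s, cis \<phi>))))"
proof -
  interpret c: finite_measure circle_measure by (rule finite_circle_measure)
  interpret o: finite_measure orientation_measure by (rule finite_orientation_measure)
  interpret b: finite_measure "count_space (UNIV :: bool set)" by (rule finite_measure_count_space) simp
  interpret n: finite_measure "count_space {1..m}" by (rule finite_measure_count_space) simp
  interpret bc: pair_sigma_finite "count_space (UNIV :: bool set)" circle_measure ..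
  interpret no: pair_sigma_finite "count_space {1..m}" orientation_measure ..
  let ?M = "count_space {1..m} \<Otimes>\<^sub>M orientation_measure"
  interpret M: finite_measure ?M
    by (rule finite_measure_pair_measure) unfold_locales
  obtain B where B: "\<And>x. x \<in> tile_space m \<Longrightarrow> norm (f x) \<le> B"
    using f by (auto simp: bounded_borel_def)
  have fm [measurable]: "f \<in> borel_measurable ?M"
    by (rule bounded_borel_measurable[OF f])
  have wm [measurable]: "(\<lambda>x. w (fst x)) \<in> borel_measurable ?M"
    by (rule measurable_compose[OF measurable_fst]) simp
  have sp: "space ?M = tile_space m"
    by (auto simp: orientation_measure_eq tile_space_def space_pair_measure)
  define W where "W = Max (insert 0 (w ` {1..m}))"
  have W: "w k \<le> W" if "k \<in> {1..m}" for k
    using that unfolding W_def by (intro Max_ge) auto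
  have int: "integrable ?M (\<lambda>x. w (fst x) *\<^sub>R f x)"
  proof (rule M.integrable_const_bound[of _ "W * B"])
    show "AE x in ?M. norm (w (fst x) *\<^sub>R f x) \<le> W * B"
    proof (intro AE_I2)
      fix x assume "x \<in> space ?M"
      then have "fst x \<in> {1..m}" "norm (f x) \<le> B" using B by (auto simp: sp tile_space_def)
      then show "norm (w (fst x) *\<^sub>R f x) \<le> W * B"
        using w W order_trans[OF w W] by (auto intro!: mult_mono)
    qed
  qed simp
  have "integral\<^sup>L (weighted_measure m w) f = integral\<^sup>L (density ?M (\<lambda>x. ennreal (w (fst x)))) f"
    by (simp add: weighted_measure_def case_prod_beta')
  also have "\<dots> = (\<integral>x. w (fst x) *\<^sub>R f x \<partial>?M)"
    by (intro integral_density fm wm AE_I2) (use w in \<open>auto simp: sp tile_space_def\<close>)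
  also have "\<dots> = (\<integral>k. \<integral>y. w k *\<^sub>R f (k, y) \<partial>orientation_measure \<partial>count_space {1..m})"
    by (subst no.integral_fst'[OF int, symmetric]) simp
  also have "\<dots> = (\<Sum>k=1..m. w k *\<^sub>R (\<integral>y. f (k, y) \<partial>orientation_measure))"
    by (simp add: lebesgue_integral_count_space_finite)
  also have "\<dots> = (\<Sum>k=1..m. w k *\<^sub>R (\<Sum>s\<in>UNIV. (1 / (4 * pi)) *\<^sub>R (LINT \<phi>:{0..<2 * pi}|lborel. f (k, s, cis \<phi>))))"
  proof (intro sum.cong refl arg_cong2[where f = scaleR])
    fix k assume k: "k \<in> {1..m}"
    have m1: "(\<lambda>y. f (k, y)) \<in> borel_measurable orientation_measure"
      using measurable_compose[OF measurable_Pair1' fm, of k] k by simp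
    have "integrable orientation_measure (\<lambda>y. f (k, y))"
      by (rule o.integrable_const_bound[of _ B])
         (use B k m1 in \<open>auto intro!: AE_I2 simp: orientation_measure_eq space_pair_measure tile_space_def\<close>)
    then have "(\<integral>y. f (k, y) \<partial>orientation_measure) = (\<integral>s. \<integral>u. f (k, s, u) \<partial>circle_measure \<partial>count_space UNIV)"
      unfolding orientation_measure_eq by (subst bc.integral_fst'[symmetric]) auto
    also have "\<dots> = (\<Sum>s\<in>UNIV. \<integral>u. f (k, s, u) \<partial>circle_measure)"
      by (simp add: lebesgue_integral_count_space_finite)
    finally show "(\<integral>y. f (k, y) \<partial>orientation_measure)
        = (\<Sum>s\<in>UNIV. (1 / (4 * pi)) *\<^sub>R (LINT \<phi>:{0..<2 * pi}|lborel. f (k, s, cis \<phi>)))"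
      using f k by (simp add: integral_circle_measure bounded_borel_def)
  qed
  finally show ?thesis .
qed

lemma integral_cis_powi:
  "(LINT \<phi>:{0..<2 * pi}|lborel. cis \<phi> powi n) = (if n = 0 then 2 * pi else 0)"
proof (cases "n = 0")
  case True
  then show ?thesis by (simp add: set_lebesgue_integral_def scaleR_conv_of_real)
next
  case False
  let ?F = "\<lambda>x. cis (of_int n * x) / (\<i> * of_int n)"
  have "has_bochner_integral lborel (\<lambda>x. indicator {0..2 * pi} x *\<^sub>R cis (of_int n * x)) (?F (2 * pi) - ?F 0)"
  proof (rule has_bochner_integral_FTC_Icc)
    fix x :: real
    have "((\<lambda>x. cis (of_int n * x)) has_vector_derivative of_int n * (\<i> * cis (of_int n * x))) (at x within {0..2 * pi})"
    proof -
      have "((\<lambda>z. exp (\<i> * of_int n * z)) has_field_derivative of_int n * (\<i> * cis (of_int n * x))) (at (of_real x))"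
        by (auto intro!: derivative_eq_intros simp: cis_conv_exp mult_ac)
      then show ?thesis
        using has_vector_derivative_real_field by (fastforce simp: cis_conv_exp mult_ac)
    qed
    then show "(?F has_vector_derivative cis (of_int n * x)) (at x within {0..2 * pi})"
      using False by (auto intro!: derivative_eq_intros)
  qed (auto intro!: continuous_intros)
  moreover have "?F (2 * pi) - ?F 0 = 0"
    using cis_multiple_2pi[of "of_int n"] by (simp add: mult_ac)
  ultimately have "(LINT x|lborel. indicator {0..2 * pi} x *\<^sub>R cis (of_int n * x)) = 0"
    by (simp add: has_bochner_integral_iff)
  \<comment> \<open>The fundamental theorem of calculus was applied on the closed interval; the
    extra endpoint is a null set.\<close>
  moreover have "(LINT x|lborel. indicator {0..<2 * pi} x *\<^sub>R cis (of_int n * x))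
      = (LINT x|lborel. indicator {0..2 * pi} x *\<^sub>R cis (of_int n * x))"
  proof (intro integral_cong_AE)
    have [measurable]: "(\<lambda>x. cis (of_int n * x)) \<in> borel_measurable borel"
      by (intro borel_measurable_continuous_onI continuous_intros)
    show "(\<lambda>x. indicator {0..<2 * pi} x *\<^sub>R cis (of_int n * x)) \<in> borel_measurable lborel"
      "(\<lambda>x. indicator {0..2 * pi} x *\<^sub>R cis (of_int n * x)) \<in> borel_measurable lborel"
      by measurable
    show "AE x in lborel. indicator {0..<2 * pi} x *\<^sub>R cis (of_int n * x)
        = indicator {0..2 * pi} x *\<^sub>R cis (of_int n * x)"
      using AE_lborel_singleton[of "2 * pi"] by eventually_elim (auto split: split_indicator)
  qed
  ultimately show ?thesis
    using False by (simp add: set_lebesgue_integral_def cis_power_int)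
qed

end

subsection \<open>Continuous functions\<close>

text \<open>Laurent polynomials in u. With monomials and sums as the only rules, induction reduces
  additive claims to a single mode.\<close>

inductive trig_poly :: "(complex \<Rightarrow> complex) \<Rightarrow> bool" where
  monomial: "trig_poly (\<lambda>u. x * u powi n)"
| add: "trig_poly f \<Longrightarrow> trig_poly g \<Longrightarrow> trig_poly (\<lambda>u. f u + g u)"

text \<open>Equality is claimed on the unit circle only, since adding exponents of
  \<open>powi\<close> requires u \<noteq> 0.\<close>

lemma trig_poly_mult:
  assumes "trig_poly f" "trig_poly g"
  shows "\<exists>h. trig_poly h \<and> (\<forall>u\<in>sphere 0 1. h u = f u * g u)"
  using assms
proof (induction f)
  case (monomial x n)
  from monomial show ?case
  proof (induction g)
    case (monomial y k)
    have "(x * y) * u powi (n + k) = (x * u powi n) * (y * u powi k)" if "u \<in> sphere 0 1" for u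
    proof -
      have "u \<noteq> 0" using that by auto
      then show ?thesis by (simp add: power_int_add)
    qed
    then show ?case using trig_poly.monomial by blast
  next
    case (add f g)
    then obtain h h' where "trig_poly h" "\<forall>u\<in>sphere 0 1. h u = x * u powi n * f u"
      "trig_poly h'" "\<forall>u\<in>sphere 0 1. h' u = x * u powi n * g u" by blast
    then show ?case
      by (intro exI[of _ "\<lambda>u. h u + h' u"]) (auto intro: trig_poly.add simp: algebra_simps)
  qed
next
  case (add f f')
  then obtain h h' where "trig_poly h" "\<forall>u\<in>sphere 0 1. h u = f u * g u"
    "trig_poly h'" "\<forall>u\<in>sphere 0 1. h' u = f' u * g u" by blast
  then show ?case
    by (intro exI[of _ "\<lambda>u. h u + h' u"]) (auto intro: trig_poly.add simp: algebra_simps)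
qed

lemma real_polynomial_function_trig_poly:
  fixes f :: "complex \<Rightarrow> real"
  assumes "real_polynomial_function f"
  shows "\<exists>h. trig_poly h \<and> (\<forall>u\<in>sphere 0 1. h u = of_real (f u))"
  using assms
proof (induction f)
  case (linear f)
  \<comment> \<open>A real linear form is w u + cnj (w u) with w determined by its values at 1 and
    \<i>. On the circle cnj u = 1 / u, so this combines the modes 1 and -1.\<close>
  define w where "w = (of_real (f 1) - \<i> * of_real (f \<i>)) / 2"
  have "w * u powi 1 + cnj w * u powi - 1 = of_real (f u)" if "u \<in> sphere 0 1" for u
  proof -
    have "u powi - 1 = cnj u"
      using that by (simp add: power_int_minus inverse_complex_def complex_eq_iff cmod_def)
    moreover have "f u = Re u * f 1 + Im u * f \<i>"
    proof -
      have "u = Re u *\<^sub>R 1 + Im u *\<^sub>R \<i>" by (simp add: complex_eq_iff)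
      then have "f u = f (Re u *\<^sub>R 1 + Im u *\<^sub>R \<i>)" by simp
      then show ?thesis
        using bounded_linear.linear[OF linear] by (simp add: linear_add linear_scale)
    qed
    ultimately show ?thesis by (simp add: w_def complex_eq_iff diff_divide_distrib algebra_simps)
  qed
  then show ?case using trig_poly.add[OF trig_poly.monomial trig_poly.monomial] by blast
next
  case (const x)
  then show ?case using trig_poly.monomial[of "of_real x" 0] by (intro exI) auto
next
  case (add f g)
  then obtain h h' where "trig_poly h" "\<forall>u\<in>sphere 0 1. h u = of_real (f u)"
    "trig_poly h'" "\<forall>u\<in>sphere 0 1. h' u = of_real (g u)" by blast
  then show ?case
    by (intro exI[of _ "\<lambda>u. h u + h' u"]) (auto intro: trig_poly.add)
next
  case (mult f g)
  then obtain h h' where h: "trig_poly h" "\<forall>u\<in>sphere 0 1. h u = of_real (f u)"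
    "trig_poly h'" "\<forall>u\<in>sphere 0 1. h' u = of_real (g u)" by blast
  then show ?case using trig_poly_mult[OF h(1,3)] by force
qed

lemma continuous_on_trig_poly: "trig_poly h \<Longrightarrow> continuous_on (sphere 0 1) h"
proof (induction h rule: trig_poly.induct)
  case (monomial x n)
  have "\<forall>u::complex\<in>sphere 0 1. u \<noteq> 0 \<or> n \<ge> 0" by auto
  then show ?case by (intro continuous_intros) auto
qed (intro continuous_intros)

lemma trig_poly_approx:
  fixes g :: "complex \<Rightarrow> real"
  assumes "continuous_on (sphere 0 1) g" "\<epsilon> > 0"
  obtains h where "trig_poly h" "\<And>u. u \<in> sphere 0 1 \<Longrightarrow> norm (of_real (g u) - h u) < \<epsilon>"
proof -
  obtain g' where g': "real_polynomial_function g'" "\<And>u. u \<in> sphere 0 1 \<Longrightarrow> \<bar>g u - g' u\<bar> < \<epsilon>"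
    using Stone_Weierstrass_real_polynomial_function[OF _ assms] by auto
  then obtain h where "trig_poly h" "\<forall>u\<in>sphere 0 1. h u = of_real (g' u)"
    using real_polynomial_function_trig_poly by blast
  then show ?thesis
    using g'(2) by (intro that[of h]) (auto simp flip: of_real_diff)
qed

section \<open>Bounded Borel functions on the space of tiles\<close>

lemma bounded_borel_piece:
  assumes "continuous_on (sphere 0 1) g"
  shows "bounded_borel m (\<lambda>(k, s, u). if k = k0 \<and> s = s0 then g u else 0)"
proof -
  have gm: "g \<in> borel_measurable (restrict_space borel (sphere 0 1))"
    using assms by (rule borel_measurable_continuous_on_restrict)
  have "bounded (g ` sphere 0 1)"
    by (intro compact_imp_bounded compact_continuous_image assms compact_sphere)
  then obtain B where B: "0 < B" "\<forall>u\<in>sphere 0 1. norm (g u) \<le> B"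
    by (auto simp: bounded_pos)
  have meas: "(\<lambda>u. if k = k0 \<and> s = s0 then g u else 0) \<in> borel_measurable (restrict_space borel (sphere 0 1))" for k s
    using gm by (cases "k = k0 \<and> s = s0") simp_all
  have bound: "\<forall>x\<in>tile_space m. norm (case x of (k, s, u) \<Rightarrow> if k = k0 \<and> s = s0 then g u else 0) \<le> B"
    using B by (auto simp: tile_space_def)
  show ?thesis
    unfolding bounded_borel_def prod.case
    by (intro conjI ballI allI meas exI[of _ B] bspec[OF bound])
qed

lemma bounded_borel_add:
  "bounded_borel m f \<Longrightarrow> bounded_borel m g \<Longrightarrow> bounded_borel m (\<lambda>x. f x + g x)"
proof -
  assume f: "bounded_borel m f" and g: "bounded_borel m g"
  obtain B B' where "\<forall>x\<in>tile_space m. norm (f x) \<le> B" "\<forall>x\<in>tile_space m. norm (g x) \<le> B'"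
    using f g by (auto simp: bounded_borel_def)
  then have "\<forall>x\<in>tile_space m. norm (f x + g x) \<le> B + B'"
    by (meson add_mono norm_triangle_le)
  then show ?thesis
    using f g by (auto simp: bounded_borel_def intro!: borel_measurable_add)
qed

lemma bounded_borel_compose:
  assumes "bounded_linear h" "bounded_borel m f"
  shows "bounded_borel m (\<lambda>x. h (f x))"
proof -
  interpret bounded_linear h by fact
  obtain K where K: "\<And>x. norm (h x) \<le> norm x * K" "0 < K" using pos_bounded by blast
  obtain B where B: "\<forall>x\<in>tile_space m. norm (f x) \<le> B" using assms(2) by (auto simp: bounded_borel_def)
  have bound: "\<forall>x\<in>tile_space m. norm (h (f x)) \<le> B * K"
    using K B by (meson less_imp_le mult_right_mono order_trans)
  have h: "h \<in> borel_measurable borel"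
    by (intro borel_measurable_continuous_onI linear_continuous_on bounded_linear_axioms)
  have meas: "(\<lambda>u. h (f (k, s, u))) \<in> borel_measurable (restrict_space borel (sphere 0 1))" if "k \<in> {1..m}" for k s
    by (rule measurable_compose[OF _ h]) (use assms(2) that in \<open>auto simp: bounded_borel_def\<close>)
  show ?thesis
    unfolding bounded_borel_def by (intro conjI ballI allI meas exI[of _ "B * K"] bspec[OF bound])
qed

lemma bounded_borel_cong:
  assumes "\<And>x. x \<in> tile_space m \<Longrightarrow> f x = g x" "bounded_borel m f"
  shows "bounded_borel m g"
proof -
  have "(\<lambda>u. g (k, s, u)) \<in> borel_measurable (restrict_space borel (sphere 0 1))" if k: "k \<in> {1..m}" for k s
  proof -
    have "(\<lambda>u. g (k, s, u)) \<in> borel_measurable (restrict_space borel (sphere 0 1)) \<longleftrightarrow>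
        (\<lambda>u. f (k, s, u)) \<in> borel_measurable (restrict_space borel (sphere 0 1))"
      using assms(1) k by (intro measurable_cong) (auto simp: space_restrict_space tile_space_def)
    then show ?thesis using assms(2) k by (auto simp: bounded_borel_def)
  qed
  then show ?thesis using assms by (auto simp: bounded_borel_def)
qed

lemma bounded_borel_continuous:
  assumes f: "continuous_on (tile_space m) f"
  shows "bounded_borel m f"
proof -
  have "compact (tile_space m)"
    unfolding tile_space_def by (intro compact_Times compact_sphere finite_imp_compact) auto
  then have "bounded (f ` tile_space m)"
    by (intro compact_imp_bounded compact_continuous_image f)
  then have "\<exists>B. \<forall>x\<in>tile_space m. norm (f x) \<le> B"
    by (auto simp: bounded_iff)
  moreover have "continuous_on (sphere 0 1) (\<lambda>u. f (k, s, u))" if "k \<in> {1..m}" for k s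
    using that by (intro continuous_on_compose2[OF f] continuous_intros) (auto simp: tile_space_def)
  ultimately show ?thesis
    by (auto simp: bounded_borel_def intro: borel_measurable_continuous_on_restrict)
qed

context pinwheel begin

section \<open>Means and equidistributed functions\<close>

lemma \<rho>_nonneg: "0 \<le> \<rho> k"
  using \<alpha>\<beta> by (auto simp: \<rho>_eq H_def intro!: divide_nonneg_nonneg add_nonneg_nonneg)

text \<open>Read off from the limit of the zeroth mode with all coefficients 1: that sequence is
  constantly 1 because \<alpha> + \<beta> = 1, and its limit is the sum of the weights.\<close>

lemma sum_\<rho>: "(\<Sum>k=1..m. \<rho> k) = 1"
proof -
  have "(\<lambda>i. mode_seq (\<lambda>_ _. 1) 0 i True) = (\<lambda>_. 1)"
  proof
    fix i
    have "mode_seq (\<lambda>_ _. 1) 0 i s = 1" for s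
    proof (induction i arbitrary: s rule: less_induct)
      case (less i)
      show ?case
      proof (cases "i < m")
        case False
        then have "mode_seq (\<lambda>_ _. 1) 0 (i - p) s = 1" "mode_seq (\<lambda>_ _. 1) 0 (i - q) s = 1" for s
          using p q m_pos by (auto intro!: less)
        then show ?thesis
          using False \<alpha>\<beta>(3) by (simp add: mode_seq_rec) (simp flip: of_real_add)
      qed (simp add: mode_seq.simps)
    qed
    then show "mode_seq (\<lambda>_ _. 1) 0 i True = 1" .
  qed
  then have "(\<lambda>_::nat. 1) \<longlonglongrightarrow> complex_of_real (\<Sum>k=1..m. \<rho> k)"
    using mode_seq_0_limit[of "\<lambda>_ _. 1" True] by simp
  then have "complex_of_real (\<Sum>k=1..m. \<rho> k) = 1"
    using LIMSEQ_unique tendsto_const by blast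
  then show ?thesis by (metis of_real_eq_1_iff)
qed

definition mean :: "(nat \<times> bool \<times> complex \<Rightarrow> 'v::{banach, second_countable_topology}) \<Rightarrow> 'v" where
  "mean f = integral\<^sup>L (weighted_measure m \<rho>) f"

text \<open>Joining integrability to convergence lets \<open>mean\<close> be additive and monotone
  on this class, so that the closure properties below can be chained.\<close>

definition equidistributed :: "(nat \<times> bool \<times> complex \<Rightarrow> 'v::{banach, second_countable_topology}) \<Rightarrow> bool" where
  "equidistributed f \<longleftrightarrow> bounded_borel m f \<and> converges_to f (mean f)"

lemma mean_eq:
  "bounded_borel m f \<Longrightarrow> mean f =
    (\<Sum>k=1..m. \<rho> k *\<^sub>R (\<Sum>s\<in>UNIV. (1 / (4 * pi)) *\<^sub>R (LINT \<phi>:{0..<2 * pi}|lborel. f (k, s, cis \<phi>))))"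
  unfolding mean_def by (rule integral_weighted_measure) (simp_all add: \<rho>_nonneg)

lemma mean_add: "bounded_borel m f \<Longrightarrow> bounded_borel m g \<Longrightarrow> mean (\<lambda>x. f x + g x) = mean f + mean g"
  unfolding mean_def by (intro Bochner_Integration.integral_add bounded_borel_integrable)

lemma mean_compose: "bounded_linear h \<Longrightarrow> bounded_borel m f \<Longrightarrow> mean (\<lambda>x. h (f x)) = h (mean f)"
  unfolding mean_def by (intro integral_bounded_linear bounded_borel_integrable)

lemma mean_cong: "(\<And>x. x \<in> tile_space m \<Longrightarrow> f x = g x) \<Longrightarrow> mean f = mean g"
  unfolding mean_def by (intro Bochner_Integration.integral_cong) (auto simp: space_weighted_measure)

lemma mean_const: "mean (\<lambda>_. v) = v"
proof -
  have "(\<Sum>k=1..m. \<rho> k *\<^sub>R v) = v"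
    using sum_\<rho> by (simp flip: scaleR_left.sum)
  moreover have "bounded_borel m (\<lambda>_. v)"
    by (auto simp: bounded_borel_def)
  moreover have "(1 / (4 * pi)) *\<^sub>R ((2 * pi) *\<^sub>R v) + (1 / (4 * pi)) *\<^sub>R ((2 * pi) *\<^sub>R v) = v"
    by (simp flip: scaleR_left_distrib)
  ultimately show ?thesis
    by (subst mean_eq) (auto simp: set_lebesgue_integral_def UNIV_bool)
qed

lemma mean_mono:
  fixes f g :: "nat \<times> bool \<times> complex \<Rightarrow> real"
  assumes "bounded_borel m f" "bounded_borel m g" "\<And>x. x \<in> tile_space m \<Longrightarrow> f x \<le> g x"
  shows "mean f \<le> mean g"
  unfolding mean_def
  by (intro integral_mono bounded_borel_integrable assms) (auto simp: space_weighted_measure intro: assms)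

lemma norm_mean_le:
  assumes f: "bounded_borel m f" and B: "\<And>x. x \<in> tile_space m \<Longrightarrow> norm (f x) \<le> B"
  shows "norm (mean f) \<le> B"
proof -
  have "norm (mean f) \<le> (\<integral>x. norm (f x) \<partial>weighted_measure m \<rho>)"
    unfolding mean_def by (rule integral_norm_bound)
  also have "\<dots> \<le> mean (\<lambda>_. B)"
    unfolding mean_def using B
    by (intro integral_mono integrable_norm bounded_borel_integrable f)
       (auto simp: space_weighted_measure bounded_borel_def)
  finally show ?thesis by (simp add: mean_const)
qed

lemma equidistributed_cong:
  assumes "\<And>x. x \<in> tile_space m \<Longrightarrow> f x = g x" "equidistributed f"
  shows "equidistributed g"
proof -
  have "uniform_limit (tile_space m) (\<lambda>j. (averaging ^^ j) g) (\<lambda>_. mean f) sequentially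
      \<longleftrightarrow> uniform_limit (tile_space m) (\<lambda>j. (averaging ^^ j) f) (\<lambda>_. mean f) sequentially"
    by (intro uniform_limit_cong' averaging_power_cong) (auto simp: assms(1))
  then show ?thesis
    using assms(2) bounded_borel_cong[OF assms(1)] mean_cong[of f g] assms(1)
    by (auto simp: equidistributed_def converges_to_def)
qed

lemma equidistributed_add:
  "equidistributed f \<Longrightarrow> equidistributed g \<Longrightarrow> equidistributed (\<lambda>x. f x + g x)"
  by (auto simp: equidistributed_def converges_to_def bounded_borel_add mean_add averaging_power_add
      intro: uniform_limit_add)

lemma equidistributed_compose:
  assumes "bounded_linear h" "equidistributed f"
  shows "equidistributed (\<lambda>x. h (f x))"
  using assms averaging_power_linear[OF bounded_linear.linear[OF assms(1)]]
  by (auto simp: equidistributed_def converges_to_def bounded_borel_compose mean_compose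
      intro: bounded_linear.uniform_limit)

lemma equidistributed_sum:
  "finite A \<Longrightarrow> (\<And>i. i \<in> A \<Longrightarrow> equidistributed (f i)) \<Longrightarrow> equidistributed (\<lambda>x. \<Sum>i\<in>A. f i x)"
proof (induction A rule: finite_induct)
  case empty
  have "equidistributed (\<lambda>_. 0 :: 'b)"
    by (auto simp: equidistributed_def converges_to_def bounded_borel_def mean_const averaging_power_const
        uniform_limit_const)
  then show ?case by simp
qed (auto intro: equidistributed_add)

text \<open>The iterates of \<open>averaging\<close> and \<open>mean\<close> are contractions for
  the supremum norm, so an approximation error is never amplified.\<close>

lemma equidistributed_uniform_closure:
  assumes f: "bounded_borel m f"
    and approx: "\<And>\<epsilon>. \<epsilon> > 0 \<Longrightarrow> \<exists>g. equidistributed g \<and> (\<forall>x\<in>tile_space m. norm (f x - g x) \<le> \<epsilon>)"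
  shows "equidistributed f"
  unfolding equidistributed_def converges_to_def uniform_limit_iff
proof (intro conjI f allI impI)
  fix \<epsilon> :: real assume "\<epsilon> > 0"
  then obtain g where g: "equidistributed g" and fg: "\<forall>x\<in>tile_space m. norm (f x - g x) \<le> \<epsilon> / 4"
    using approx[of "\<epsilon> / 4"] by auto
  have gb: "bounded_borel m (\<lambda>x. - g x)"
    using g bounded_borel_compose[OF bounded_linear_minus[OF bounded_linear_ident]]
    by (auto simp: equidistributed_def)
  have "mean (\<lambda>x. f x + - g x) = mean f - mean g"
    using mean_add[OF f gb] mean_compose[OF bounded_linear_minus[OF bounded_linear_ident], of g] g
    by (simp add: equidistributed_def)
  then have mean: "norm (mean f - mean g) \<le> \<epsilon> / 4"
    using norm_mean_le[OF bounded_borel_add[OF f gb], of "\<epsilon> / 4"] fg by simp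
  have avg: "norm ((averaging ^^ j) f x - (averaging ^^ j) g x) \<le> \<epsilon> / 4" if "x \<in> tile_space m" for j x
  proof -
    have "(averaging ^^ j) (\<lambda>x. f x + - g x) x = (averaging ^^ j) f x - (averaging ^^ j) g x"
      unfolding averaging_power_add
      by (subst averaging_power_linear[OF bounded_linear.linear[OF bounded_linear_minus[OF bounded_linear_ident]]]) simp
    then show ?thesis
      using averaging_power_norm_le[of "\<lambda>x. f x + - g x" "\<epsilon> / 4" x j] fg that by simp
  qed
  have "\<forall>\<^sub>F j in sequentially. \<forall>x\<in>tile_space m. dist ((averaging ^^ j) g x) (mean g) < \<epsilon> / 2"
    using g half_gt_zero[OF \<open>\<epsilon> > 0\<close>]
    unfolding equidistributed_def converges_to_def uniform_limit_iff by blast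
  then show "\<forall>\<^sub>F j in sequentially. \<forall>x\<in>tile_space m. dist ((averaging ^^ j) f x) (mean f) < \<epsilon>"
  proof eventually_elim
    case (elim j)
    show ?case
    proof
      fix x assume x: "x \<in> tile_space m"
      have "dist ((averaging ^^ j) f x) (mean f) \<le> dist ((averaging ^^ j) f x) ((averaging ^^ j) g x)
          + (dist ((averaging ^^ j) g x) (mean g) + dist (mean g) (mean f))"
        by (meson add_left_mono dist_triangle order_trans)
      also have "\<dots> < \<epsilon> / 4 + (\<epsilon> / 2 + \<epsilon> / 4)"
        using avg[OF x, of j] elim x mean
        by (intro add_le_less_mono add_less_le_mono) (auto simp: dist_norm norm_minus_commute)
      finally show "dist ((averaging ^^ j) f x) (mean f) < \<epsilon>" by simp
    qed
  qed
qed

text \<open>Positivity of \<open>averaging\<close> traps the iterates of f between those of g and h,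
  and the limits of these are as close as desired; uniformity is inherited.\<close>

lemma equidistributed_squeeze:
  fixes f :: "nat \<times> bool \<times> complex \<Rightarrow> real"
  assumes f: "bounded_borel m f"
    and approx: "\<And>\<epsilon>. \<epsilon> > 0 \<Longrightarrow> \<exists>g h. equidistributed g \<and> equidistributed h \<and>
      (\<forall>x\<in>tile_space m. g x \<le> f x \<and> f x \<le> h x) \<and> mean h - mean g < \<epsilon>"
  shows "equidistributed f"
  unfolding equidistributed_def converges_to_def uniform_limit_iff
proof (intro conjI f allI impI)
  fix \<epsilon> :: real assume "\<epsilon> > 0"
  then obtain g h where g: "equidistributed g" and h: "equidistributed h"
    and gfh: "\<And>x. x \<in> tile_space m \<Longrightarrow> g x \<le> f x" "\<And>x. x \<in> tile_space m \<Longrightarrow> f x \<le> h x"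
    and gap: "mean h - mean g < \<epsilon> / 2"
    using approx[of "\<epsilon> / 2"] by auto
  have mm: "mean g \<le> mean f" "mean f \<le> mean h"
    using g h f gfh by (auto intro!: mean_mono simp: equidistributed_def)
  have "\<forall>\<^sub>F j in sequentially. \<forall>x\<in>tile_space m. dist ((averaging ^^ j) g x) (mean g) < \<epsilon> / 2"
    "\<forall>\<^sub>F j in sequentially. \<forall>x\<in>tile_space m. dist ((averaging ^^ j) h x) (mean h) < \<epsilon> / 2"
    using g h half_gt_zero[OF \<open>\<epsilon> > 0\<close>]
    unfolding equidistributed_def converges_to_def uniform_limit_iff by blast+
  then show "\<forall>\<^sub>F j in sequentially. \<forall>x\<in>tile_space m. dist ((averaging ^^ j) f x) (mean f) < \<epsilon>"
  proof eventually_elim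
    case (elim j)
    show ?case
    proof
      fix x assume x: "x \<in> tile_space m"
      have "(averaging ^^ j) g x \<le> (averaging ^^ j) f x" "(averaging ^^ j) f x \<le> (averaging ^^ j) h x"
        using x gfh by (auto intro!: averaging_power_mono)
      moreover have "\<bar>(averaging ^^ j) g x - mean g\<bar> < \<epsilon> / 2" "\<bar>(averaging ^^ j) h x - mean h\<bar> < \<epsilon> / 2"
        using elim x by (simp_all add: dist_real_def)
      ultimately show "dist ((averaging ^^ j) f x) (mean f) < \<epsilon>"
        using mm gap unfolding dist_real_def by linarith
    qed
  qed
qed

text \<open>The factor 1 / 2 is the mass of a single circle.\<close>

lemma mean_mode:
  "mean (\<lambda>(k, s, u). if k = k0 \<and> s = s0 then x * u powi n else 0)
    = (if n = 0 \<and> k0 \<in> {1..m} then of_real (\<rho> k0) * (x / 2) else 0)"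
proof -
  let ?f = "\<lambda>(k, s, u). if k = k0 \<and> s = s0 then x * u powi n else 0"
  have b: "bounded_borel m ?f"
    by (intro bounded_borel_piece continuous_on_trig_poly trig_poly.monomial)
  have "(LINT \<phi>:{0..<2 * pi}|lborel. ?f (k, s, cis \<phi>)) = (if k = k0 \<and> s = s0 \<and> n = 0 then 2 * pi * x else 0)" for k s
  proof (cases "k = k0 \<and> s = s0")
    case True
    then show ?thesis using integral_cis_powi[of n] by simp
  qed (auto simp: set_lebesgue_integral_def)
  then have "mean ?f = (\<Sum>k=1..m. if k = k0 then (if n = 0 then of_real (\<rho> k0) * (x / 2) else 0) else 0)"
    unfolding mean_eq[OF b] by (intro sum.cong refl) (auto simp: UNIV_bool scaleR_conv_of_real)
  then show ?thesis by (simp add: sum.delta)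
qed

lemma equidistributed_mode:
  "equidistributed (\<lambda>(k, s, u). if k = k0 \<and> s = s0 then x * u powi n else 0)"
proof -
  let ?F = "\<lambda>k s. if k = k0 \<and> s = s0 then x else 0"
  have eq: "(\<lambda>(k, s, u). ?F k s * u powi n) = (\<lambda>(k, s, u). if k = k0 \<and> s = s0 then x * u powi n else 0)"
    by auto
  have "converges_to (\<lambda>(k, s, u). ?F k s * u powi n) (if n = 0 \<and> k0 \<in> {1..m} then of_real (\<rho> k0) * (x / 2) else 0)"
  proof (cases "n = 0")
    case True
    have "(\<Sum>k=1..m. of_real (\<rho> k) * ((?F k True + ?F k False) / 2))
        = (\<Sum>k=1..m. if k = k0 then of_real (\<rho> k0) * (x / 2) else 0)"
      by (intro sum.cong refl) auto
    then show ?thesis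
      using converges_to_mode_0[of ?F] True by (simp add: sum.delta)
  qed (use converges_to_mode_nonzero in auto)
  then show ?thesis
    unfolding equidistributed_def mean_mode eq
    by (intro conjI bounded_borel_piece continuous_on_trig_poly trig_poly.monomial)
qed

lemma equidistributed_trig_poly:
  assumes "trig_poly h"
  shows "equidistributed (\<lambda>(k, s, u). if k = k0 \<and> s = s0 then h u else 0)"
  using assms
proof (induction h)
  case (monomial x n)
  then show ?case by (rule equidistributed_mode)
next
  case (add f g)
  show ?case
    by (rule equidistributed_cong[OF _ equidistributed_add[OF add.IH]]) auto
qed

text \<open>The approximating trigonometric polynomials are complex even for real g; taking real
  parts afterwards is a bounded linear map and returns to g.\<close>

lemma equidistributed_real_piece:
  assumes "continuous_on (sphere 0 1) g"
  shows "equidistributed (\<lambda>(k, s, u). if k = k0 \<and> s = s0 then g u else (0 :: real))"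
proof -
  have "equidistributed (\<lambda>(k, s, u). if k = k0 \<and> s = s0 then complex_of_real (g u) else 0)"
  proof (rule equidistributed_uniform_closure)
    show "bounded_borel m (\<lambda>(k, s, u). if k = k0 \<and> s = s0 then complex_of_real (g u) else 0)"
      by (intro bounded_borel_piece continuous_intros assms)
    fix \<epsilon> :: real assume "\<epsilon> > 0"
    then obtain h where h: "trig_poly h" "\<And>u. u \<in> sphere 0 1 \<Longrightarrow> norm (of_real (g u) - h u) < \<epsilon>"
      using trig_poly_approx[OF assms] by blast
    then show "\<exists>h'. equidistributed h' \<and> (\<forall>x\<in>tile_space m. norm ((case x of (k, s, u) \<Rightarrow>
        if k = k0 \<and> s = s0 then complex_of_real (g u) else 0) - h' x) \<le> \<epsilon>)"
      using \<open>\<epsilon> > 0\<close> by (intro exI[of _ "\<lambda>(k, s, u). if k = k0 \<and> s = s0 then h u else 0"] conjI equidistributed_trig_poly)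
        (auto simp: tile_space_def less_imp_le)
  qed
  from equidistributed_compose[OF bounded_linear_Re this] show ?thesis
    by (rule equidistributed_cong[rotated]) auto
qed

lemma equidistributed_continuous:
  fixes f :: "nat \<times> bool \<times> complex \<Rightarrow> complex"
  assumes f: "continuous_on (tile_space m) f"
  shows "equidistributed f"
proof -
  have piece: "equidistributed (\<lambda>(k, s, u). if k = k0 \<and> s = s0 then f (k0, s0, u) else 0)" if k0: "k0 \<in> {1..m}" for k0 s0
  proof -
    have c: "continuous_on (sphere 0 1) (\<lambda>u. f (k0, s0, u))"
      using k0 by (intro continuous_on_compose2[OF f] continuous_intros) (auto simp: tile_space_def)
    have R: "equidistributed (\<lambda>(k, s, u). if k = k0 \<and> s = s0 then Re (f (k0, s0, u)) else 0)"
      and I: "equidistributed (\<lambda>(k, s, u). if k = k0 \<and> s = s0 then Im (f (k0, s0, u)) else 0)"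
      by (intro equidistributed_real_piece continuous_intros c)+
    have "bounded_linear (\<lambda>x. \<i> * complex_of_real x)"
      by (intro bounded_linear_mult_right[THEN bounded_linear_compose] bounded_linear_of_real)
    from equidistributed_add[OF equidistributed_compose[OF bounded_linear_of_real R] equidistributed_compose[OF this I]]
    show ?thesis
      by (rule equidistributed_cong[rotated]) (auto simp: complex_eq_iff)
  qed
  have "equidistributed (\<lambda>x. \<Sum>i\<in>{1..m} \<times> UNIV. (case x of (k, s, u) \<Rightarrow> if k = fst i \<and> s = snd i then f (fst i, snd i, u) else 0))"
    by (rule equidistributed_sum) (auto intro!: piece)
  then show ?thesis
  proof (rule equidistributed_cong[rotated])
    fix x assume "x \<in> tile_space m"
    moreover obtain k s u where x: "x = (k, s, u)" by (cases x) auto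
    ultimately have "(k, s) \<in> {1..m} \<times> UNIV" by (auto simp: tile_space_def)
    moreover have "(\<Sum>i\<in>{1..m} \<times> UNIV. (case x of (k, s, u) \<Rightarrow> if k = fst i \<and> s = snd i then f (fst i, snd i, u) else 0))
       = (\<Sum>i\<in>{1..m} \<times> UNIV. if i = (k, s) then f (k, s, u) else 0)"
      unfolding x by (intro sum.cong refl) auto
    ultimately show "(\<Sum>i\<in>{1..m} \<times> UNIV. (case x of (k, s, u) \<Rightarrow> if k = fst i \<and> s = snd i then f (fst i, snd i, u) else 0)) = f x"
      by (simp add: sum.delta x)
  qed
qed

end

subsection \<open>Intervals\<close>

lemma cis_eq_iff: "cis s = cis t \<longleftrightarrow> (\<exists>n::int. s = t + 2 * pi * n)"
  using sin_cos_eq_iff[of s t] by (auto simp: complex_eq_iff)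

lemma unit_circle_representative:
  assumes "norm u = 1"
  obtains t where "x \<le> t" "t < x + 2 * pi" "u = cis t"
proof -
  obtain \<phi> where \<phi>: "u = cis \<phi>"
    using complex_unimodular_polar[OF assms] by (auto simp: complex_eq_iff)
  define t where "t = x + 2 * pi * frac ((\<phi> - x) / (2 * pi))"
  have "cis \<phi> = cis t"
    unfolding cis_eq_iff t_def
    by (intro exI[of _ "\<lfloor>(\<phi> - x) / (2 * pi)\<rfloor>"]) (simp add: frac_def field_simps)
  moreover have "x \<le> t" "t < x + 2 * pi"
    by (auto simp: t_def frac_lt_1)
  ultimately show ?thesis using that \<phi> by blast
qed

text \<open>J may be unbounded or wind around the circle several times. If it contains an open
  interval of length 2 pi, that interval serves; otherwise J has length at most 2 pi, and its
  infimum and supremum are the endpoints.\<close>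

lemma arc_endpoints:
  fixes J :: "real set"
  assumes "is_interval J" "J \<noteq> {}"
  obtains x y where "x \<le> y" "y \<le> x + 2 * pi" "cis ` {x<..<y} \<subseteq> cis ` J" "cis ` J \<subseteq> cis ` {x..y}"
proof (cases "\<exists>x. {x<..<x + 2 * pi} \<subseteq> J")
  case True
  then obtain x where x: "{x<..<x + 2 * pi} \<subseteq> J" by blast
  have "cis ` J \<subseteq> cis ` {x..x + 2 * pi}"
  proof
    fix u assume "u \<in> cis ` J"
    then have "norm u = 1" by auto
    then obtain t where "x \<le> t" "t < x + 2 * pi" "u = cis t"
      by (rule unit_circle_representative)
    then show "u \<in> cis ` {x..x + 2 * pi}" by auto
  qed
  then show ?thesis using x by (intro that[of x "x + 2 * pi"]) auto
next
  case False
  have conv: "z \<in> J" if "s \<in> J" "t \<in> J" "s \<le> z" "z \<le> t" for s t z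
    using assms(1) that unfolding is_interval_1 by blast
  have short: "t \<le> s + 2 * pi" if "s \<in> J" "t \<in> J" for s t
  proof (rule ccontr)
    assume "\<not> t \<le> s + 2 * pi"
    then have "{s<..<s + 2 * pi} \<subseteq> J" using conv[OF that] by auto
    then show False using False by blast
  qed
  obtain j where j: "j \<in> J" using assms(2) by blast
  have bdd: "bdd_above J" "bdd_below J"
    using short[OF j] short[OF _ j]
    by (auto intro!: bdd_aboveI[of _ "j + 2 * pi"] bdd_belowI[of _ "j - 2 * pi"] simp: diff_le_eq)
  define x where "x = Inf J"
  define y where "y = Sup J"
  have J: "J \<subseteq> {x..y}"
    using bdd by (auto simp: x_def y_def intro: cInf_lower cSup_upper)
  have "{x<..<y} \<subseteq> J"
  proof
    fix z assume z: "z \<in> {x<..<y}"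
    then obtain s t where "s \<in> J" "s < z" "t \<in> J" "z < t"
      using cInf_lessD[OF assms(2), of z] less_cSupD[OF assms(2), of z] by (auto simp: x_def y_def)
    then show "z \<in> J" using conv[of s t z] by simp
  qed
  moreover have "y \<le> x + 2 * pi"
  proof -
    have "t - 2 * pi \<le> x" if "t \<in> J" for t
      unfolding x_def using short that by (intro cInf_greatest assms(2)) (auto simp: diff_le_eq)
    then show ?thesis
      unfolding y_def by (intro cSup_least assms(2)) (auto simp: diff_le_eq)
  qed
  moreover have "x \<le> y" using J j by auto
  ultimately show ?thesis using J by (intro that[of x y]) auto
qed

text \<open>For nonempty closed K these continuous functions decrease to the indicator of K as N
  grows.\<close>

definition bump :: "complex set \<Rightarrow> nat \<Rightarrow> complex \<Rightarrow> real" where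
  "bump K N u = max 0 (1 - real N * infdist u K)"

lemma bump_bounds: "0 \<le> bump K N u" "bump K N u \<le> 1"
  by (auto simp: bump_def infdist_nonneg)

lemma bump_eq_1: "u \<in> K \<Longrightarrow> bump K N u = 1"
  by (simp add: bump_def)

lemma continuous_on_bump: "continuous_on S (bump K N)"
  unfolding bump_def by (intro continuous_intros)

lemma bump_tendsto_0:
  assumes "closed K" "K \<noteq> {}" "u \<notin> K"
  shows "(\<lambda>N. bump K N u) \<longlonglongrightarrow> 0"
proof (rule tendsto_eventually)
  have d: "infdist u K > 0"
    using assms in_closed_iff_infdist_zero[of K u] infdist_nonneg[of u K] by auto
  then obtain N0 where "1 < real N0 * infdist u K"
    using ex_less_of_nat_mult by blast
  then have "bump K N u = 0" if "N \<ge> N0" for N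
  proof -
    have "real N0 * infdist u K \<le> real N * infdist u K"
      using that d by (intro mult_right_mono) auto
    then have "1 < real N * infdist u K" using \<open>1 < real N0 * infdist u K\<close> by linarith
    then show ?thesis by (simp add: bump_def)
  qed
  then show "\<forall>\<^sub>F N in sequentially. bump K N u = 0"
    by (auto simp: eventually_sequentially)
qed

text \<open>The preimage of a point under \<open>cis\<close> is empty or a translate of the
  multiples of 2 pi, hence countable.\<close>

lemma AE_cis_notin_finite:
  assumes "finite P"
  shows "AE \<phi> in lborel. cis \<phi> \<notin> P"
proof -
  have "AE \<phi> in lborel. cis \<phi> \<noteq> w" for w
  proof (cases "\<exists>x. w = cis x")
    case True
    then obtain x where x: "w = cis x" by blast
    have "countable (range (\<lambda>n::int. x + 2 * pi * n))" by simp
    then have "AE \<phi> in lborel. \<phi> \<notin> range (\<lambda>n::int. x + 2 * pi * n)"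
      by (intro AE_not_in countable_imp_null_set_lborel)
    then show ?thesis
      by eventually_elim (auto simp: x cis_eq_iff)
  qed auto
  then have "AE \<phi> in lborel. \<forall>w\<in>P. cis \<phi> \<noteq> w"
    using assms by (intro AE_finite_allI) auto
  then show ?thesis by eventually_elim auto
qed

text \<open>The integrand is the gap between an upper bound \<open>bump K1 N\<close> and a lower
  bound \<open>1 - bump K2 N\<close>. It lies in [-1, 1] and tends to 0 wherever the point belongs
  to only one of the two sets.\<close>

lemma bump_integral_tendsto_0:
  assumes K: "closed K1" "closed K2" "K1 \<noteq> {}" "K2 \<noteq> {}" "sphere 0 1 \<subseteq> K1 \<union> K2" "finite (K1 \<inter> K2)"
  shows "(\<lambda>N. LINT \<phi>:{0..<2 * pi}|lborel. bump K1 N (cis \<phi>) + bump K2 N (cis \<phi>) - 1) \<longlonglongrightarrow> 0"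
proof -
  let ?D = "\<lambda>N \<phi>. bump K1 N (cis \<phi>) + bump K2 N (cis \<phi>) - 1"
  have meas: "(\<lambda>\<phi>. indicator {0..<2 * pi} \<phi> *\<^sub>R ?D N \<phi>) \<in> borel_measurable lborel" for N
  proof -
    have [measurable]: "?D N \<in> borel_measurable borel"
      by (intro borel_measurable_continuous_onI continuous_intros
          continuous_on_compose2[OF continuous_on_bump[of UNIV]]) auto
    show ?thesis by measurable
  qed
  have "(\<lambda>N. LINT \<phi>|lborel. indicator {0..<2 * pi} \<phi> *\<^sub>R ?D N \<phi>) \<longlonglongrightarrow> integral\<^sup>L lborel (\<lambda>_ :: real. 0 :: real)"
  proof (rule integral_dominated_convergence[where w = "\<lambda>\<phi>. indicator {0..<2 * pi} \<phi> :: real"])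
    show "integrable lborel (\<lambda>\<phi>. indicator {0..<2 * pi} \<phi> :: real)" by simp
    show "AE \<phi> in lborel. (\<lambda>N. indicator {0..<2 * pi} \<phi> *\<^sub>R ?D N \<phi>) \<longlonglongrightarrow> 0"
      using AE_cis_notin_finite[OF K(6)]
    proof eventually_elim
      case (elim \<phi>)
      have "(\<lambda>N. ?D N \<phi>) \<longlonglongrightarrow> 0"
      proof (cases "cis \<phi> \<in> K1")
        case True
        then have "cis \<phi> \<notin> K2" using elim by blast
        then show ?thesis
          using bump_tendsto_0[OF K(2,4)] True by (simp add: bump_eq_1)
      next
        case False
        moreover have "cis \<phi> \<in> sphere 0 1" by simp
        ultimately have "cis \<phi> \<in> K2" using K(5) by blast
        then show ?thesis
          using bump_tendsto_0[OF K(1,3) False] by (simp add: bump_eq_1)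
      qed
      then have "(\<lambda>N. indicator {0..<2 * pi} \<phi> *\<^sub>R ?D N \<phi>) \<longlonglongrightarrow> indicator {0..<2 * pi} \<phi> *\<^sub>R 0"
        by (intro tendsto_scaleR tendsto_const)
      then show ?case by simp
    qed
    show "AE \<phi> in lborel. norm (indicator {0..<2 * pi} \<phi> *\<^sub>R ?D N \<phi>) \<le> indicator {0..<2 * pi} \<phi>" for N
    proof (rule AE_I2)
      fix \<phi>
      show "norm (indicator {0..<2 * pi} \<phi> *\<^sub>R ?D N \<phi>) \<le> indicator {0..<2 * pi} \<phi>"
        using bump_bounds[of K1 N "cis \<phi>"] bump_bounds[of K2 N "cis \<phi>"]
        by (auto split: split_indicator)
    qed
  qed (use meas in auto)
  then show ?thesis by (simp add: set_lebesgue_integral_def)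
qed

context pinwheel begin

lemma mean_piece:
  fixes g :: "complex \<Rightarrow> real"
  assumes "continuous_on (sphere 0 1) g" "k0 \<in> {1..m}"
  shows "mean (\<lambda>(k, s, u). if k = k0 \<and> s = s0 then g u else 0)
    = \<rho> k0 * (1 / (4 * pi) * (LINT \<phi>:{0..<2 * pi}|lborel. g (cis \<phi>)))"
proof -
  let ?f = "\<lambda>(k, s, u). if k = k0 \<and> s = s0 then g u else 0"
  have "(LINT \<phi>:{0..<2 * pi}|lborel. ?f (k, s, cis \<phi>))
      = (if k = k0 \<and> s = s0 then LINT \<phi>:{0..<2 * pi}|lborel. g (cis \<phi>) else 0)" for k s
    by (cases "k = k0 \<and> s = s0") (auto simp: set_lebesgue_integral_def)
  then have "mean ?f = (\<Sum>k=1..m. if k = k0 then \<rho> k0 * (1 / (4 * pi) * (LINT \<phi>:{0..<2 * pi}|lborel. g (cis \<phi>))) else 0)"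
    unfolding mean_eq[OF bounded_borel_piece[OF assms(1)]]
    by (intro sum.cong refl) (auto simp: UNIV_bool)
  then show ?thesis using assms(2) by (simp add: sum.delta)
qed

text \<open>An arc and its complement are contained in compact arcs that meet in at most two points, and
  the indicator is squeezed between bump functions of these two arcs.\<close>

lemma equidistributed_arc:
  assumes J: "is_interval J" "J \<noteq> {}" and k0: "k0 \<in> {1..m}"
  shows "equidistributed (\<lambda>(k, s, u). if k = k0 \<and> s = s0 then indicator (cis ` J) u else (0::real))"
proof -
  define E where "E = cis ` J"
  obtain x y where xy: "x \<le> y" "y \<le> x + 2 * pi" "cis ` {x<..<y} \<subseteq> E" "E \<subseteq> cis ` {x..y}"
    unfolding E_def using arc_endpoints[OF J] by blast
  define K1 where "K1 = cis ` {x..y}"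
  define K2 where "K2 = cis ` {y..x + 2 * pi}"
  have closed: "closed K1" "closed K2"
    unfolding K1_def K2_def by (intro compact_imp_closed compact_continuous_image continuous_intros compact_Icc)+
  have ne: "K1 \<noteq> {}" "K2 \<noteq> {}" using xy by (auto simp: K1_def K2_def)
  have compl: "u \<in> K2" if u: "norm u = 1" "u \<notin> E" for u
  proof -
    obtain t where t: "x \<le> t" "t < x + 2 * pi" "u = cis t"
      using unit_circle_representative[OF u(1)] by blast
    \<comment> \<open>The starting point x may be missing from the arc; it then reappears in K2 as
      the end x + 2 pi.\<close>
    then have "t = x \<or> y \<le> t" using u(2) xy(3) by force
    moreover have "cis x = cis (x + 2 * pi)" by (simp flip: cis_mult)
    ultimately show ?thesis using t xy unfolding K2_def by (metis atLeastAtMost_iff imageI less_imp_le order_refl)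
  qed
  have cover: "sphere 0 1 \<subseteq> K1 \<union> K2"
    using compl xy(4) unfolding K1_def[symmetric] by (meson UnCI mem_sphere_0 subset_iff)
  have inter: "K1 \<inter> K2 \<subseteq> {cis x, cis y}"
  proof
    fix u assume "u \<in> K1 \<inter> K2"
    then have "u \<in> cis ` {x..y}" "u \<in> cis ` {y..x + 2 * pi}" unfolding K1_def K2_def by blast+
    then obtain s t where st': "u = cis s" "s \<in> {x..y}" "u = cis t" "t \<in> {y..x + 2 * pi}"
      by (elim imageE) (rule that)
    then have st: "x \<le> s" "s \<le> y" "y \<le> t" "t \<le> x + 2 * pi" by simp_all
    have "cis t = cis s" using st' by simp
    then obtain n :: int where n: "t = s + 2 * pi * n" unfolding cis_eq_iff by blast
    \<comment> \<open>As s \<le> y \<le> t and t - s \<le> 2 pi, the shift n is 0 or 1; these cases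
      force s = y and s = x respectively.\<close>
    have "2 * pi * 0 \<le> 2 * pi * real_of_int n" "2 * pi * real_of_int n \<le> 2 * pi * 1"
      using n st by linarith+
    then have "0 \<le> n" "n \<le> 1"
      using pi_gt_zero by (auto simp: zero_le_mult_iff)
    then have "n = 0 \<or> n = 1" by linarith
    then have "s = y \<or> s = x" using n st by auto
    then show "u \<in> {cis x, cis y}" using st'(1) by auto
  qed
  \<comment> \<open>Measurability: the arc is a closed arc with at most its endpoints
    removed.\<close>
  have "E = K1 - (K1 - E)" using xy by (auto simp: K1_def)
  moreover have "K1 - E \<subseteq> {cis x, cis y}"
  proof
    fix u assume u: "u \<in> K1 - E"
    then obtain t where t: "x \<le> t" "t \<le> y" "u = cis t"
      unfolding K1_def by auto
    then have "t \<notin> {x<..<y}" using xy(3) u t(3) by blast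
    with t show "u \<in> {cis x, cis y}" by force
  qed
  then have "closed (K1 - E)" by (intro finite_imp_closed) (rule finite_subset, auto)
  ultimately have "E \<in> sets borel" using closed by (metis borel_closed sets.Diff)
  then have Emeas: "(indicator E :: complex \<Rightarrow> real) \<in> borel_measurable (restrict_space borel (sphere 0 1))"
    by (intro measurable_restrict_space1) simp
  let ?p = "\<lambda>g. \<lambda>(k, s, u). if k = k0 \<and> s = s0 then g u else (0 :: real)"
  have "equidistributed (?p (indicator E))"
  proof (rule equidistributed_squeeze)
    have meas: "(\<lambda>u. if k = k0 \<and> s = s0 then indicator E u else (0 :: real)) \<in> borel_measurable (restrict_space borel (sphere 0 1))" for k s
      using Emeas by (cases "k = k0 \<and> s = s0") simp_all
    have bound: "\<forall>x\<in>tile_space m. norm (?p (indicator E) x) \<le> 1"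
      by (auto simp: indicator_def)
    show "bounded_borel m (?p (indicator E))"
      unfolding bounded_borel_def prod.case
      by (intro conjI ballI allI meas exI[of _ 1] bspec[OF bound])
  next
    fix \<epsilon> :: real assume "\<epsilon> > 0"
    let ?D = "\<lambda>N u. bump K1 N u + bump K2 N u - 1"
    have cb: "continuous_on (sphere 0 1) (bump K N)" for K N by (rule continuous_on_bump)
    have meanD: "mean (?p (?D N)) = \<rho> k0 * (1 / (4 * pi) * (LINT \<phi>:{0..<2 * pi}|lborel. ?D N (cis \<phi>)))" for N
      by (intro mean_piece k0 continuous_intros cb)
    have "(\<lambda>N. mean (?p (?D N))) \<longlonglongrightarrow> \<rho> k0 * (1 / (4 * pi) * 0)"
      unfolding meanD
      by (intro tendsto_intros bump_integral_tendsto_0 closed ne cover finite_subset[OF inter]) simp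
    then have "\<forall>\<^sub>F N in sequentially. mean (?p (?D N)) < \<epsilon>"
      using \<open>\<epsilon> > 0\<close> by (intro order_tendstoD(2)) simp_all
    then obtain N where N: "mean (?p (?D N)) < \<epsilon>"
      by (auto simp: eventually_sequentially)
    let ?h = "?p (bump K1 N)" and ?g = "?p (\<lambda>u. 1 - bump K2 N u)"
    have g: "equidistributed ?g" and h: "equidistributed ?h"
      by (intro equidistributed_real_piece continuous_intros cb)+
    have "mean (?p (?D N)) = mean (\<lambda>x. ?h x + - ?g x)"
      by (intro mean_cong) auto
    also have "\<dots> = mean ?h + mean (\<lambda>x. - ?g x)"
      using g h bounded_borel_compose[OF bounded_linear_minus[OF bounded_linear_ident], of m ?g]
      by (intro mean_add) (auto simp: equidistributed_def)
    also have "mean (\<lambda>x. - ?g x) = - mean ?g"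
      using g mean_compose[OF bounded_linear_minus[OF bounded_linear_ident], of ?g] by (simp add: equidistributed_def)
    finally have "mean ?h - mean ?g < \<epsilon>" using N by simp
    moreover have "\<forall>x\<in>tile_space m. ?g x \<le> ?p (indicator E) x \<and> ?p (indicator E) x \<le> ?h x"
    proof
      fix z assume "z \<in> tile_space m"
      moreover obtain k s u where z: "z = (k, s, u)" by (cases z) auto
      ultimately have u: "norm u = 1" by (auto simp: tile_space_def)
      have "1 - bump K2 N u \<le> indicator E u \<and> indicator E u \<le> bump K1 N u"
      proof (cases "u \<in> E")
        case True
        then have "u \<in> K1" using xy by (auto simp: K1_def)
        then show ?thesis using True bump_bounds[of K2 N u] by (simp add: bump_eq_1)
      next
        case False
        then show ?thesis using compl[OF u] bump_bounds[of K1 N u] by (simp add: bump_eq_1)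
      qed
      then show "?g z \<le> ?p (indicator E) z \<and> ?p (indicator E) z \<le> ?h z"
        by (simp add: z)
    qed
    ultimately show "\<exists>g h. equidistributed g \<and> equidistributed h \<and>
      (\<forall>x\<in>tile_space m. g x \<le> ?p (indicator E) x \<and> ?p (indicator E) x \<le> h x) \<and> mean h - mean g < \<epsilon>"
      using g h by blast
  qed
  then show ?thesis unfolding E_def .
qed

lemma equidistributed_interval:
  assumes "interval_of m I"
  shows "equidistributed (indicator I :: _ \<Rightarrow> complex)"
proof -
  obtain k0 s0 J where I: "k0 \<in> {1..m}" "is_interval J" "I = {k0} \<times> {s0} \<times> cis ` J"
    using assms by (auto simp: interval_of_def)
  show ?thesis
  proof (cases "J = {}")
    case True
    then have "(indicator I :: _ \<Rightarrow> complex) = (\<lambda>_. 0)" by (auto simp: I(3))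
    then show ?thesis by (auto intro!: equidistributed_continuous)
  next
    case False
    from equidistributed_compose[OF bounded_linear_of_real equidistributed_arc[OF I(2) False I(1)]]
    show ?thesis
    proof (rule equidistributed_cong[rotated])
      fix x :: "nat \<times> bool \<times> complex"
      show "complex_of_real (case x of (k, s, u) \<Rightarrow> if k = k0 \<and> s = s0 then indicator (cis ` J) u else 0)
          = indicator I x"
        by (cases x) (simp add: I(3) indicator_def)
    qed
  qed
qed

end

subsection \<open>Geometry of the subdivision\<close>

context pinwheel begin

definition chirality_sign :: "bool \<Rightarrow> real" where "chirality_sign s = (if s then 1 else - 1)"

text \<open>The tile with vertex \<open>A\<close> whose leg \<open>AC\<close> has direction \<open>u\<close> and whose hypotenuse is \<open>c * L\<close>.\<close>

definition tile_at :: "complex \<Rightarrow> real \<Rightarrow> bool \<Rightarrow> complex \<Rightarrow> tile" where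
  "tile_at A L s u = (A, A + of_real (L * b) * u, A + of_real L * u * Complex b (chirality_sign s * a))"

lemma norm_hypotenuse_vector: "norm (Complex b (chirality_sign s * a)) = c"
  using pythagoras pos by (simp add: cmod_def chirality_sign_def real_sqrt_unique add.commute)

lemma rot_eq: "of_real c * rot s = Complex b (chirality_sign s * a)"
  using pos by (simp add: rot_def unit_def chirality_sign_def complex_eq_iff)

lemma hypotenuse_tile_at: "norm u = 1 \<Longrightarrow> L > 0 \<Longrightarrow> hypotenuse (tile_at A L s u) = c * L"
  by (simp add: hypotenuse_def tile_at_def dist_norm norm_mult norm_hypotenuse_vector)

text \<open>The imaginary part of this product is twice the signed area, so it yields both the
  chirality and the area of the tile.\<close>

lemma cnj_leg_mult_hypotenuse:
  assumes "norm u = 1"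
  shows "cnj (of_real (L * b) * u) * (of_real L * u * Complex b (chirality_sign s * a))
    = of_real (L * L * b) * Complex b (chirality_sign s * a)"
proof -
  have "cnj (of_real (L * b) * u) * (of_real L * u * Complex b (chirality_sign s * a))
      = of_real (L * L * b) * (u * cnj u) * Complex b (chirality_sign s * a)"
    by (simp add: mult_ac)
  also have "u * cnj u = 1" using assms by (simp add: complex_norm_square[symmetric])
  finally show ?thesis by (simp only: mult_1_right)
qed

lemma orientation_tile_at:
  assumes "norm u = 1" "L > 0"
  shows "orientation (tile_at A L s u) = (s, u)"
proof -
  have "Im (cnj (of_real (L * b) * u) * (of_real L * u * Complex b (chirality_sign s * a)))
      = L * L * b * (chirality_sign s * a)" unfolding cnj_leg_mult_hypotenuse[OF assms(1)] by simp
  moreover have "sgn (of_real (L * b) * u) = u"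
    using assms pos by (simp add: sgn_mult sgn_of_real) (simp add: sgn_eq)
  moreover have "0 < L * L * b * (chirality_sign s * a) \<longleftrightarrow> s"
  proof -
    have "0 < L * L * b * a" using assms pos by simp
    then show ?thesis by (simp add: chirality_sign_def)
  qed
  ultimately show ?thesis
    by (simp only: orientation_def tile_at_def prod.case add_diff_cancel_left')
qed

text \<open>The right angle at C makes the quotient v of the two leg directions purely imaginary of
  modulus 1. Hence v is \<i> or its negative, and this sign is the chirality.\<close>

lemma tile_of_size_imp_tile_at:
  assumes "tile_of_size a b c r k t"
  obtains A s u where "t = tile_at A (r ^ k) s u" "norm u = 1"
proof -
  obtain A C B where t: "t = (A, C, B)" by (cases t) auto
  define L where "L = r ^ k"
  have L: "L > 0" using pos by (simp add: L_def)
  have h: "inner (A - C) (B - C) = 0" "norm (C - A) = b * L" "norm (B - C) = a * L"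
    using assms by (auto simp: t tile_of_size_def L_def dist_norm norm_minus_commute)
  define u where "u = (C - A) / of_real (L * b)"
  have u: "norm u = 1" using h(2) L pos by (simp add: u_def norm_divide norm_mult)
  have C: "C = A + of_real (L * b) * u" using L pos by (simp add: u_def)
  define v where "v = (B - C) / (of_real (L * a) * u)"
  have v: "norm v = 1" using h(3) L pos u by (simp add: v_def norm_divide norm_mult)
  have B: "B = C + of_real (L * a) * u * v" using L pos u by (auto simp: v_def)
  have "inner (A - C) (B - C) = - (L * b * (L * a) * Re (cnj u * u * v))"
    unfolding B C by (simp add: inner_complex_def algebra_simps)
  moreover have "cnj u * u = 1" using u by (simp add: complex_norm_square[symmetric] mult.commute)
  ultimately have "Re v = 0" using h(1) L pos by simp
  then have v': "v = Complex 0 (Im v)" "\<bar>Im v\<bar> = 1"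
    using v by (simp_all add: complex_eq_iff cmod_def)
  then have "v = \<i> * of_real (chirality_sign (Im v > 0))"
    by (auto simp: complex_eq_iff chirality_sign_def abs_if split: if_splits)
  then have "B = A + of_real L * u * Complex b (chirality_sign (Im v > 0) * a)"
    unfolding B C by (simp add: complex_eq_iff algebra_simps)
  then have "t = tile_at A (r ^ k) (Im v > 0) u"
    by (simp add: t tile_at_def C flip: L_def)
  then show ?thesis using u that by blast
qed

lemma expand_tile_at: "expand x (tile_at A L s u) = tile_at (x *\<^sub>R A) (x * L) s u"
  by (simp add: expand_def tile_at_def scaleR_conv_of_real algebra_simps)

lemma foot_tile:
  assumes "norm u = 1"
  shows "foot (A + of_real b * u) A (A + u * Complex b (chirality_sign s * a))
    = A + of_real (b\<^sup>2 / c\<^sup>2) * (u * Complex b (chirality_sign s * a))"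
proof -
  let ?w = "Complex b (chirality_sign s * a)"
  have "inner (of_real b * u) (u * ?w) = b * Re (cnj u * u * ?w)"
    by (simp add: inner_complex_def algebra_simps)
  also have "cnj u * u = 1" using assms by (simp add: complex_norm_square[symmetric] mult.commute)
  finally have "inner (of_real b * u) (u * ?w) = b\<^sup>2" by (simp add: power2_eq_square)
  moreover have "inner (u * ?w) (u * ?w) = c\<^sup>2"
    using assms by (simp add: dot_square_norm norm_mult norm_hypotenuse_vector)
  ultimately show ?thesis
    by (simp add: foot_def scaleR_conv_of_real)
qed

text \<open>In the coordinates \<open>A = 0\<close>, \<open>AC = b\<close>, \<open>AB = w\<close> with \<open>w * cnj w = c\<^sup>2\<close>, all vertices are polynomials
  in \<open>w\<close> and \<open>cnj w\<close>; reflection of a daughter amounts to conjugating \<open>w\<close>.\<close>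

lemma subdivide_tile_at:
  assumes "norm u = 1"
  shows "\<exists>A1 A2 A3 A4 A5. subdivide (tile_at A 1 s u) =
    {#tile_at A1 (r ^ q) (\<not> s) (rot s * u), tile_at A2 (r ^ q) (\<not> s) (rot s * u),
      tile_at A3 (r ^ q) s (rot s * u), tile_at A4 (r ^ q) s (- (rot s * u)),
      tile_at A5 (r ^ p) (\<not> s) (quarter s * rot s * u)#}"
proof -
  define w where "w = Complex b (chirality_sign s * a)"
  have cw: "cnj w = Complex b (chirality_sign (\<not> s) * a)"
    by (simp add: w_def chirality_sign_def complex_eq_iff)
  have ww: "w * cnj w = (of_real c)\<^sup>2"
    using norm_hypotenuse_vector[of s] complex_norm_square[of w] by (simp add: w_def)
  have b2: "w + cnj w = 2 * of_real b" and a2: "w - cnj w = 2 * quarter s * of_real a"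
    by (simp_all add: w_def complex_eq_iff quarter_def chirality_sign_def)
  have c0: "of_real c \<noteq> (0 :: complex)" using pos by simp
  have rot: "rot s = w / of_real c"
    using rot_eq[of s] c0 by (simp add: w_def field_simps)
  define C where "C = A + of_real b * u"
  define B where "B = A + u * w"
  define F where "F = A + of_real (b\<^sup>2 / c\<^sup>2) * (u * w)"
  have t: "tile_at A 1 s u = (A, C, B)"
    by (simp add: tile_at_def C_def B_def w_def)
  have F: "foot C A B = F"
    unfolding C_def B_def F_def w_def by (rule foot_tile[OF assms])
  let ?M = "midpoint A C" and ?N = "midpoint A F" and ?K = "midpoint F C"
  define \<gamma> :: complex where "\<gamma> = of_real c"
  \<comment> \<open>The vector from A to the foot F.\<close>
  define X where "X = of_real (b\<^sup>2 / c\<^sup>2) * (u * w)"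
  note c0 = c0[folded \<gamma>_def] and ww = ww[folded \<gamma>_def] and rot = rot[folded \<gamma>_def]
  have rq': "of_real (r ^ q) = of_real b / (2 * \<gamma>)" and rp': "of_real (r ^ p) = of_real a / \<gamma>"
    by (simp_all only: rq rp \<gamma>_def of_real_divide of_real_mult of_real_numeral)
  have X: "X = (of_real b)\<^sup>2 * w * u / \<gamma>\<^sup>2"
    by (simp add: X_def \<gamma>_def)
  \<comment> \<open>The quadratic equation of w over the reals, from the sum and product of w and
    \<open>cnj w\<close>; it removes squares of w below.\<close>
  have w2: "w * w = 2 * of_real b * w - \<gamma>\<^sup>2"
    using b2 ww by algebra
  \<comment> \<open>The identities \<open>h1\<close> to \<open>h5\<close> give the vectors AN, AM,
    MF, CF and CB, which up to sign are the legs and hypotenuses of all daughters.\<close>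
  have h1: "of_real (r ^ q * b) * (rot s * u) = X / 2"
    unfolding of_real_mult rq' rot X using c0 by (simp add: field_simps power2_eq_square)
  have h2: "of_real (r ^ q) * (rot s * u) * cnj w = of_real b * u / 2"
  proof -
    have "of_real (r ^ q) * (rot s * u) * cnj w = of_real b * u * (w * cnj w) / (2 * \<gamma>\<^sup>2)"
      unfolding rq' rot using c0 by (simp add: field_simps power2_eq_square)
    then show ?thesis unfolding ww using c0 by simp
  qed
  have h3: "of_real (r ^ q) * (rot s * u) * w = X - of_real b * u / 2"
  proof -
    have "of_real (r ^ q) * (rot s * u) * w = of_real b * u * (w * w) / (2 * \<gamma>\<^sup>2)"
      unfolding rq' rot using c0 by (simp add: field_simps power2_eq_square)
    then show ?thesis unfolding w2 X using c0 by (simp add: field_simps power2_eq_square)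
  qed
  have "2 * (quarter s * of_real a) = 2 * (w - of_real b)"
    using a2 b2 by algebra
  then have qa: "quarter s * of_real a = w - of_real b"
    by (simp only: mult_cancel_left) simp
  have h4: "of_real (r ^ p * b) * (quarter s * rot s * u) = X - of_real b * u"
  proof -
    have "of_real (r ^ p * b) * (quarter s * rot s * u) = of_real b * (quarter s * of_real a) * w * u / \<gamma>\<^sup>2"
      unfolding of_real_mult rp' rot
      by (simp only: times_divide_eq_left times_divide_eq_right divide_divide_eq_left power2_eq_square mult_ac)
    also have "\<dots> = of_real b * (w * w - of_real b * w) * u / \<gamma>\<^sup>2"
      unfolding qa by (simp add: algebra_simps)
    finally show ?thesis unfolding w2 X using c0 by (simp add: field_simps power2_eq_square)
  qed
  have h5: "of_real (r ^ p) * (quarter s * rot s * u) * cnj w = u * w - of_real b * u"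
  proof -
    have "of_real (r ^ p) * (quarter s * rot s * u) * cnj w = quarter s * of_real a * (w * cnj w) * u / \<gamma>\<^sup>2"
      unfolding rp' rot
      by (simp only: times_divide_eq_left times_divide_eq_right divide_divide_eq_left power2_eq_square mult_ac)
    also have "\<dots> = (w - of_real b) * u"
      unfolding ww qa using c0 by simp
    finally show ?thesis by (simp add: algebra_simps)
  qed
  have FX: "F = A + X" by (simp add: F_def X_def)
  note defs = tile_at_def cw[symmetric] w_def[symmetric] h1 h2 h3 h4 h5 mult_minus_right mult_minus_left
    FX C_def B_def midpoint_def scaleR_conv_of_real
  have 1: "(A, ?N, ?M) = tile_at A (r ^ q) (\<not> s) (rot s * u)"
    unfolding defs by (simp add: field_simps)
  have 2: "(?M, ?K, C) = tile_at ?M (r ^ q) (\<not> s) (rot s * u)"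
    unfolding defs by (simp add: field_simps)
  have 3: "(?M, ?K, F) = tile_at ?M (r ^ q) s (rot s * u)"
    unfolding defs by (simp add: field_simps)
  have 4: "(F, ?N, ?M) = tile_at F (r ^ q) s (- (rot s * u))"
    unfolding defs by (simp add: field_simps)
  have 5: "(C, F, B) = tile_at C (r ^ p) (\<not> s) (quarter s * rot s * u)"
    unfolding defs by (simp add: field_simps)
  show ?thesis
    unfolding t subdivide_def Let_def prod.case F 1 2 3 4 5 by blast
qed

section \<open>Sizes and classes of tiles under iteration\<close>

lemma r_less_1: "r < 1"
proof (rule ccontr)
  assume "\<not> r < 1"
  then have "1 \<le> a / c" using one_le_power[of r p] rp by simp
  then have "c \<le> a" using pos by (simp add: field_simps)
  then have "c\<^sup>2 \<le> a\<^sup>2" using pos by (intro power_mono) auto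
  then show False using pythagoras zero_less_power[of b 2] pos by linarith
qed

lemma size_eq_iff: "r ^ k = r ^ l \<longleftrightarrow> k = l"
  using r_less_1 pos by (simp add: power_inject_exp')

lemma tile_class_tile_at:
  assumes "norm u = 1"
  shows "tile_class c r (tile_at A (r ^ k) s u) = (k, s, u)"
  using assms pos
  by (simp add: tile_class_def orientation_tile_at hypotenuse_tile_at size_eq_iff)

text \<open>\<open>tile_class\<close> assigns a value to every triple of points; this predicate also
  certifies the shape and an admissible size, and is the invariant of the iteration.\<close>

definition has_class :: "nat \<times> bool \<times> complex \<Rightarrow> tile \<Rightarrow> bool" where
  "has_class x t \<longleftrightarrow> x \<in> tile_space m \<and> (\<exists>A. t = tile_at A (r ^ fst x) (fst (snd x)) (snd (snd x)))"

lemma tile_class_if_has_class: "has_class x t \<Longrightarrow> tile_class c r t = x"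
  by (cases x) (auto simp: has_class_def in_tile_space tile_class_tile_at)

text \<open>The counting version of \<open>averaging\<close>, in which each daughter has weight 1:
  the substitution seen through its action on functions.\<close>

definition transfer :: "(nat \<times> bool \<times> complex \<Rightarrow> 'v::real_vector) \<Rightarrow> nat \<times> bool \<times> complex \<Rightarrow> 'v" where
  "transfer f = (\<lambda>(k, s, u).
     if k = 1 then f (p, \<not> s, quarter s * rot s * u)
       + 2 *\<^sub>R f (q, \<not> s, rot s * u) + f (q, s, rot s * u) + f (q, s, - (rot s * u))
     else f (k - 1, s, u))"

lemma transfer_Suc_0:
  "transfer f (Suc 0, s, u) = f (p, \<not> s, quarter s * rot s * u)
       + 2 *\<^sub>R f (q, \<not> s, rot s * u) + f (q, s, rot s * u) + f (q, s, - (rot s * u))"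
  and transfer_gt_1: "k \<noteq> Suc 0 \<Longrightarrow> transfer f (k, s, u) = f (k - 1, s, u)"
  by (simp_all add: transfer_def)

lemma tile_at_has_class:
  "1 \<le> k \<Longrightarrow> k \<le> m \<Longrightarrow> norm u = 1 \<Longrightarrow> \<exists>x. has_class x (tile_at A (r ^ k) s u)"
  by (rule exI[of _ "(k, s, u)"]) (auto simp: has_class_def in_tile_space)

lemma substitution_add: "substitution c r (S + T) = substitution c r S + substitution c r T"
  by (simp add: substitution_def)

lemma substitution_step:
  assumes "\<forall>t\<in>#S. \<exists>x. has_class x t"
  shows "(\<forall>t\<in>#substitution c r S. \<exists>x. has_class x t) \<and>
    (\<Sum>t\<in>#substitution c r S. f (tile_class c r t)) = (\<Sum>t\<in>#S. transfer f (tile_class c r t))"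
  using assms
proof (induction S)
  case empty
  then show ?case by (simp add: substitution_def)
next
  case (add t S)
  obtain k s u A where x: "has_class (k, s, u) t" and t: "t = tile_at A (r ^ k) s u"
    and k: "1 \<le> k" "k \<le> m" "norm u = 1"
    using add.prems by (fastforce simp: has_class_def in_tile_space)
  have single: "(\<forall>t\<in>#substitution c r {#t#}. \<exists>x. has_class x t) \<and>
    (\<Sum>t\<in>#substitution c r {#t#}. f (tile_class c r t)) = transfer f (k, s, u)"
  proof (cases "k = 1")
    case True
    have "hypotenuse t = c * r" using True t k pos by (simp add: hypotenuse_tile_at)
    then have "substitution c r {#t#} = subdivide (tile_at (inverse r *\<^sub>R A) 1 s u)"
      using True t pos by (simp add: substitution_def expand_tile_at)
    moreover obtain A1 A2 A3 A4 A5 where "subdivide (tile_at (inverse r *\<^sub>R A) 1 s u) =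
    {#tile_at A1 (r ^ q) (\<not> s) (rot s * u), tile_at A2 (r ^ q) (\<not> s) (rot s * u),
      tile_at A3 (r ^ q) s (rot s * u), tile_at A4 (r ^ q) s (- (rot s * u)),
      tile_at A5 (r ^ p) (\<not> s) (quarter s * rot s * u)#}"
      using subdivide_tile_at k by blast
    ultimately show ?thesis
      using True k
      by (simp add: tile_class_tile_at norm_mult transfer_Suc_0 scaleR_2 tile_at_has_class
          p q p_le q_le Suc_le_eq del: split_paired_Ex)
  next
    case False
    obtain l where l: "k = Suc l" using k by (cases k) auto
    have "hypotenuse t \<noteq> c * r"
      using False t k pos size_eq_iff[of k 1] by (simp add: hypotenuse_tile_at)
    then have "substitution c r {#t#} = {#tile_at (inverse r *\<^sub>R A) (r ^ l) s u#}"
      using t pos l by (simp add: substitution_def expand_tile_at flip: mult.assoc)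
    then show ?thesis
      using k l False by (simp add: tile_class_tile_at transfer_gt_1 tile_at_has_class Suc_le_eq del: split_paired_Ex)
  qed
  have "substitution c r (add_mset t S) = substitution c r {#t#} + substitution c r S"
    using substitution_add[of "{#t#}" S] by simp
  then show ?case
    using add single tile_class_if_has_class[OF x] by (auto simp del: split_paired_Ex)
qed

lemma substitution_power:
  assumes "\<forall>t\<in>#S. \<exists>x. has_class x t"
  shows "(\<forall>t\<in>#(substitution c r ^^ j) S. \<exists>x. has_class x t) \<and>
    (\<Sum>t\<in>#(substitution c r ^^ j) S. f (tile_class c r t)) = (\<Sum>t\<in>#S. (transfer ^^ j) f (tile_class c r t))"
\<comment> \<open>The last substitution is absorbed into the function, so the induction hypothesis
  is used for \<open>transfer f\<close>.\<close>
proof (induction j arbitrary: f)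
  case (Suc j)
  then show ?case
    using substitution_step[of "(substitution c r ^^ j) S" f] Suc[of "transfer f"]
    by (simp add: funpow_swap1)
qed (use assms in simp)

text \<open>Weighting a tile of size \<open>D\<^sub>k\<close> by \<open>r\<^sup>2\<^sup>k\<close>, a constant multiple of its area, turns the substitution into an average.\<close>

lemma transfer_weighted:
  fixes f :: "nat \<times> bool \<times> complex \<Rightarrow> 'v::real_vector"
  assumes "x \<in> tile_space m"
  shows "(transfer ^^ j) (\<lambda>x. (r\<^sup>2) ^ fst x *\<^sub>R f x) x = ((r\<^sup>2) ^ fst x / (r\<^sup>2) ^ j) *\<^sub>R (averaging ^^ j) f x"
  using assms
proof (induction j arbitrary: x)
  case (Suc j)
  obtain k s u where x: "x = (k, s, u)" by (cases x) auto
  then have k: "1 \<le> k" "k \<le> m" and u: "norm u = 1" using Suc.prems by (auto simp: in_tile_space)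
  have r0: "r \<noteq> 0" using pos by simp
  let ?g = "(averaging ^^ j) f"
  show ?case
  proof (cases "k = 1")
    case True
    \<comment> \<open>The squared linear factors are the area fractions: one daughter of fraction
      \<alpha>, four of fraction \<beta> / 4.\<close>
    have "(r\<^sup>2) ^ p = \<alpha>"
      by (metis \<alpha>_def power_divide power_mult mult.commute rp)
    moreover have "\<beta> = 4 * (r\<^sup>2) ^ q"
      using rq by (simp add: \<beta>_def power_divide power_mult_distrib flip: power_mult) (simp add: mult.commute power_mult power_divide power_mult_distrib)
    moreover have "r\<^sup>2 / (r\<^sup>2) ^ Suc j = 1 / (r\<^sup>2) ^ j"
      using r0 by simp
    ultimately show ?thesis
      using u by (simp add: x True transfer_Suc_0 averaging_Suc_0 Suc.IH tile_space_daughters scaleR_right_distrib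
          del: power_Suc)
  next
    case False
    then obtain l where l: "k = Suc l" "l \<noteq> 0" using k by (cases k) auto
    then have "(l, s, u) \<in> tile_space m" using k u by (auto simp: in_tile_space)
    then show ?thesis
      using l r0 by (simp add: x transfer_gt_1 averaging_gt_1 Suc.IH)
  qed
qed simp

end

subsection \<open>Areas of tiles\<close>

text \<open>Carries the area formula \<open>content_triangle\<close> from \<open>real ^ 2\<close> to
  the complex plane.\<close>

definition complex_of_vec :: "real ^ 2 \<Rightarrow> complex" where
  "complex_of_vec v = Complex (v $ 1) (v $ 2)"

lemma linear_complex_of_vec: "linear complex_of_vec"
  by (auto simp: linear_iff complex_of_vec_def complex_eq_iff)

lemma complex_of_vec_measurable: "complex_of_vec \<in> borel_measurable borel"
  by (intro borel_measurable_continuous_onI linear_continuous_on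
      linear_conv_bounded_linear[THEN iffD1, OF linear_complex_of_vec])

text \<open>Lebesgue measure is determined by its values on boxes, and the coordinate map matches
  boxes with boxes of equal side lengths.\<close>

lemma lborel_complex_eq: "(lborel :: complex measure) = distr lborel borel complex_of_vec"
proof (rule lborel_eqI)
  have meas: "complex_of_vec \<in> borel_measurable lborel"
    using complex_of_vec_measurable by simp
  fix l u :: complex
  assume "\<And>b. b \<in> Basis \<Longrightarrow> l \<bullet> b \<le> u \<bullet> b"
  from this[of 1] this[of \<i>] have lu: "Re l \<le> Re u" "Im l \<le> Im u"
    by (simp_all add: Basis_complex_def inner_complex_def)
  define v where "v z = (\<chi> i. if i = 1 then Re z else Im z :: real ^ 2)" for z
  have "complex_of_vec -` box l u = box (v l) (v u)"
    by (auto simp: complex_of_vec_def v_def in_box_complex_iff mem_box_cart forall_2)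
  then have "emeasure (distr lborel borel complex_of_vec) (box l u) = emeasure lborel (box (v l) (v u))"
    using meas by (subst emeasure_distr) auto
  also have "\<dots> = ennreal (\<Prod>b\<in>Basis. (v u - v l) \<bullet> b)"
    using lu by (intro emeasure_lborel_box) (auto simp: Basis_vec_def inner_axis v_def)
  also have "(\<Prod>b\<in>Basis. (v u - v l) \<bullet> b) = (\<Prod>i\<in>UNIV. (v u - v l) $ i)"
    by (rule prod.reindex_cong[of "\<lambda>i. axis i 1"])
       (auto simp: inj_on_def axis_eq_axis Basis_vec_def inner_axis)
  also have "\<dots> = (\<Prod>b\<in>Basis. (u - l) \<bullet> b)"
    by (simp add: v_def Basis_complex_def inner_complex_def UNIV_2)
  finally show "emeasure (distr lborel borel complex_of_vec) (box l u) = ennreal (\<Prod>b\<in>Basis. (u - l) \<bullet> b)" .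
qed simp

lemma measure_triangle_complex:
  "measure lebesgue (convex hull {A, C, B :: complex}) = \<bar>Im (cnj (C - A) * (B - A))\<bar> / 2"
proof -
  define v where "v z = (vector [Re z, Im z] :: real ^ 2)" for z
  have v: "complex_of_vec (v z) = z" for z by (simp add: complex_of_vec_def v_def)
  have inj: "inj complex_of_vec"
    by (auto simp: inj_def complex_of_vec_def vec_eq_iff forall_2)
  have meas: "complex_of_vec \<in> borel_measurable lborel"
    using complex_of_vec_measurable by simp
  have "closed (convex hull {A, C, B})"
    by (intro compact_imp_closed finite_imp_compact_convex_hull) simp
  then have borel: "convex hull {A, C, B} \<in> sets borel" by (rule borel_closed)
  have "convex hull {A, C, B} = convex hull (complex_of_vec ` {v A, v C, v B})" by (simp add: v)
  also have "\<dots> = complex_of_vec ` (convex hull {v A, v C, v B})"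
    by (rule convex_hull_linear_image[OF linear_complex_of_vec, symmetric])
  finally have pre: "complex_of_vec -` (convex hull {A, C, B}) = convex hull {v A, v C, v B}"
    using inj by (simp add: inj_vimage_image_eq)
  have "measure lebesgue (convex hull {A, C, B}) = measure lborel (convex hull {A, C, B})"
    using borel by (simp add: measure_completion)
  also have "\<dots> = measure lborel (convex hull {v A, v C, v B})"
    unfolding lborel_complex_eq by (subst measure_distr) (use meas borel in \<open>auto simp: pre\<close>)
  also have "\<dots> = \<bar>Im (cnj (C - A) * (B - A))\<bar> / 2"
    by (subst content_triangle) (simp add: v_def algebra_simps abs_minus_commute)
  finally show ?thesis .
qed

context pinwheel begin

lemma tile_area_tile_at:
  assumes "norm u = 1"
  shows "tile_area (tile_at A L s u) = L\<^sup>2 * (a * b / 2)"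
proof -
  have "tile_area (tile_at A L s u) = \<bar>Im (cnj (of_real (L * b) * u) * (of_real L * u * Complex b (chirality_sign s * a)))\<bar> / 2"
    by (simp only: tile_area_def tile_at_def prod.case measure_triangle_complex add_diff_cancel_left')
  also have "\<dots> = L\<^sup>2 * (a * b / 2)"
    unfolding cnj_leg_mult_hypotenuse[OF assms] using pos by (cases s) (simp_all add: chirality_sign_def abs_mult power2_eq_square)
  finally show ?thesis .
qed

end

subsection \<open>The limits\<close>

context pinwheel begin

definition \<nu> :: "nat \<Rightarrow> real" where "\<nu> = nu p q a b c r"

definition inverse_area :: "nat \<times> bool \<times> complex \<Rightarrow> real" where
  "inverse_area x = inverse ((r\<^sup>2) ^ fst x)"

lemma r2: "0 < r\<^sup>2" "r\<^sup>2 < 1"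
  using pos r_less_1 by (auto simp: power_less_one_iff)

lemma continuous_on_inverse_area: "continuous_on (tile_space m) inverse_area"
  unfolding inverse_area_def
  by (rule continuous_on_compose2[of UNIV "\<lambda>k. inverse ((r\<^sup>2) ^ k)" _ fst]) (auto intro!: continuous_intros)

lemma sum_inverse_area: "(1 - r\<^sup>2) * (\<Sum>k=1..n. inverse ((r\<^sup>2) ^ k)) = inverse ((r\<^sup>2) ^ n) - 1"
proof (induction n)
  case (Suc n)
  have "r\<^sup>2 * inverse ((r\<^sup>2) ^ Suc n) = inverse ((r\<^sup>2) ^ n)"
    using pos by simp
  then show ?case using Suc by (simp add: algebra_simps)
qed simp

text \<open>Summing the geometric series leaves a^2 (r^(-2 p) - 1) + b^2 (r^(-2 q) - 1) = c^2 + 4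
  c^2 - c^2, the origin of the constant 4 c^2 in \<nu>.\<close>

lemma sum_\<rho>_inverse_area:
  "(\<Sum>k=1..m. \<rho> k * inverse ((r\<^sup>2) ^ k)) = 4 * c\<^sup>2 / ((1 - r\<^sup>2) * (p * a\<^sup>2 + q * b\<^sup>2))"
proof -
  define Z where "Z = p * a\<^sup>2 + q * b\<^sup>2"
  have Z: "Z > 0" using p q pos by (simp add: Z_def add_pos_pos)
  let ?y = "\<lambda>k. inverse ((r\<^sup>2) ^ k)"
  have part: "(\<Sum>k=1..m. H (int n - int k) * ?y k) = (\<Sum>k=1..n. ?y k)" if "n \<le> m" for n
    using that by (intro sum.mono_neutral_cong_right) (auto simp: H_def)
  have yp: "a\<^sup>2 * ?y p = c\<^sup>2"
  proof -
    have "(r\<^sup>2) ^ p = (a / c)\<^sup>2" by (metis power_mult mult.commute rp)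
    then show ?thesis using pos by (simp add: power_divide)
  qed
  have yq: "b\<^sup>2 * ?y q = 4 * c\<^sup>2"
  proof -
    have "(r\<^sup>2) ^ q = (b / (2 * c))\<^sup>2" by (metis power_mult mult.commute rq)
    then show ?thesis using pos by (simp add: power_divide power_mult_distrib)
  qed
  have "(\<Sum>k=1..m. \<rho> k * ?y k) = (\<Sum>k=1..m. (a\<^sup>2 * (H (int p - int k) * ?y k) + b\<^sup>2 * (H (int q - int k) * ?y k)) / Z)"
    by (intro sum.cong refl) (simp add: \<rho>_def rho_def Z_def algebra_simps add_divide_distrib)
  also have "\<dots> = (a\<^sup>2 * (\<Sum>k=1..p. ?y k) + b\<^sup>2 * (\<Sum>k=1..q. ?y k)) / Z"
    unfolding sum_divide_distrib[symmetric] sum.distrib sum_distrib_left[symmetric]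
    by (simp only: part p_le q_le)
  finally have "(1 - r\<^sup>2) * (\<Sum>k=1..m. \<rho> k * ?y k) = (a\<^sup>2 * ((1 - r\<^sup>2) * (\<Sum>k=1..p. ?y k)) + b\<^sup>2 * ((1 - r\<^sup>2) * (\<Sum>k=1..q. ?y k))) / Z"
    by (simp add: algebra_simps)
  also have "\<dots> = (a\<^sup>2 * (?y p - 1) + b\<^sup>2 * (?y q - 1)) / Z"
    unfolding sum_inverse_area ..
  also have "a\<^sup>2 * (?y p - 1) + b\<^sup>2 * (?y q - 1) = 4 * c\<^sup>2"
    using yp yq pythagoras by (simp add: right_diff_distrib)
  finally have "(1 - r\<^sup>2) * (\<Sum>k=1..m. \<rho> k * ?y k) = 4 * c\<^sup>2 / Z" .
  then have "(\<Sum>k=1..m. \<rho> k * ?y k) * (1 - r\<^sup>2) = 4 * c\<^sup>2 / Z"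
    by (simp only: mult.commute[of _ "1 - r\<^sup>2"])
  then have "(\<Sum>k=1..m. \<rho> k * ?y k) = 4 * c\<^sup>2 / Z / (1 - r\<^sup>2)"
    by (rule eq_divide_imp[rotated]) (use r2(2) in simp)
  then show ?thesis by (simp add: Z_def mult.commute)
qed

text \<open>Counting tiles in place of weighing them divides each area weight by r^(2 k); the
  denominator restores total mass 1.\<close>

lemma \<nu>_eq: "\<nu> k = \<rho> k * inverse ((r\<^sup>2) ^ k) / (\<Sum>k=1..m. \<rho> k * inverse ((r\<^sup>2) ^ k))"
proof -
  define Z where "Z = p * a\<^sup>2 + q * b\<^sup>2"
  have Z: "Z > 0" using p q pos by (simp add: Z_def add_pos_pos)
  have "r powi (- 2 * int k) = inverse ((r\<^sup>2) ^ k)"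
  proof -
    have "- 2 * int k = - int (2 * k)" by simp
    then show ?thesis by (simp only: power_int_minus power_int_of_nat power_mult)
  qed
  then have "\<nu> k = (1 - r\<^sup>2) / (4 * c\<^sup>2) * (a\<^sup>2 * H (int p - int k) + b\<^sup>2 * H (int q - int k)) * inverse ((r\<^sup>2) ^ k)"
    by (simp only: \<nu>_def nu_def)
  also have "\<dots> = (a\<^sup>2 * H (int p - int k) + b\<^sup>2 * H (int q - int k)) / Z * inverse ((r\<^sup>2) ^ k) / (4 * c\<^sup>2 / ((1 - r\<^sup>2) * Z))"
    using Z r2 pos by (simp add: divide_simps)
  finally show ?thesis
    unfolding sum_\<rho>_inverse_area by (simp only: \<rho>_def rho_def Z_def)
qed

lemma sum_\<rho>_inverse_area_pos: "0 < (\<Sum>k=1..m. \<rho> k * inverse ((r\<^sup>2) ^ k))"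
  unfolding sum_\<rho>_inverse_area using r2 p q pos by (intro divide_pos_pos mult_pos_pos add_pos_pos) auto

lemma \<nu>_nonneg: "0 \<le> \<nu> k"
  unfolding \<nu>_eq using \<rho>_nonneg sum_\<rho>_inverse_area_pos r2
  by (intro divide_nonneg_pos mult_nonneg_nonneg) auto

lemma mean_inverse_area: "mean inverse_area = (\<Sum>k=1..m. \<rho> k * inverse ((r\<^sup>2) ^ k))"
proof -
  have b: "bounded_borel m inverse_area"
    by (rule bounded_borel_continuous[OF continuous_on_inverse_area])
  have "(\<Sum>s\<in>(UNIV::bool set). (1 / (4 * pi)) *\<^sub>R (LINT \<phi>:{0..<2 * pi}|lborel. inverse_area (k, s, cis \<phi>)))
      = inverse ((r\<^sup>2) ^ k)" for k
    by (simp add: inverse_area_def set_lebesgue_integral_def UNIV_bool)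
  then show ?thesis unfolding mean_eq[OF b] by simp
qed

lemma integral_\<nu>:
  fixes f :: "nat \<times> bool \<times> complex \<Rightarrow> complex"
  assumes f: "bounded_borel m f" and f': "bounded_borel m (\<lambda>x. inverse_area x *\<^sub>R f x)"
  shows "integral\<^sup>L (weighted_measure m \<nu>) f = mean (\<lambda>x. inverse_area x *\<^sub>R f x) / of_real (mean inverse_area)"
proof -
  have "(LINT \<phi>:{0..<2 * pi}|lborel. inverse_area (k, s, cis \<phi>) *\<^sub>R f (k, s, cis \<phi>))
      = inverse ((r\<^sup>2) ^ k) *\<^sub>R (LINT \<phi>:{0..<2 * pi}|lborel. f (k, s, cis \<phi>))" for k s
    by (simp add: inverse_area_def)
  moreover have "(x *\<^sub>R (d *\<^sub>R (y *\<^sub>R U) + d *\<^sub>R (y *\<^sub>R V))) / of_real D = (x * y / D) *\<^sub>R (d *\<^sub>R U + d *\<^sub>R V)"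
    for x y d D :: real and U V :: complex
    by (simp add: scaleR_conv_of_real add_divide_distrib algebra_simps)
  ultimately have "mean (\<lambda>x. inverse_area x *\<^sub>R f x) / of_real (mean inverse_area)
     = (\<Sum>k=1..m. \<nu> k *\<^sub>R (\<Sum>s\<in>UNIV. (1 / (4 * pi)) *\<^sub>R (LINT \<phi>:{0..<2 * pi}|lborel. f (k, s, cis \<phi>))))"
    unfolding mean_eq[OF f'] sum_divide_distrib mean_inverse_area \<nu>_eq
    by (intro sum.cong refl) (simp only: UNIV_bool sum.insert sum.empty finite.intros add_0_right
        empty_iff insert_iff simp_thms)
  then show ?thesis
    using integral_weighted_measure[OF f, of \<nu>] \<nu>_nonneg by simp
qed

lemma averaging_power_tendsto:
  assumes "equidistributed f" "filterlim j at_top sequentially" "\<And>n. x n \<in> tile_space m"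
  shows "(\<lambda>n. (averaging ^^ j n) f (x n)) \<longlonglongrightarrow> mean f"
proof (rule tendstoI)
  fix \<epsilon> :: real assume "\<epsilon> > 0"
  then have "\<forall>\<^sub>F j in sequentially. \<forall>x\<in>tile_space m. dist ((averaging ^^ j) f x) (mean f) < \<epsilon>"
    using assms(1) unfolding equidistributed_def converges_to_def uniform_limit_iff by blast
  from eventually_compose_filterlim[OF this assms(2)]
  show "\<forall>\<^sub>F n in sequentially. dist ((averaging ^^ j n) f (x n)) (mean f) < \<epsilon>"
    by eventually_elim (use assms(3) in blast)
qed

lemma supertile_sum:
  fixes f :: "nat \<times> bool \<times> complex \<Rightarrow> 'v::real_vector"
  assumes "has_class x t"
  shows "(\<Sum>t\<in>#(substitution c r ^^ j) {#t#}. (r\<^sup>2) ^ fst (tile_class c r t) *\<^sub>R f (tile_class c r t))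
    = ((r\<^sup>2) ^ fst x / (r\<^sup>2) ^ j) *\<^sub>R (averaging ^^ j) f x"
proof -
  have "\<forall>t\<in>#{#t#}. \<exists>x. has_class x t" using assms by (metis set_mset_single singletonD)
  note substitution_power[OF this, of j "\<lambda>x. (r\<^sup>2) ^ fst x *\<^sub>R f x", THEN conjunct2]
  then show ?thesis
    using transfer_weighted[of x j f] tile_class_if_has_class[OF assms] assms
    by (simp add: has_class_def)
qed

lemma tile_area_if_has_class: "has_class x t \<Longrightarrow> tile_area t = a * b / 2 * (r\<^sup>2) ^ fst x"
  by (cases x) (auto simp: has_class_def in_tile_space tile_area_tile_at power2_eq_square power_mult_distrib)

text \<open>Numerator and denominator carry the same factor \<open>K * w\<close>; the denominator is
  the case f = 1, as averaging preserves constants.\<close>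

lemma area_average_supertile:
  assumes "has_class x t"
  shows "tile_area_average c r f ((substitution c r ^^ j) {#t#}) = (averaging ^^ j) f x"
proof -
  let ?S = "(substitution c r ^^ j) {#t#}"
  define K where "K = a * b / 2"
  define w where "w = (r\<^sup>2) ^ fst x / (r\<^sup>2) ^ j"
  have K: "K \<noteq> 0" and w: "w \<noteq> 0" using pos by (auto simp: K_def w_def)
  have area: "tile_area t' = K * (r\<^sup>2) ^ fst (tile_class c r t')" if "t' \<in># ?S" for t'
  proof -
    have "\<forall>t\<in>#{#t#}. \<exists>x. has_class x t" using assms by (metis set_mset_single singletonD)
    from substitution_power[OF this, where j = j and f = "\<lambda>_. 0 :: real", THEN conjunct1]
    obtain y where "has_class y t'" using \<open>t' \<in># ?S\<close> by metis
    then show ?thesis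
      using tile_area_if_has_class tile_class_if_has_class by (simp add: K_def)
  qed
  have "(\<Sum>t\<in>#?S. of_real (tile_area t) * f (tile_class c r t))
      = (\<Sum>t\<in>#?S. of_real K * ((r\<^sup>2) ^ fst (tile_class c r t) *\<^sub>R f (tile_class c r t)))"
    by (intro arg_cong[where f = sum_mset] image_mset_cong) (simp add: area scaleR_conv_of_real)
  also have "\<dots> = of_real K * (w *\<^sub>R (averaging ^^ j) f x)"
    unfolding w_def supertile_sum[OF assms, symmetric] by (simp add: sum_mset_distrib_left)
  finally have num: "(\<Sum>t\<in>#?S. of_real (tile_area t) * f (tile_class c r t)) = of_real (K * w) * (averaging ^^ j) f x"
    by (simp add: scaleR_conv_of_real)
  have "(\<Sum>t\<in>#?S. tile_area t) = (\<Sum>t\<in>#?S. K * ((r\<^sup>2) ^ fst (tile_class c r t) *\<^sub>R (1 :: real)))"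
    by (intro arg_cong[where f = sum_mset] image_mset_cong) (simp add: area)
  also have "\<dots> = K * (w *\<^sub>R (averaging ^^ j) (\<lambda>_. 1) x)"
    unfolding w_def supertile_sum[OF assms, of "\<lambda>_. 1" j, symmetric] by (simp only: sum_mset_distrib_left)
  also have "\<dots> = K * w" by (simp add: averaging_power_const)
  finally show ?thesis
    unfolding tile_area_average_def weighted_average_def num using K w by simp
qed

text \<open>Writing f as r^(2 k) times r^(-2 k) f turns the count into an area-weighted sum; the
  same device turns the number of tiles into an average of \<open>inverse_area\<close>.\<close>

lemma average_supertile:
  assumes "has_class x t"
  shows "tile_average c r f ((substitution c r ^^ j) {#t#})
    = (averaging ^^ j) (\<lambda>x. inverse_area x *\<^sub>R f x) x / of_real ((averaging ^^ j) inverse_area x)"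
proof -
  let ?S = "(substitution c r ^^ j) {#t#}"
  define w where "w = (r\<^sup>2) ^ fst x / (r\<^sup>2) ^ j"
  have w: "w \<noteq> 0" using pos by (auto simp: w_def)
  have cancel: "(r\<^sup>2) ^ fst y * inverse_area y = 1" for y
    using pos by (simp add: inverse_area_def)
  have num: "(\<Sum>t\<in>#?S. f (tile_class c r t)) = w *\<^sub>R (averaging ^^ j) (\<lambda>x. inverse_area x *\<^sub>R f x) x"
    unfolding w_def supertile_sum[OF assms, symmetric] by (simp add: cancel)
  have "(\<Sum>t\<in>#?S. 1 :: real) = w *\<^sub>R (averaging ^^ j) inverse_area x"
    unfolding w_def supertile_sum[OF assms, symmetric] by (simp add: cancel)
  then show ?thesis
    using w num by (simp add: tile_average_def weighted_average_def scaleR_conv_of_real)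
qed

lemma supertile_averages_tendsto:
  fixes f :: "nat \<times> bool \<times> complex \<Rightarrow> complex"
  assumes S: "supertile_sequence a b c r m S"
    and f: "continuous_on (tile_space m) f \<or> (\<exists>I. interval_of m I \<and> f = indicator I)"
  shows "(\<lambda>n. tile_average c r f (S n)) \<longlonglongrightarrow> integral\<^sup>L (weighted_measure m \<nu>) f"
    and "(\<lambda>n. tile_area_average c r f (S n)) \<longlonglongrightarrow> integral\<^sup>L (weighted_measure m \<rho>) f"
proof -
  obtain j t where j: "filterlim j at_top sequentially"
    and t: "\<And>n. \<exists>k\<in>{1..m}. tile_of_size a b c r k (t n)" and Sn: "\<And>n. S n = (substitution c r ^^ j n) {#t n#}"
    using S by (auto simp: supertile_sequence_def)
  have "\<exists>x. has_class x (t n)" for n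
    using t[of n] tile_of_size_imp_tile_at tile_at_has_class by (metis atLeastAtMost_iff)
  then obtain x where x: "\<And>n. has_class (x n) (t n)" by metis
  then have xX: "\<And>n. x n \<in> tile_space m" by (simp add: has_class_def)
  have ef: "equidistributed f"
    using f equidistributed_continuous equidistributed_interval by blast
  have eg: "equidistributed (\<lambda>x. inverse_area x *\<^sub>R f x)"
    using f
  proof
    assume "continuous_on (tile_space m) f"
    then show ?thesis
      by (intro equidistributed_continuous continuous_intros continuous_on_inverse_area)
  next
    assume "\<exists>I. interval_of m I \<and> f = indicator I"
    then obtain I where I: "interval_of m I" "f = indicator I" by blast
    then obtain k0 where k0: "\<And>x. x \<in> I \<Longrightarrow> fst x = k0" by (auto simp: interval_of_def)
    \<comment> \<open>An interval lies on a single circle, where the inverse area is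
      constant.\<close>
    have "equidistributed (\<lambda>x. inverse ((r\<^sup>2) ^ k0) *\<^sub>R f x)"
      by (intro equidistributed_compose[OF _ ef] bounded_linear_scaleR_right)
    moreover have "inverse ((r\<^sup>2) ^ k0) *\<^sub>R f x = inverse_area x *\<^sub>R f x" for x
      using k0[of x] by (cases "x \<in> I") (auto simp: I(2) inverse_area_def)
    ultimately show ?thesis by simp
  qed
  \<comment> \<open>\<open>equidistributed_continuous\<close> concerns complex functions, hence the
    passage through real parts.\<close>
  have "equidistributed (\<lambda>x. complex_of_real (inverse_area x))"
    by (intro equidistributed_continuous continuous_intros continuous_on_inverse_area)
  from equidistributed_compose[OF bounded_linear_Re this]
  have ei: "equidistributed inverse_area" by simp
  show "(\<lambda>n. tile_area_average c r f (S n)) \<longlonglongrightarrow> integral\<^sup>L (weighted_measure m \<rho>) f"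
    unfolding Sn area_average_supertile[OF x] mean_def[symmetric]
    by (rule averaging_power_tendsto[OF ef j xX])
  have "mean inverse_area \<noteq> 0"
    unfolding mean_inverse_area using sum_\<rho>_inverse_area_pos by simp
  then show "(\<lambda>n. tile_average c r f (S n)) \<longlonglongrightarrow> integral\<^sup>L (weighted_measure m \<nu>) f"
    unfolding Sn average_supertile[OF x] using ef eg
    by (subst integral_\<nu>) (auto simp: equidistributed_def intro!: tendsto_intros averaging_power_tendsto[OF _ j xX] ei)
qed

end

theorem theorem7:
  fixes p q m :: nat and a b c r :: real
    and f :: "nat \<times> bool \<times> complex \<Rightarrow> complex"
    and S :: "nat \<Rightarrow> tile multiset"
  assumes "p > 0" "q > 0" "coprime p q" "real p / real q \<noteq> 1 / 3"
    and "a > 0" "b > 0" "c > 0" "a\<^sup>2 + b\<^sup>2 = c\<^sup>2"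
    and "ln (a / c) / ln (b / (2 * c)) = real p / real q"
    and "m = max p q"
    and "r = (a / c) powr (1 / real p)" "r = (b / (2 * c)) powr (1 / real q)"
    and "supertile_sequence a b c r m S"
    and "continuous_on (tile_space m) f \<or> (\<exists>I. interval_of m I \<and> f = indicator I)"
  shows "(\<lambda>n. tile_average c r f (S n))
           \<longlonglongrightarrow> integral\<^sup>L (weighted_measure m (nu p q a b c r)) f \<and>
         (\<lambda>n. tile_area_average c r f (S n))
           \<longlonglongrightarrow> integral\<^sup>L (weighted_measure m (rho p q a b)) f"
proof -
  have "r > 0" using assms(5,7) by (simp add: assms(11))
  have "r ^ p = a / c"
    using assms(1,5,7) by (simp add: assms(11) powr_powr flip: powr_realpow)
  moreover have "r ^ q = b / (2 * c)"
    using assms(2,6,7) by (simp add: assms(12) powr_powr flip: powr_realpow)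
  moreover have "q \<noteq> 3 * p"
    using assms(1,4) by auto
  ultimately interpret pinwheel p q m a b c r
    using assms(1-8,10) \<open>r > 0\<close> by unfold_locales
  show ?thesis
    using supertile_averages_tendsto[OF assms(13,14)] by (simp add: \<nu>_def \<rho>_def)
qed

end
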